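(* Let $R$ be a ring, $N\geqslant 0$ an integer, and $M$ an $N$-nilpotent $R$-bimodule, with tensor ring $T_R(M)$. Consider the statements: (i) $M$ is finitely generated as an $R$-module and $T_R(M)$ is left coherent. (ii) $M$ is finitely presented as an $R$-module and $R$ is left coherent. Then (i) implies (ii). Furthermore, if $M$ is flat as an $R^{\mathrm{op}}$-module, then (i) and (ii) are equivalent.
   Context: All rings are nonzero, associative and unital; modules are unitary. An $R$-module is a left $R$-module; right $R$-modules are viewed as $R^{\mathrm{op}}$-modules. For an $R$-bimodule $M$ put $M^{\otimes_R 0}=R$ and $M^{\otimes_R(i+1)}=M\otimes_R M^{\otimes_R i}$. $M$ is $N$-nilpotent if $M^{\otimes_R(N+1)}=0$. The tensor ring is $T_R(M)=\bigoplus_{i=0}^N M^{\otimes_R i}$, with multiplication induced by $M^{\otimes_R n}\otimes_R M^{\otimes_R m}\cong M^{\otimes_R(n+m)}$. *)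

theory Defs
  imports
    "HOL-Algebra.Module"
    "HOL-Algebra.Coset"
    "HOL-Algebra.Free_Abelian_Groups"
    "HOL-Library.FSet"
begin

section \<open>Modules over rings that need not be commutative\<close>

text \<open>
  The locale \<^locale>\<open>module\<close> of the library requires a commutative ring.  The record
  type \<^typ>\<open>('a, 'b) module\<close> and the locale \<^locale>\<open>submodule\<close> do not, and are
  reused; as in the library, the fields \<^const>\<open>monoid.mult\<close> and \<^const>\<open>monoid.one\<close> of
  a module record are meaningless.
\<close>

locale left_module = R?: ring R + M?: abelian_group M
  for R :: "('r, 'x) ring_scheme" (structure)
    and M :: "('r, 'm, 'y) module_scheme" (structure) +
  assumes smult_closed:
      "\<lbrakk>a \<in> carrier R; x \<in> carrier M\<rbrakk> \<Longrightarrow> a \<odot>\<^bsub>M\<^esub> x \<in> carrier M"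
    and smult_l_distr:
      "\<lbrakk>a \<in> carrier R; b \<in> carrier R; x \<in> carrier M\<rbrakk>
        \<Longrightarrow> (a \<oplus> b) \<odot>\<^bsub>M\<^esub> x = a \<odot>\<^bsub>M\<^esub> x \<oplus>\<^bsub>M\<^esub> b \<odot>\<^bsub>M\<^esub> x"
    and smult_r_distr:
      "\<lbrakk>a \<in> carrier R; x \<in> carrier M; y \<in> carrier M\<rbrakk>
        \<Longrightarrow> a \<odot>\<^bsub>M\<^esub> (x \<oplus>\<^bsub>M\<^esub> y) = a \<odot>\<^bsub>M\<^esub> x \<oplus>\<^bsub>M\<^esub> a \<odot>\<^bsub>M\<^esub> y"
    and smult_assoc:
      "\<lbrakk>a \<in> carrier R; b \<in> carrier R; x \<in> carrier M\<rbrakk>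
        \<Longrightarrow> (a \<otimes> b) \<odot>\<^bsub>M\<^esub> x = a \<odot>\<^bsub>M\<^esub> (b \<odot>\<^bsub>M\<^esub> x)"
    and smult_one: "x \<in> carrier M \<Longrightarrow> \<one> \<odot>\<^bsub>M\<^esub> x = x"

definition left_module_hom ::
  "('r, 'x) ring_scheme \<Rightarrow> ('r, 'm, 'y) module_scheme \<Rightarrow> ('r, 'n, 'z) module_scheme
    \<Rightarrow> ('m \<Rightarrow> 'n) set" where
  "left_module_hom R M N =
    {f \<in> carrier M \<rightarrow> carrier N.
      (\<forall>x\<in>carrier M. \<forall>y\<in>carrier M. f (x \<oplus>\<^bsub>M\<^esub> y) = f x \<oplus>\<^bsub>N\<^esub> f y) \<and>
      (\<forall>r\<in>carrier R. \<forall>x\<in>carrier M. f (r \<odot>\<^bsub>M\<^esub> x) = r \<odot>\<^bsub>N\<^esub> f x)}"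

definition regular_module :: "('r, 'x) ring_scheme \<Rightarrow> ('r, 'r) module" where
  "regular_module R =
    \<lparr>carrier = carrier R, mult = undefined, one = undefined,
     ring.zero = \<zero>\<^bsub>R\<^esub>, add = add R, smult = monoid.mult R\<rparr>"

definition free_module :: "('r, 'x) ring_scheme \<Rightarrow> nat \<Rightarrow> ('r, nat \<Rightarrow> 'r) module" where
  "free_module R n =
    \<lparr>carrier = {..<n} \<rightarrow>\<^sub>E carrier R, mult = undefined, one = undefined,
     ring.zero = (\<lambda>i\<in>{..<n}. \<zero>\<^bsub>R\<^esub>),
     add = (\<lambda>u v. \<lambda>i\<in>{..<n}. u i \<oplus>\<^bsub>R\<^esub> v i),
     smult = (\<lambda>r u. \<lambda>i\<in>{..<n}. r \<otimes>\<^bsub>R\<^esub> u i)\<rparr>"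

definition module_span ::
  "('r, 'x) ring_scheme \<Rightarrow> ('r, 'm, 'y) module_scheme \<Rightarrow> 'm set \<Rightarrow> 'm set" where
  "module_span R M S = \<Inter>{H. submodule H R M \<and> S \<subseteq> H}"

definition finitely_generated ::
  "('r, 'x) ring_scheme \<Rightarrow> ('r, 'm, 'y) module_scheme \<Rightarrow> bool" where
  "finitely_generated R M \<longleftrightarrow>
    (\<exists>S. finite S \<and> S \<subseteq> carrier M \<and> module_span R M S = carrier M)"

definition finitely_presented ::
  "('r, 'x) ring_scheme \<Rightarrow> ('r, 'm, 'y) module_scheme \<Rightarrow> bool" where
  "finitely_presented R M \<longleftrightarrow>
    (\<exists>n. \<exists>f \<in> left_module_hom R (free_module R n) M.
      f ` carrier (free_module R n) = carrier M \<and>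
      finitely_generated R
        ((free_module R n)\<lparr>carrier := {v \<in> carrier (free_module R n). f v = \<zero>\<^bsub>M\<^esub>}\<rparr>))"

text \<open>The left ideals of \<open>R\<close> are the submodules of \<open>R\<close> as a left module.\<close>

definition left_coherent :: "('r, 'x) ring_scheme \<Rightarrow> bool" where
  "left_coherent R \<longleftrightarrow>
    (\<forall>I. submodule I R (regular_module R) \<longrightarrow>
      finitely_generated R ((regular_module R)\<lparr>carrier := I\<rparr>) \<longrightarrow>
      finitely_presented R ((regular_module R)\<lparr>carrier := I\<rparr>))"


section \<open>Right modules and bimodules\<close>

definition opposite_ring :: "'r ring \<Rightarrow> 'r ring" where
  "opposite_ring R = R\<lparr>mult := \<lambda>x y. y \<otimes>\<^bsub>R\<^esub> x\<rparr>"

record ('r, 'm) bimodule = "('r, 'm) module" +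
  rsmult :: "'m \<Rightarrow> 'r \<Rightarrow> 'm"

text \<open>The right module underlying a bimodule, as a left module over the opposite ring.\<close>

definition op_module :: "('r, 'm) bimodule \<Rightarrow> ('r, 'm) module" where
  "op_module M =
    \<lparr>carrier = carrier M, mult = monoid.mult M, one = monoid.one M,
     ring.zero = \<zero>\<^bsub>M\<^esub>, add = add M, smult = (\<lambda>r x. rsmult M x r)\<rparr>"

locale bimodule = left_module R M
  for R :: "'r ring" (structure) and M :: "('r, 'm) bimodule" (structure) +
  assumes right_module: "left_module (opposite_ring R) (op_module M)"
    and smult_rsmult:
      "\<lbrakk>a \<in> carrier R; b \<in> carrier R; x \<in> carrier M\<rbrakk>
        \<Longrightarrow> rsmult M (a \<odot>\<^bsub>M\<^esub> x) b = a \<odot>\<^bsub>M\<^esub> rsmult M x b"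


section \<open>Tensor products\<close>

text \<open>
  In this section \<open>A\<close> is a right \<open>R\<close>-module, that is, \<open>a r\<close> is written
  \<open>smult A r a\<close>, and \<open>B\<close> is a left \<open>R\<close>-module.
\<close>

definition tensor_relators ::
  "'r ring \<Rightarrow> ('r, 'a) module \<Rightarrow> ('r, 'b) module \<Rightarrow> ('a \<times> 'b \<Rightarrow>\<^sub>0 int) set" where
  "tensor_relators R A B =
    {frag_of (a \<oplus>\<^bsub>A\<^esub> a', b) - frag_of (a, b) - frag_of (a', b) | a a' b.
      a \<in> carrier A \<and> a' \<in> carrier A \<and> b \<in> carrier B} \<union>
    {frag_of (a, b \<oplus>\<^bsub>B\<^esub> b') - frag_of (a, b) - frag_of (a, b') | a b b'.
      a \<in> carrier A \<and> b \<in> carrier B \<and> b' \<in> carrier B} \<union>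
    {frag_of (r \<odot>\<^bsub>A\<^esub> a, b) - frag_of (a, r \<odot>\<^bsub>B\<^esub> b) | r a b.
      r \<in> carrier R \<and> a \<in> carrier A \<and> b \<in> carrier B}"

definition tensor_kernel ::
  "'r ring \<Rightarrow> ('r, 'a) module \<Rightarrow> ('r, 'b) module \<Rightarrow> ('a \<times> 'b \<Rightarrow>\<^sub>0 int) set" where
  "tensor_kernel R A B =
    generate (free_Abelian_group (carrier A \<times> carrier B)) (tensor_relators R A B)"

abbreviation tensor_quotient ::
  "'r ring \<Rightarrow> ('r, 'a) module \<Rightarrow> ('r, 'b) module \<Rightarrow> ('a \<times> 'b \<Rightarrow>\<^sub>0 int) set monoid" where
  "tensor_quotient R A B \<equiv>
    free_Abelian_group (carrier A \<times> carrier B) Mod tensor_kernel R A B"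

definition tensor_group ::
  "'r ring \<Rightarrow> ('r, 'a) module \<Rightarrow> ('r, 'b) module \<Rightarrow> ('a \<times> 'b \<Rightarrow>\<^sub>0 int) set ring" where
  "tensor_group R A B =
    \<lparr>carrier = carrier (tensor_quotient R A B), mult = undefined, one = undefined,
     ring.zero = \<one>\<^bsub>tensor_quotient R A B\<^esub>, add = monoid.mult (tensor_quotient R A B)\<rparr>"

definition pure_tensor ::
  "'r ring \<Rightarrow> ('r, 'a) module \<Rightarrow> ('r, 'b) module \<Rightarrow> 'a \<Rightarrow> 'b
    \<Rightarrow> ('a \<times> 'b \<Rightarrow>\<^sub>0 int) set" where
  "pure_tensor R A B a b =
    tensor_kernel R A B #>\<^bsub>free_Abelian_group (carrier A \<times> carrier B)\<^esub> frag_of (a, b)"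

text \<open>
  For a biadditive map \<open>\<phi>\<close> into \<open>C\<close> with \<open>\<phi> (a r) b = \<phi> a (r b)\<close>,
  \<open>tensor_lift C \<phi>\<close> is the additive map with \<open>pure_tensor R A B a b \<mapsto> \<phi> a b\<close>:
  it is evaluated at an arbitrary representative of the coset \<open>c\<close>.
\<close>

definition tensor_lift ::
  "('c, 'z) ring_scheme \<Rightarrow> ('a \<Rightarrow> 'b \<Rightarrow> 'c) \<Rightarrow> ('a \<times> 'b \<Rightarrow>\<^sub>0 int) set \<Rightarrow> 'c" where
  "tensor_lift C \<phi> c =
    (let f = (SOME f. f \<in> c) in
      \<Oplus>\<^bsub>C\<^esub>p\<in>Poly_Mapping.keys f. [Poly_Mapping.lookup f p] \<cdot>\<^bsub>C\<^esub> \<phi> (fst p) (snd p))"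

definition tensor_map ::
  "'r ring \<Rightarrow> ('r, 'a) module \<Rightarrow> ('r, 'b) module \<Rightarrow> ('b' \<Rightarrow> 'b)
    \<Rightarrow> ('a \<times> 'b' \<Rightarrow>\<^sub>0 int) set \<Rightarrow> ('a \<times> 'b \<Rightarrow>\<^sub>0 int) set" where
  "tensor_map R A B f =
    tensor_lift (tensor_group R A B) (\<lambda>a b. pure_tensor R A B a (f b))"

text \<open>
  Flatness of a right \<open>R\<close>-module \<open>A\<close>: the functor \<open>A \<otimes>\<^sub>R -\<close> preserves injective
  homomorphisms of left \<open>R\<close>-modules.  A definition cannot quantify over types, so the
  modules range over those with carrier in \<^typ>\<open>(nat \<Rightarrow> 'r) set\<close>.  Up to isomorphism these
  include all countably generated left \<open>R\<close>-modules (as sets of cosets of functions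
  with finite support).  Since a violation of injectivity involves only finitely many elements of
  the two modules, this is no restriction.
\<close>

definition flat_right_module :: "'r ring \<Rightarrow> ('r, 'a) module \<Rightarrow> bool" where
  "flat_right_module R A \<longleftrightarrow>
    (\<forall>(B :: ('r, (nat \<Rightarrow> 'r) set) module) (B' :: ('r, (nat \<Rightarrow> 'r) set) module).
      \<forall>f \<in> left_module_hom R B B'.
        left_module R B \<longrightarrow> left_module R B' \<longrightarrow> inj_on f (carrier B) \<longrightarrow>
        inj_on (tensor_map R A B' f) (carrier (tensor_group R A B)))"

text \<open>The left \<open>R\<close>-module \<open>M \<otimes>\<^sub>R B\<close> for a bimodule \<open>M\<close>, with \<open>r (m \<otimes> b) = r m \<otimes> b\<close>.\<close>

definition tensor_module ::
  "'r ring \<Rightarrow> ('r, 'm) bimodule \<Rightarrow> ('r, 'b) module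
    \<Rightarrow> ('r, ('m \<times> 'b \<Rightarrow>\<^sub>0 int) set) module" where
  "tensor_module R M B =
    \<lparr>carrier = carrier (tensor_group R (op_module M) B), mult = undefined, one = undefined,
     ring.zero = \<zero>\<^bsub>tensor_group R (op_module M) B\<^esub>,
     add = add (tensor_group R (op_module M) B),
     smult = (\<lambda>r. tensor_lift (tensor_group R (op_module M) B)
                    (\<lambda>m b. pure_tensor R (op_module M) B (r \<odot>\<^bsub>M\<^esub> m) b))\<rparr>"


section \<open>Tensor powers and the tensor ring\<close>

text \<open>
  The recursion \<open>M\<^sup>0 = R\<close>, \<open>M\<^sup>i\<^sup>+\<^sup>1 = M \<otimes>\<^sub>R M\<^sup>i\<close> changes the type of the
  elements at each step.  To have all powers in one type, the elements are renamed:
  an element of \<open>M\<^sup>0\<close> is \<open>Scalar r\<close>, and a coset of formal sums of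
  pairs is named by the graph of one representative.  The module structure is transported
  along this renaming, which is injective by \<open>inj_on_tensor_code\<close> below.
\<close>

datatype ('r, 'm) tensor_term =
    Scalar (scalar_of: 'r)
  | Formal_Sum "(('m \<times> ('r, 'm) tensor_term) \<times> int) fset"

definition tensor_code ::
  "('m \<times> ('r, 'm) tensor_term \<Rightarrow>\<^sub>0 int) set \<Rightarrow> ('r, 'm) tensor_term" where
  "tensor_code c =
    (let f = (SOME f. f \<in> c) in
      Formal_Sum (Abs_fset ((\<lambda>p. (p, Poly_Mapping.lookup f p)) ` Poly_Mapping.keys f)))"

definition transport_module ::
  "('a \<Rightarrow> 'b) \<Rightarrow> ('r, 'a) module \<Rightarrow> ('r, 'b) module" where
  "transport_module h A =
    (let g = the_inv_into (carrier A) h in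
      \<lparr>carrier = h ` carrier A, mult = undefined, one = undefined,
       ring.zero = h \<zero>\<^bsub>A\<^esub>,
       add = (\<lambda>x y. h (g x \<oplus>\<^bsub>A\<^esub> g y)),
       smult = (\<lambda>r x. h (r \<odot>\<^bsub>A\<^esub> g x))\<rparr>)"

primrec tensor_power ::
  "'r ring \<Rightarrow> ('r, 'm) bimodule \<Rightarrow> nat \<Rightarrow> ('r, ('r, 'm) tensor_term) module" where
  "tensor_power R M 0 = transport_module Scalar (regular_module R)"
| "tensor_power R M (Suc i) =
    transport_module tensor_code (tensor_module R M (tensor_power R M i))"

definition nilpotent_bimodule :: "'r ring \<Rightarrow> ('r, 'm) bimodule \<Rightarrow> nat \<Rightarrow> bool" where
  "nilpotent_bimodule R M N \<longleftrightarrow>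
    carrier (tensor_power R M (N + 1)) = {\<zero>\<^bsub>tensor_power R M (N + 1)\<^esub>}"

text \<open>
  The isomorphism \<open>M\<^sup>n \<otimes>\<^sub>R M\<^sup>m \<cong> M\<^sup>n\<^sup>+\<^sup>m\<close> as a balanced map
  \<open>tensor_mult R M n m\<close> on \<open>M\<^sup>n \<times> M\<^sup>m\<close>:
  \<open>r \<cdot> y = r y\<close> for \<open>r \<in> R = M\<^sup>0\<close>, and \<open>(a \<otimes> z) \<cdot> y = a \<otimes> (z \<cdot> y)\<close>
  for \<open>a \<in> M\<close>, \<open>z \<in> M\<^sup>n\<close>.
\<close>

primrec tensor_mult ::
  "'r ring \<Rightarrow> ('r, 'm) bimodule \<Rightarrow> nat \<Rightarrow> nat
    \<Rightarrow> ('r, 'm) tensor_term \<Rightarrow> ('r, 'm) tensor_term \<Rightarrow> ('r, 'm) tensor_term" where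
  "tensor_mult R M 0 = (\<lambda>m x y. scalar_of x \<odot>\<^bsub>tensor_power R M m\<^esub> y)"
| "tensor_mult R M (Suc n) = (\<lambda>m x y.
    tensor_lift (tensor_power R M (Suc (n + m)))
      (\<lambda>a z. tensor_code
        (pure_tensor R (op_module M) (tensor_power R M (n + m)) a (tensor_mult R M n m z y)))
      (the_inv_into (carrier (tensor_module R M (tensor_power R M n))) tensor_code x))"

text \<open>Products landing in a degree above \<open>N\<close> are dropped: those powers are zero.\<close>

definition tensor_ring ::
  "'r ring \<Rightarrow> ('r, 'm) bimodule \<Rightarrow> nat \<Rightarrow> (nat \<Rightarrow> ('r, 'm) tensor_term) ring" where
  "tensor_ring R M N =
    \<lparr>carrier = (\<Pi>\<^sub>E i\<in>{..N}. carrier (tensor_power R M i)),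
     mult = (\<lambda>u v. \<lambda>k\<in>{..N}.
       \<Oplus>\<^bsub>tensor_power R M k\<^esub>i\<in>{..k}. tensor_mult R M i (k - i) (u i) (v (k - i))),
     one = (\<lambda>k\<in>{..N}. if k = 0 then Scalar \<one>\<^bsub>R\<^esub> else \<zero>\<^bsub>tensor_power R M k\<^esub>),
     ring.zero = (\<lambda>k\<in>{..N}. \<zero>\<^bsub>tensor_power R M k\<^esub>),
     add = (\<lambda>u v. \<lambda>k\<in>{..N}. u k \<oplus>\<^bsub>tensor_power R M k\<^esub> v k)\<rparr>"


section \<open>The renaming of tensors is injective\<close>

lemma tensor_kernel_subgroup:
  assumes "bimodule R M" "left_module R B"
  shows "subgroup (tensor_kernel R (op_module M) B)
    (free_Abelian_group (carrier (op_module M) \<times> carrier B))"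
proof -
  interpret M: bimodule R M by fact
  interpret B: left_module R B by fact
  interpret Mop: left_module "opposite_ring R" "op_module M" by (rule M.right_module)
  have Mop: "r \<odot>\<^bsub>op_module M\<^esub> a \<in> carrier (op_module M)"
    if "r \<in> carrier R" "a \<in> carrier (op_module M)" for r a
    using Mop.smult_closed[of r a] that by (simp add: opposite_ring_def)
  have diff: "f - g \<in> carrier (free_Abelian_group S)"
    if "f \<in> carrier (free_Abelian_group S)" "g \<in> carrier (free_Abelian_group S)"
    for f g :: "'b \<times> 'd \<Rightarrow>\<^sub>0 int" and S
    using that keys_diff[of f g] by auto
  have "tensor_relators R (op_module M) B
      \<subseteq> carrier (free_Abelian_group (carrier (op_module M) \<times> carrier B))"
    unfolding tensor_relators_def
    by (auto intro!: diff simp: Mop B.smult_closed Mop.M.add.m_closed simp del: carrier_free_Abelian_group_iff)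
  then show ?thesis
    unfolding tensor_kernel_def
    by (intro group.generate_is_subgroup) auto
qed

lemma Formal_Sum_graph_eq_iff:
  fixes f g :: "'m \<times> ('r, 'm) tensor_term \<Rightarrow>\<^sub>0 int"
  shows "Formal_Sum (Abs_fset ((\<lambda>p. (p, Poly_Mapping.lookup f p)) ` Poly_Mapping.keys f))
       = Formal_Sum (Abs_fset ((\<lambda>p. (p, Poly_Mapping.lookup g p)) ` Poly_Mapping.keys g))
     \<longleftrightarrow> f = g"
proof
  assume "Formal_Sum (Abs_fset ((\<lambda>p. (p, Poly_Mapping.lookup f p)) ` Poly_Mapping.keys f))
       = Formal_Sum (Abs_fset ((\<lambda>p. (p, Poly_Mapping.lookup g p)) ` Poly_Mapping.keys g))"
  then have *: "(\<lambda>p. (p, Poly_Mapping.lookup f p)) ` Poly_Mapping.keys f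
       = (\<lambda>p. (p, Poly_Mapping.lookup g p)) ` Poly_Mapping.keys g"
    by (simp add: Abs_fset_inject)
  show "f = g"
  proof (rule poly_mapping_eqI)
    fix p
    have "(p, k) \<in> (\<lambda>p. (p, Poly_Mapping.lookup f p)) ` Poly_Mapping.keys f
       \<longleftrightarrow> (p, k) \<in> (\<lambda>p. (p, Poly_Mapping.lookup g p)) ` Poly_Mapping.keys g" for k
      by (simp only: *)
    then have eq: "(p \<in> Poly_Mapping.keys f \<and> k = Poly_Mapping.lookup f p)
       \<longleftrightarrow> (p \<in> Poly_Mapping.keys g \<and> k = Poly_Mapping.lookup g p)" for k
      by (auto simp: image_iff)
    show "Poly_Mapping.lookup f p = Poly_Mapping.lookup g p"
    proof (cases "p \<in> Poly_Mapping.keys f")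
      case True
      then show ?thesis using eq by blast
    next
      case False
      then have "p \<notin> Poly_Mapping.keys g" using eq by blast
      with False show ?thesis by (simp add: in_keys_iff)
    qed
  qed
qed simp

lemma inj_on_tensor_code:
  assumes "bimodule R M" "left_module R B"
  shows "inj_on tensor_code (carrier (tensor_module R M B))"
proof (rule inj_onI)
  let ?F = "free_Abelian_group (carrier (op_module M) \<times> carrier B)"
  let ?K = "tensor_kernel R (op_module M) B"
  fix c d
  assume c: "c \<in> carrier (tensor_module R M B)" and d: "d \<in> carrier (tensor_module R M B)"
    and eq: "tensor_code c = tensor_code d"
  interpret F: group ?F by simp
  have K: "subgroup ?K ?F" using assms by (rule tensor_kernel_subgroup)
  have c': "c \<in> rcosets\<^bsub>?F\<^esub> ?K" and d': "d \<in> rcosets\<^bsub>?F\<^esub> ?K"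
    using c d by (simp_all add: tensor_module_def tensor_group_def FactGroup_def)
  have "c \<noteq> {}" "d \<noteq> {}"
    using subgroup.rcosets_non_empty[OF K] c' d' by blast+
  then have "(SOME f. f \<in> c) \<in> c" "(SOME f. f \<in> d) \<in> d"
    by (simp_all add: some_in_eq)
  moreover have "(SOME f. f \<in> c) = (SOME f. f \<in> d)"
    using eq unfolding tensor_code_def Let_def Formal_Sum_graph_eq_iff .
  ultimately have "c \<inter> d \<noteq> {}" by auto
  then show "c = d"
    using F.rcos_disjoint[OF K] c' d' by (auto simp: pairwise_def disjnt_def)
qed

end

theory Submission
  imports Defs
begin

text \<open>
  Write \<open>T\<close> for the tensor ring and \<open>M\<^sup>i\<close> for the tensor powers. Two ring homomorphisms carry
  the argument, the inclusion \<open>\<iota> : R \<rightarrow> T\<close> of the degree \<open>0\<close> part and the augmentation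
  \<open>\<pi> : T \<rightarrow> R\<close>, with \<open>\<pi> \<circ> \<iota> = id\<close>.

  Call a module \<open>X\<close> pseudo-coherent if every homomorphism from a finite free module to \<open>X\<close> has
  a finitely generated kernel. By Schanuel's argument (\<open>fg_kernel_of_finitely_presented\<close>) a
  ring is left coherent iff it is pseudo-coherent as a left module over itself
  (\<open>left_coherent_iff\<close>), and over a left coherent ring a module is finitely presented iff it is
  finitely generated and pseudo-coherent (\<open>finitely_presented_iff_pseudo_coherent\<close>).

  From \<open>T\<close> to \<open>R\<close>: let \<open>X\<close> be \<open>R\<close> or, if \<open>N > 0\<close>, the module \<open>M\<close>, embedded in \<open>T\<close> as the
  component of degree \<open>0\<close> or \<open>1\<close>. Relations over \<open>R\<close> between elements \<open>x\<^sub>1, \<dots>, x\<^sub>n\<close> of \<open>X\<close> are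
  relations over \<open>T\<close> between their images. Conversely, the component of lowest degree of a
  relation over \<open>T\<close> shows that \<open>\<pi>\<close>, applied to the coefficients, gives a relation over \<open>R\<close>. So
  \<open>\<pi>\<close> maps the \<open>T\<close>-module of relations onto the \<open>R\<close>-module of relations, and finite generation
  descends (\<open>pseudo_coherent_descent\<close>). If \<open>N = 0\<close>, then \<open>M = 0\<close>, because
  \<open>M \<cong> M \<otimes>\<^sub>R R = M\<^sup>1 = 0\<close>.

  From \<open>R\<close> to \<open>T\<close>: if \<open>M\<close> and \<open>X\<close> are finitely generated and pseudo-coherent, then so is
  \<open>M \<otimes>\<^sub>R X\<close>: for generators \<open>x\<^sub>1, \<dots>, x\<^sub>n\<close> of \<open>X\<close> it is the quotient of the direct sum of \<open>n\<close>
  copies of \<open>M\<close> by the submodule spanned by the \<open>(m k\<^sub>1, \<dots>, m k\<^sub>n)\<close> with \<open>m\<close> a generator of \<open>M\<close>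
  and \<open>k\<close> a generator of the relations between the \<open>x\<^sub>j\<close> (\<open>pseudo_coherent_power_Suc\<close>). Hence
  all \<open>M\<^sup>i\<close> are finitely generated and pseudo-coherent over \<open>R\<close>. The kernel of a homomorphism
  of left \<open>T\<close>-modules from a finite free module to \<open>T\<close> is the common kernel of its \<open>N + 1\<close>
  components, which are \<open>R\<close>-linear maps to the \<open>M\<^sup>i\<close> from a finitely generated \<open>R\<close>-module. It
  is therefore finitely generated over \<open>R\<close> (\<open>fg_common_kernel\<close>), and a fortiori over \<open>T\<close>.
\<close>

section \<open>Additive maps, submodules and finite generation\<close>

abbreviation additive_hom ::
  "('a, 'x) ring_scheme \<Rightarrow> ('b, 'y) ring_scheme \<Rightarrow> ('a \<Rightarrow> 'b) set" where
  "additive_hom X Y \<equiv> hom (add_monoid X) (add_monoid Y)"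

lemma additive_homI:
  assumes "\<And>x. x \<in> carrier X \<Longrightarrow> f x \<in> carrier Y"
    and "\<And>x y. \<lbrakk>x \<in> carrier X; y \<in> carrier X\<rbrakk> \<Longrightarrow> f (x \<oplus>\<^bsub>X\<^esub> y) = f x \<oplus>\<^bsub>Y\<^esub> f y"
  shows "f \<in> additive_hom X Y"
  using assms by (auto simp: hom_def)

lemma additive_homD:
  assumes "f \<in> additive_hom X Y"
  shows "\<And>x. x \<in> carrier X \<Longrightarrow> f x \<in> carrier Y"
    and "\<And>x y. \<lbrakk>x \<in> carrier X; y \<in> carrier X\<rbrakk> \<Longrightarrow> f (x \<oplus>\<^bsub>X\<^esub> y) = f x \<oplus>\<^bsub>Y\<^esub> f y"
  using assms by (auto simp: hom_def)

lemma additive_hom_zero: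
  assumes "f \<in> additive_hom X Y" "abelian_group X" "abelian_group Y"
  shows "f \<zero>\<^bsub>X\<^esub> = \<zero>\<^bsub>Y\<^esub>"
proof -
  interpret group_hom "add_monoid X" "add_monoid Y" f
    using assms by (intro group_hom.intro group_hom_axioms.intro abelian_group.a_group)
  show ?thesis using hom_one by simp
qed

lemma additive_hom_inv:
  assumes "f \<in> additive_hom X Y" "abelian_group X" "abelian_group Y" "x \<in> carrier X"
  shows "f (\<ominus>\<^bsub>X\<^esub> x) = \<ominus>\<^bsub>Y\<^esub> f x"
proof -
  interpret group_hom "add_monoid X" "add_monoid Y" f
    using assms by (intro group_hom.intro group_hom_axioms.intro abelian_group.a_group)
  show ?thesis using hom_inv assms(4) by (simp add: a_inv_def)
qed

lemma additive_hom_minus: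
  assumes "f \<in> additive_hom X Y" "abelian_group X" "abelian_group Y"
    and "x \<in> carrier X" "y \<in> carrier X"
  shows "f (x \<ominus>\<^bsub>X\<^esub> y) = f x \<ominus>\<^bsub>Y\<^esub> f y"
proof -
  interpret X: abelian_group X by fact
  show ?thesis
    using assms by (simp add: a_minus_def additive_homD(2)[OF assms(1)] additive_hom_inv)
qed

lemma left_module_homI:
  assumes "f \<in> additive_hom X Y"
    and "\<And>r x. \<lbrakk>r \<in> carrier R; x \<in> carrier X\<rbrakk> \<Longrightarrow> f (r \<odot>\<^bsub>X\<^esub> x) = r \<odot>\<^bsub>Y\<^esub> f x"
  shows "f \<in> left_module_hom R X Y"
  using assms by (auto simp: hom_def left_module_hom_def)

lemma left_module_homD:
  assumes "f \<in> left_module_hom R X Y"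
  shows "f \<in> additive_hom X Y"
    and "\<And>r x. \<lbrakk>r \<in> carrier R; x \<in> carrier X\<rbrakk> \<Longrightarrow> f (r \<odot>\<^bsub>X\<^esub> x) = r \<odot>\<^bsub>Y\<^esub> f x"
  using assms by (auto simp: hom_def left_module_hom_def)

lemma left_module_hom_compose:
  assumes "f \<in> left_module_hom R X Y" "g \<in> left_module_hom R Y Z"
  shows "(\<lambda>x. g (f x)) \<in> left_module_hom R X Z"
  using assms by (auto simp: left_module_hom_def Pi_iff)

context left_module
begin

lemma smult_zero_right: "r \<in> carrier R \<Longrightarrow> r \<odot>\<^bsub>M\<^esub> \<zero>\<^bsub>M\<^esub> = \<zero>\<^bsub>M\<^esub>"
  by (rule additive_hom_zero[where f = "\<lambda>x. r \<odot>\<^bsub>M\<^esub> x"])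
    (auto intro!: additive_homI smult_closed smult_r_distr M.abelian_group_axioms)

lemma smult_zero_left: "x \<in> carrier M \<Longrightarrow> \<zero> \<odot>\<^bsub>M\<^esub> x = \<zero>\<^bsub>M\<^esub>"
  by (rule additive_hom_zero[where f = "\<lambda>r. r \<odot>\<^bsub>M\<^esub> x" and X = R])
    (auto intro!: additive_homI smult_closed smult_l_distr M.abelian_group_axioms R.abelian_group_axioms)

lemma smult_minus_one: "x \<in> carrier M \<Longrightarrow> (\<ominus> \<one>) \<odot>\<^bsub>M\<^esub> x = \<ominus>\<^bsub>M\<^esub> x"
  using additive_hom_inv[where f = "\<lambda>r. r \<odot>\<^bsub>M\<^esub> x" and X = R and Y = M and x = \<one>]
  by (auto intro!: additive_homI smult_closed smult_l_distr M.abelian_group_axioms R.abelian_group_axioms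
      simp: smult_one)

lemma submodule_iff:
  "submodule H R M \<longleftrightarrow> H \<subseteq> carrier M \<and> \<zero>\<^bsub>M\<^esub> \<in> H \<and> (\<forall>x\<in>H. \<forall>y\<in>H. x \<oplus>\<^bsub>M\<^esub> y \<in> H)
    \<and> (\<forall>r\<in>carrier R. \<forall>x\<in>H. r \<odot>\<^bsub>M\<^esub> x \<in> H)" (is "_ = ?rhs")
proof
  assume "submodule H R M"
  then interpret submodule H R M .
  show ?rhs using subset m_closed one_closed smult_closed by auto
next
  assume r: ?rhs
  show "submodule H R M"
  proof (intro submodule.intro subgroup.intro submodule_axioms.intro)
    fix x assume "x \<in> H"
    then have "\<ominus>\<^bsub>M\<^esub> x \<in> H"
      using r smult_minus_one[of x] R.add.inv_closed[OF R.one_closed] by (metis subsetD)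
    then show "inv\<^bsub>add_monoid M\<^esub> x \<in> H" by (simp add: a_inv_def)
  qed (use r in auto)
qed

lemma submodule_carrier: "submodule (carrier M) R M"
  by (auto simp: submodule_iff smult_closed)

lemma submodule_minus:
  assumes "submodule H R M" "x \<in> H" "y \<in> H" shows "x \<ominus>\<^bsub>M\<^esub> y \<in> H"
proof -
  have "y \<in> carrier M" using assms by (auto simp: submodule_iff)
  then have "\<ominus>\<^bsub>M\<^esub> y \<in> H"
    using assms smult_minus_one[of y] R.add.inv_closed[OF R.one_closed]
    by (metis submodule_iff)
  then show ?thesis using assms by (auto simp: submodule_iff a_minus_def)
qed

lemma left_module_submodule:
  assumes "submodule L R M"
  shows "left_module R (M\<lparr>carrier := L\<rparr>)"
proof -
  note L = assms[unfolded submodule_iff]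
  have neg: "\<exists>y\<in>L. y \<oplus>\<^bsub>M\<^esub> x = \<zero>\<^bsub>M\<^esub>" if "x \<in> L" for x
  proof -
    have "\<zero>\<^bsub>M\<^esub> \<ominus>\<^bsub>M\<^esub> x \<in> L" using submodule_minus[OF assms] that L by blast
    moreover have "(\<zero>\<^bsub>M\<^esub> \<ominus>\<^bsub>M\<^esub> x) \<oplus>\<^bsub>M\<^esub> x = \<zero>\<^bsub>M\<^esub>"
      using that L by (auto simp: a_minus_def M.l_neg subset_iff)
    ultimately show ?thesis by blast
  qed
  show ?thesis
    by (intro left_module.intro left_module_axioms.intro R.ring_axioms abelian_groupI)
      (use L neg in \<open>auto simp: smult_l_distr smult_r_distr smult_assoc smult_one subset_iff
        M.a_assoc intro: M.a_comm\<close>)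
qed

lemma submodule_preimage:
  assumes "left_module S Y" "\<sigma> \<in> carrier R \<rightarrow> carrier S" "q \<in> additive_hom M Y"
    and "\<And>r x. \<lbrakk>r \<in> carrier R; x \<in> carrier M\<rbrakk> \<Longrightarrow> q (r \<odot>\<^bsub>M\<^esub> x) = \<sigma> r \<odot>\<^bsub>Y\<^esub> q x"
    and "submodule H S Y"
  shows "submodule {x \<in> carrier M. q x \<in> H} R M"
proof -
  interpret Y: left_module S Y by fact
  note H = assms(5)[unfolded Y.submodule_iff]
  show ?thesis
    unfolding submodule_iff
    using H assms(2) additive_homD[OF assms(3)] assms(4)
      additive_hom_zero[OF assms(3) M.abelian_group_axioms Y.M.abelian_group_axioms]
    by (auto simp: smult_closed)
qed

end

lemma submodule_kernel:
  assumes "left_module R X" "left_module R Y" "f \<in> left_module_hom R X Y"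
  shows "submodule {x \<in> carrier X. f x = \<zero>\<^bsub>Y\<^esub>} R X"
proof -
  interpret X: left_module R X by fact
  interpret Y: left_module R Y by fact
  have "submodule {\<zero>\<^bsub>Y\<^esub>} R Y" by (auto simp: Y.submodule_iff Y.smult_zero_right)
  from X.submodule_preimage[OF assms(2) _ left_module_homD[OF assms(3)] this]
  show ?thesis by simp
qed

text \<open>
  The set \<open>L\<close> contains finitely many elements whose span contains \<open>L\<close>. For a submodule \<open>L\<close> this
  says that \<open>L\<close> is finitely generated, without passing to the module with carrier \<open>L\<close>.
\<close>

definition fg_subset ::
  "('r, 'x) ring_scheme \<Rightarrow> ('r, 'm, 'y) module_scheme \<Rightarrow> 'm set \<Rightarrow> bool" where
  "fg_subset R M L \<longleftrightarrow>
    (\<exists>S. finite S \<and> S \<subseteq> L \<and> (\<forall>H. submodule H R M \<longrightarrow> S \<subseteq> H \<longrightarrow> L \<subseteq> H))"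

lemma finitely_generated_submodule_iff:
  assumes "left_module R X" "submodule L R X"
  shows "finitely_generated R (X\<lparr>carrier := L\<rparr>) \<longleftrightarrow> fg_subset R X L"
proof -
  interpret X: left_module R X by fact
  interpret L: left_module R "X\<lparr>carrier := L\<rparr>" by (rule X.left_module_submodule) fact
  have sub: "submodule H R (X\<lparr>carrier := L\<rparr>) \<longleftrightarrow> submodule H R X \<and> H \<subseteq> L" for H
    using assms(2) by (auto simp: L.submodule_iff X.submodule_iff)
  have int: "submodule (H \<inter> L) R X" if "submodule H R X" for H
    using assms(2) that by (auto simp: X.submodule_iff)
  have "module_span R (X\<lparr>carrier := L\<rparr>) S = L
      \<longleftrightarrow> (\<forall>H. submodule H R X \<longrightarrow> S \<subseteq> H \<longrightarrow> L \<subseteq> H)" if S: "S \<subseteq> L" for S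
  proof
    assume span: "module_span R (X\<lparr>carrier := L\<rparr>) S = L"
    show "\<forall>H. submodule H R X \<longrightarrow> S \<subseteq> H \<longrightarrow> L \<subseteq> H"
    proof (intro allI impI)
      fix H assume "submodule H R X" "S \<subseteq> H"
      then have "module_span R (X\<lparr>carrier := L\<rparr>) S \<subseteq> H \<inter> L"
        unfolding module_span_def sub using int S by blast
      then show "L \<subseteq> H" using span by blast
    qed
  next
    assume *: "\<forall>H. submodule H R X \<longrightarrow> S \<subseteq> H \<longrightarrow> L \<subseteq> H"
    show "module_span R (X\<lparr>carrier := L\<rparr>) S = L"
      unfolding module_span_def sub using * S assms(2) by auto
  qed
  then show ?thesis
    unfolding finitely_generated_def fg_subset_def by auto
qed

lemma finitely_generated_iff:
  assumes "left_module R X"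
  shows "finitely_generated R X \<longleftrightarrow> fg_subset R X (carrier X)"
  using finitely_generated_submodule_iff[OF assms left_module.submodule_carrier[OF assms]]
  by simp

text \<open>
  Finite generation passes to images under maps that are semilinear along an arbitrary map \<open>\<sigma>\<close>
  of scalars. This covers homomorphisms, extension of scalars along \<open>R \<rightarrow> T\<close> (with \<open>q\<close> the
  identity) and the passage from \<open>T\<close> to \<open>R\<close> along the augmentation.
\<close>

lemma fg_subset_image:
  assumes "left_module R X" "left_module S Y" "\<sigma> \<in> carrier R \<rightarrow> carrier S" "q \<in> additive_hom X Y"
    and "\<And>r x. \<lbrakk>r \<in> carrier R; x \<in> carrier X\<rbrakk> \<Longrightarrow> q (r \<odot>\<^bsub>X\<^esub> x) = \<sigma> r \<odot>\<^bsub>Y\<^esub> q x"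
    and "fg_subset R X L" "L \<subseteq> carrier X" "q ` L = K"
  shows "fg_subset S Y K"
proof -
  interpret X: left_module R X by fact
  obtain T where T: "finite T" "T \<subseteq> L" "\<And>H. submodule H R X \<Longrightarrow> T \<subseteq> H \<Longrightarrow> L \<subseteq> H"
    using assms(6) unfolding fg_subset_def by blast
  have "K \<subseteq> H" if H: "submodule H S Y" "q ` T \<subseteq> H" for H
    using T(3)[OF X.submodule_preimage[OF assms(2-5) H(1)]] H(2) T(2) assms(7,8) by blast
  then show ?thesis
    unfolding fg_subset_def using T(1,2) assms(8) by (intro exI[of _ "q ` T"]) auto
qed

lemma fg_subset_hom_image:
  assumes "left_module R X" "left_module R Y" "f \<in> left_module_hom R X Y"
    and "fg_subset R X L" "L \<subseteq> carrier X" "f ` L = K"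
  shows "fg_subset R Y K"
  using fg_subset_image[OF assms(1,2) _ left_module_homD[OF assms(3)] assms(4-6)] by simp

section \<open>Finite products and free modules\<close>

text \<open>
  The product of the modules \<open>X i\<close> for \<open>i \<in> I\<close>, as a set of extensional functions.
\<close>

definition product_module ::
  "'i set \<Rightarrow> ('i \<Rightarrow> ('r, 'm, 'y) module_scheme) \<Rightarrow> ('r, 'i \<Rightarrow> 'm) module" where
  "product_module I X =
    \<lparr>carrier = (\<Pi>\<^sub>E i\<in>I. carrier (X i)), mult = undefined, one = undefined,
     ring.zero = (\<lambda>i\<in>I. \<zero>\<^bsub>X i\<^esub>),
     add = (\<lambda>u v. \<lambda>i\<in>I. u i \<oplus>\<^bsub>X i\<^esub> v i),
     smult = (\<lambda>r u. \<lambda>i\<in>I. r \<odot>\<^bsub>X i\<^esub> u i)\<rparr>"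

text \<open>
  The element of the product with \<open>y\<close> at the index \<open>j\<close> and zero elsewhere.
\<close>

definition single :: "'i set \<Rightarrow> ('i \<Rightarrow> ('r, 'm, 'y) module_scheme) \<Rightarrow> 'i \<Rightarrow> 'm \<Rightarrow> 'i \<Rightarrow> 'm" where
  "single I X j y = (\<lambda>i\<in>I. if i = j then y else \<zero>\<^bsub>X i\<^esub>)"

text \<open>
  The map \<open>v \<mapsto> \<Sum>\<^sub>i \<alpha> i (v i)\<close> from a finite product to \<open>Y\<close> with the components \<open>\<alpha> i\<close>.
\<close>

definition coordinate_sum ::
  "('b, 'z) ring_scheme \<Rightarrow> 'i set \<Rightarrow> ('i \<Rightarrow> 'm \<Rightarrow> 'b) \<Rightarrow> ('i \<Rightarrow> 'm) \<Rightarrow> 'b" where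
  "coordinate_sum Y I \<alpha> v = (\<Oplus>\<^bsub>Y\<^esub>i\<in>I. \<alpha> i (v i))"

lemma product_module_simps:
  "carrier (product_module I X) = (\<Pi>\<^sub>E i\<in>I. carrier (X i))"
  "\<zero>\<^bsub>product_module I X\<^esub> = (\<lambda>i\<in>I. \<zero>\<^bsub>X i\<^esub>)"
  "u \<oplus>\<^bsub>product_module I X\<^esub> v = (\<lambda>i\<in>I. u i \<oplus>\<^bsub>X i\<^esub> v i)"
  "r \<odot>\<^bsub>product_module I X\<^esub> u = (\<lambda>i\<in>I. r \<odot>\<^bsub>X i\<^esub> u i)"
  by (simp_all add: product_module_def)

lemma free_module_eq_product_module:
  "free_module R n = product_module {..<n} (\<lambda>_. regular_module R)"
  by (simp add: free_module_def product_module_def regular_module_def)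

lemma product_module_eqI:
  assumes "u \<in> carrier (product_module I X)" "v \<in> carrier (product_module I X)"
    and "\<And>i. i \<in> I \<Longrightarrow> u i = v i"
  shows "u = v"
  using assms unfolding product_module_simps by (rule PiE_ext)

lemma abelian_group_product_module:
  assumes "\<And>i. i \<in> I \<Longrightarrow> abelian_group (X i)"
  shows "abelian_group (product_module I X)"
proof (rule abelian_groupI)
  let ?P = "product_module I X"
  have closed: "u \<oplus>\<^bsub>?P\<^esub> v \<in> carrier ?P" if "u \<in> carrier ?P" "v \<in> carrier ?P" for u v
    using that assms by (auto simp: product_module_simps PiE_iff abelian_groupE)
  then show "\<And>u v. \<lbrakk>u \<in> carrier ?P; v \<in> carrier ?P\<rbrakk> \<Longrightarrow> u \<oplus>\<^bsub>?P\<^esub> v \<in> carrier ?P" .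
  show zero: "\<zero>\<^bsub>?P\<^esub> \<in> carrier ?P"
    using assms by (simp add: product_module_simps abelian_groupE(2))
  show "u \<oplus>\<^bsub>?P\<^esub> v \<oplus>\<^bsub>?P\<^esub> w = u \<oplus>\<^bsub>?P\<^esub> (v \<oplus>\<^bsub>?P\<^esub> w)"
    if "u \<in> carrier ?P" "v \<in> carrier ?P" "w \<in> carrier ?P" for u v w
    by (rule product_module_eqI[where I = I and X = X])
      (use that assms closed in \<open>auto simp: product_module_simps PiE_iff abelian_groupE(1,3)\<close>)
  show "u \<oplus>\<^bsub>?P\<^esub> v = v \<oplus>\<^bsub>?P\<^esub> u" if "u \<in> carrier ?P" "v \<in> carrier ?P" for u v
    by (rule product_module_eqI[where I = I and X = X])
      (use that assms closed in \<open>auto simp: product_module_simps PiE_iff abelian_groupE(4)\<close>)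
  show "\<zero>\<^bsub>?P\<^esub> \<oplus>\<^bsub>?P\<^esub> u = u" if "u \<in> carrier ?P" for u
    by (rule product_module_eqI[where I = I and X = X])
      (use that assms closed zero in \<open>auto simp: product_module_simps PiE_iff abelian_groupE(5)\<close>)
  show "\<exists>v\<in>carrier ?P. v \<oplus>\<^bsub>?P\<^esub> u = \<zero>\<^bsub>?P\<^esub>" if "u \<in> carrier ?P" for u
    using that assms
    by (intro bexI[of _ "\<lambda>i\<in>I. \<ominus>\<^bsub>X i\<^esub> u i"])
      (auto simp: product_module_simps PiE_iff abelian_group.l_neg abelian_group.a_inv_closed
        intro!: restrict_ext)
qed

lemma left_module_product_module:
  assumes "ring R" "\<And>i. i \<in> I \<Longrightarrow> left_module R (X i)"
  shows "left_module R (product_module I X)"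
proof -
  let ?P = "product_module I X"
  have "abelian_group (X i)" if "i \<in> I" for i
    using assms(2)[OF that] left_module.axioms(2) by blast
  then interpret P: abelian_group ?P by (rule abelian_group_product_module)
  interpret R: ring R by fact
  have closed: "r \<odot>\<^bsub>?P\<^esub> u \<in> carrier ?P" if "r \<in> carrier R" "u \<in> carrier ?P" for r u
    using that left_module.smult_closed[OF assms(2)] by (auto simp: product_module_simps PiE_iff)
  show ?thesis
  proof (intro left_module.intro left_module_axioms.intro assms(1) P.abelian_group_axioms closed)
    fix a b u
    assume *: "a \<in> carrier R" "b \<in> carrier R" "u \<in> carrier ?P"
    show "(a \<oplus>\<^bsub>R\<^esub> b) \<odot>\<^bsub>?P\<^esub> u = a \<odot>\<^bsub>?P\<^esub> u \<oplus>\<^bsub>?P\<^esub> b \<odot>\<^bsub>?P\<^esub> u"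
      using * left_module.smult_l_distr[OF assms(2)]
      by (auto simp: product_module_simps PiE_iff intro!: restrict_ext)
    show "(a \<otimes>\<^bsub>R\<^esub> b) \<odot>\<^bsub>?P\<^esub> u = a \<odot>\<^bsub>?P\<^esub> (b \<odot>\<^bsub>?P\<^esub> u)"
      using * left_module.smult_assoc[OF assms(2)]
      by (auto simp: product_module_simps PiE_iff intro!: restrict_ext)
  next
    fix u assume *: "u \<in> carrier ?P"
    show "\<one>\<^bsub>R\<^esub> \<odot>\<^bsub>?P\<^esub> u = u"
      by (rule product_module_eqI[where I = I and X = X])
        (use * left_module.smult_one[OF assms(2)] closed in \<open>auto simp: product_module_simps PiE_iff\<close>)
  next
    fix a u v assume *: "a \<in> carrier R" "u \<in> carrier ?P" "v \<in> carrier ?P"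
    show "a \<odot>\<^bsub>?P\<^esub> (u \<oplus>\<^bsub>?P\<^esub> v) = a \<odot>\<^bsub>?P\<^esub> u \<oplus>\<^bsub>?P\<^esub> a \<odot>\<^bsub>?P\<^esub> v"
      using * left_module.smult_r_distr[OF assms(2)]
      by (auto simp: product_module_simps PiE_iff intro!: restrict_ext)
  qed
qed

lemma left_module_regular:
  assumes "ring R" shows "left_module R (regular_module R)"
proof -
  interpret ring R by fact
  have "abelian_group (regular_module R)"
    by (rule abelian_groupI) (auto simp: regular_module_def a_assoc intro: a_comm l_neg)
  then show ?thesis
    by (intro left_module.intro left_module_axioms.intro assms)
      (auto simp: regular_module_def l_distr r_distr m_assoc)
qed

lemma regular_module_simps:
  "carrier (regular_module R) = carrier R" "\<zero>\<^bsub>regular_module R\<^esub> = \<zero>\<^bsub>R\<^esub>"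
  "x \<oplus>\<^bsub>regular_module R\<^esub> y = x \<oplus>\<^bsub>R\<^esub> y" "x \<odot>\<^bsub>regular_module R\<^esub> y = x \<otimes>\<^bsub>R\<^esub> y"
  by (simp_all add: regular_module_def)

lemma left_module_free: "ring R \<Longrightarrow> left_module R (free_module R n)"
  unfolding free_module_eq_product_module
  by (intro left_module_product_module left_module_regular)

lemma single_closed:
  assumes "\<And>i. i \<in> I \<Longrightarrow> abelian_group (X i)" "j \<in> I \<Longrightarrow> y \<in> carrier (X j)"
  shows "single I X j y \<in> carrier (product_module I X)"
  using assms by (auto simp: single_def product_module_simps abelian_groupE(2))

lemma single_add:
  assumes "\<And>i. i \<in> I \<Longrightarrow> abelian_group (X i)"
  shows "single I X j (y \<oplus>\<^bsub>X j\<^esub> z)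
    = single I X j y \<oplus>\<^bsub>product_module I X\<^esub> single I X j z"
  using assms by (auto simp: single_def product_module_simps abelian_groupE intro!: restrict_ext)

lemma single_smult:
  assumes "\<And>i. i \<in> I \<Longrightarrow> left_module R (X i)" "r \<in> carrier R"
  shows "single I X j (r \<odot>\<^bsub>X j\<^esub> y) = r \<odot>\<^bsub>product_module I X\<^esub> single I X j y"
proof -
  have "r \<odot>\<^bsub>X i\<^esub> \<zero>\<^bsub>X i\<^esub> = \<zero>\<^bsub>X i\<^esub>" if "i \<in> I" for i
    using assms(1)[OF that] assms(2) by (rule left_module.smult_zero_right)
  then show ?thesis
    by (auto simp: single_def product_module_simps intro!: restrict_ext)
qed

lemma product_module_induct [consumes 3, case_names zero single add]:
  assumes "finite I" "v \<in> carrier (product_module I X)" "\<And>i. i \<in> I \<Longrightarrow> abelian_group (X i)"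
    and zero: "P \<zero>\<^bsub>product_module I X\<^esub>"
    and single: "\<And>j y. \<lbrakk>j \<in> I; y \<in> carrier (X j)\<rbrakk> \<Longrightarrow> P (single I X j y)"
    and add: "\<And>u v. \<lbrakk>u \<in> carrier (product_module I X); v \<in> carrier (product_module I X);
        P u; P v\<rbrakk> \<Longrightarrow> P (u \<oplus>\<^bsub>product_module I X\<^esub> v)"
  shows "P v"
proof -
  define w where "w J = (\<lambda>i\<in>I. if i \<in> J then v i else \<zero>\<^bsub>X i\<^esub>)" for J
  have v: "v i \<in> carrier (X i)" if "i \<in> I" for i
    using that assms(2) by (auto simp: product_module_simps)
  have w: "w J \<in> carrier (product_module I X)" for J
    using assms(3) v by (auto simp: w_def product_module_simps abelian_groupE(2))
  have "J \<subseteq> I \<Longrightarrow> P (w J)" if "finite J" for J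
    using that
  proof (induction J rule: finite_induct)
    case empty
    then show ?case using zero by (simp add: w_def product_module_simps(2) restrict_def)
  next
    case (insert j J)
    have "w (insert j J) = w J \<oplus>\<^bsub>product_module I X\<^esub> single I X j (v j)"
      unfolding w_def product_module_simps
    proof (rule restrict_ext)
      fix i assume i: "i \<in> I"
      interpret abelian_group "X i" using assms(3) i .
      show "(if i \<in> insert j J then v i else \<zero>\<^bsub>X i\<^esub>) =
        (\<lambda>i\<in>I. if i \<in> J then v i else \<zero>\<^bsub>X i\<^esub>) i \<oplus>\<^bsub>X i\<^esub> single I X j (v j) i"
        using i v insert abelian_groupE(5)[OF assms(3)] by (auto simp: single_def)
    qed
    then show ?case
      using add[OF w single_closed[OF assms(3)]] single insert v by auto
  qed
  from this[OF assms(1) order_refl] have "P (w I)" .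
  moreover have "w I = v"
    by (rule product_module_eqI[OF w assms(2)]) (simp add: w_def)
  ultimately show ?thesis by simp
qed

lemma additive_hom_product_eqI:
  assumes "finite I" "\<And>i. i \<in> I \<Longrightarrow> abelian_group (X i)" "abelian_group Y"
    and "f \<in> additive_hom (product_module I X) Y" "g \<in> additive_hom (product_module I X) Y"
    and "\<And>j y. \<lbrakk>j \<in> I; y \<in> carrier (X j)\<rbrakk> \<Longrightarrow> f (single I X j y) = g (single I X j y)"
    and "v \<in> carrier (product_module I X)"
  shows "f v = g v"
proof (rule product_module_induct[OF assms(1,7,2)])
  show "f \<zero>\<^bsub>product_module I X\<^esub> = g \<zero>\<^bsub>product_module I X\<^esub>"
    using assms(2-5) additive_hom_zero[OF _ abelian_group_product_module] by metis
next
  fix u v assume "u \<in> carrier (product_module I X)" "v \<in> carrier (product_module I X)"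
    "f u = g u" "f v = g v"
  then show "f (u \<oplus>\<^bsub>product_module I X\<^esub> v) = g (u \<oplus>\<^bsub>product_module I X\<^esub> v)"
    using additive_homD(2)[OF assms(4)] additive_homD(2)[OF assms(5)] by simp
qed (use assms in auto)

lemma coordinate_sum_hom:
  assumes "finite I" "abelian_group Y" "\<And>i. i \<in> I \<Longrightarrow> \<alpha> i \<in> additive_hom (X i) Y"
  shows "coordinate_sum Y I \<alpha> \<in> additive_hom (product_module I X) Y"
proof -
  interpret abelian_group Y by fact
  show ?thesis
  proof (rule additive_homI)
    fix u v assume u: "u \<in> carrier (product_module I X)" and v: "v \<in> carrier (product_module I X)"
    have 1: "(\<lambda>i. \<alpha> i (u i)) \<in> I \<rightarrow> carrier Y" "(\<lambda>i. \<alpha> i (v i)) \<in> I \<rightarrow> carrier Y"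
      using u v additive_homD(1)[OF assms(3)] by (auto simp: product_module_simps PiE_iff)
    have "(\<Oplus>\<^bsub>Y\<^esub>i\<in>I. \<alpha> i ((\<lambda>i\<in>I. u i \<oplus>\<^bsub>X i\<^esub> v i) i)) = (\<Oplus>\<^bsub>Y\<^esub>i\<in>I. \<alpha> i (u i) \<oplus>\<^bsub>Y\<^esub> \<alpha> i (v i))"
      using u v 1 additive_homD(2)[OF assms(3)]
      by (intro add.finprod_cong') (auto simp: product_module_simps PiE_iff)
    then show "coordinate_sum Y I \<alpha> (u \<oplus>\<^bsub>product_module I X\<^esub> v)
        = coordinate_sum Y I \<alpha> u \<oplus>\<^bsub>Y\<^esub> coordinate_sum Y I \<alpha> v"
      using 1 by (simp add: coordinate_sum_def product_module_simps finsum_addf)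
  qed (use additive_homD(1)[OF assms(3)] in \<open>auto simp: coordinate_sum_def product_module_simps PiE_iff
      intro!: finsum_closed\<close>)
qed

lemma coordinate_sum_single:
  assumes "finite I" "abelian_group Y" "\<And>i. i \<in> I \<Longrightarrow> \<alpha> i \<in> additive_hom (X i) Y"
    and "\<And>i. i \<in> I \<Longrightarrow> abelian_group (X i)" "j \<in> I" "y \<in> carrier (X j)"
  shows "coordinate_sum Y I \<alpha> (single I X j y) = \<alpha> j y"
proof -
  interpret abelian_group Y by fact
  have y: "\<alpha> j y \<in> carrier Y" using additive_homD(1)[OF assms(3)] assms by blast
  have "coordinate_sum Y I \<alpha> (single I X j y) = (\<Oplus>\<^bsub>Y\<^esub>i\<in>I. if j = i then \<alpha> j y else \<zero>\<^bsub>Y\<^esub>)"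
    unfolding coordinate_sum_def using assms(5) y
    by (intro add.finprod_cong') (auto simp: single_def additive_hom_zero[OF assms(3,4,2)])
  also have "\<dots> = \<alpha> j y"
    using add.finprod_singleton[OF assms(5,1), of "\<lambda>_. \<alpha> j y"] y by simp
  finally show ?thesis .
qed

lemma coordinate_sum_module_hom:
  assumes "finite I" "left_module R Y" "\<And>i. i \<in> I \<Longrightarrow> left_module R (X i)"
    and "\<And>i. i \<in> I \<Longrightarrow> \<alpha> i \<in> left_module_hom R (X i) Y"
  shows "coordinate_sum Y I \<alpha> \<in> left_module_hom R (product_module I X) Y"
proof -
  interpret Y: left_module R Y by fact
  have X: "abelian_group (X i)" if "i \<in> I" for i using assms(3)[OF that] left_module.axioms(2) by blast
  have \<alpha>: "\<alpha> i \<in> additive_hom (X i) Y" if "i \<in> I" for i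
    using assms(4)[OF that] left_module_homD by blast
  interpret P: left_module R "product_module I X"
    using assms Y.R.ring_axioms by (intro left_module_product_module)
  have add: "coordinate_sum Y I \<alpha> \<in> additive_hom (product_module I X) Y"
    using assms(1) Y.M.abelian_group_axioms \<alpha> by (rule coordinate_sum_hom)
  have "coordinate_sum Y I \<alpha> (r \<odot>\<^bsub>product_module I X\<^esub> v) = r \<odot>\<^bsub>Y\<^esub> coordinate_sum Y I \<alpha> v"
    if r: "r \<in> carrier R" and v: "v \<in> carrier (product_module I X)" for r v
  proof (rule additive_hom_product_eqI[OF assms(1) X Y.M.abelian_group_axioms _ _ _ v])
    show "(\<lambda>v. coordinate_sum Y I \<alpha> (r \<odot>\<^bsub>product_module I X\<^esub> v)) \<in> additive_hom (product_module I X) Y"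
      by (intro additive_homI)
        (simp_all add: r P.smult_r_distr P.smult_closed additive_homD[OF add])
    show "(\<lambda>v. r \<odot>\<^bsub>Y\<^esub> coordinate_sum Y I \<alpha> v) \<in> additive_hom (product_module I X) Y"
      by (intro additive_homI)
        (simp_all add: r Y.smult_r_distr Y.smult_closed additive_homD[OF add])
    fix j y assume j: "j \<in> I" "y \<in> carrier (X j)"
    have ry: "r \<odot>\<^bsub>X j\<^esub> y \<in> carrier (X j)"
      by (rule left_module.smult_closed[OF assms(3)[OF j(1)] r j(2)])
    have cs: "coordinate_sum Y I \<alpha> (single I X j z) = \<alpha> j z" if "z \<in> carrier (X j)" for z
      using assms(1) Y.M.abelian_group_axioms \<alpha> X j(1) that by (rule coordinate_sum_single)
    have "coordinate_sum Y I \<alpha> (r \<odot>\<^bsub>product_module I X\<^esub> single I X j y)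
        = coordinate_sum Y I \<alpha> (single I X j (r \<odot>\<^bsub>X j\<^esub> y))"
      using single_smult[of I R X r j y, OF assms(3) r] by simp
    also have "\<dots> = r \<odot>\<^bsub>Y\<^esub> coordinate_sum Y I \<alpha> (single I X j y)"
      unfolding cs[OF j(2)] cs[OF ry] by (rule left_module_homD(2)[OF assms(4)[OF j(1)] r j(2)])
    finally show "coordinate_sum Y I \<alpha> (r \<odot>\<^bsub>product_module I X\<^esub> single I X j y) =
        r \<odot>\<^bsub>Y\<^esub> coordinate_sum Y I \<alpha> (single I X j y)" .
  qed auto
  with add show ?thesis by (intro left_module_homI)
qed

lemma coordinate_hom:
  assumes "i \<in> I"
  shows "(\<lambda>v. v i) \<in> left_module_hom R (product_module I X) (X i)"
  using assms by (auto simp: left_module_hom_def product_module_simps)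

lemma fg_product_module:
  assumes "ring R" "finite I" "\<And>i. i \<in> I \<Longrightarrow> left_module R (X i)"
    and "\<And>i. i \<in> I \<Longrightarrow> fg_subset R (X i) (carrier (X i))"
  shows "fg_subset R (product_module I X) (carrier (product_module I X))"
proof -
  let ?P = "product_module I X"
  interpret P: left_module R ?P using assms by (intro left_module_product_module)
  have X: "abelian_group (X i)" if "i \<in> I" for i using assms(3)[OF that] left_module.axioms(2) by blast
  have "\<forall>i\<in>I. \<exists>S. finite S \<and> S \<subseteq> carrier (X i) \<and> (\<forall>H. submodule H R (X i) \<longrightarrow> S \<subseteq> H \<longrightarrow> carrier (X i) \<subseteq> H)"
    using assms(4) unfolding fg_subset_def by blast
  then obtain S where S: "\<And>i. i \<in> I \<Longrightarrow> finite (S i)" "\<And>i. i \<in> I \<Longrightarrow> S i \<subseteq> carrier (X i)"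
    "\<And>i H. \<lbrakk>i \<in> I; submodule H R (X i); S i \<subseteq> H\<rbrakk> \<Longrightarrow> carrier (X i) \<subseteq> H"
    by metis
  show ?thesis
    unfolding fg_subset_def
  proof (intro exI[of _ "\<Union>i\<in>I. single I X i ` S i"] conjI allI impI subsetI)
    fix H v assume H: "submodule H R ?P" "(\<Union>i\<in>I. single I X i ` S i) \<subseteq> H" and v: "v \<in> carrier ?P"
    show "v \<in> H"
    proof (rule product_module_induct[OF assms(2) v X])
      fix j y assume single: "j \<in> I" "y \<in> carrier (X j)"
      have "submodule {y \<in> carrier (X j). single I X j y \<in> H} R (X j)"
        by (rule left_module.submodule_preimage[OF assms(3)[OF single(1)] P.left_module_axioms, where \<sigma> = "\<lambda>r. r"])
         (use single H(1) assms(3) X in \<open>auto intro!: additive_homI single_closed single_add single_smult\<close>)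
      then show "single I X j y \<in> H" using S(3)[OF single(1)] H(2) S(2) single by blast
    qed (use H in \<open>auto simp: P.submodule_iff\<close>)
  qed (use assms(2) S X in \<open>auto intro!: single_closed\<close>)
qed

text \<open>
  The kernel of \<open>f\<close>; of the codomain only the zero element is used.
\<close>

abbreviation kernel_of ::
  "('r, 'm, 'y) module_scheme \<Rightarrow> ('r, 'n, 'z) module_scheme \<Rightarrow> ('m \<Rightarrow> 'n) \<Rightarrow> 'm set" where
  "kernel_of X Y f \<equiv> {x \<in> carrier X. f x = \<zero>\<^bsub>Y\<^esub>}"

abbreviation free_single :: "('r, 'x) ring_scheme \<Rightarrow> nat \<Rightarrow> nat \<Rightarrow> 'r \<Rightarrow> nat \<Rightarrow> 'r" where
  "free_single R n \<equiv> single {..<n} (\<lambda>_. regular_module R)"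

text \<open>
  The homomorphism from the free module of rank \<open>n\<close> that sends the \<open>i\<close>-th basis vector to
  \<open>x i\<close>.
\<close>

definition free_hom ::
  "('r, 'm, 'y) module_scheme \<Rightarrow> nat \<Rightarrow> (nat \<Rightarrow> 'm) \<Rightarrow> (nat \<Rightarrow> 'r) \<Rightarrow> 'm" where
  "free_hom X n x = coordinate_sum X {..<n} (\<lambda>i r. r \<odot>\<^bsub>X\<^esub> x i)"

lemma free_single_closed:
  assumes "ring R" "r \<in> carrier R"
  shows "free_single R n j r \<in> carrier (free_module R n)"
  unfolding free_module_eq_product_module
  by (rule single_closed)
    (use left_module.axioms(2)[OF left_module_regular[OF assms(1)]] assms(2) in
      \<open>simp_all add: regular_module_simps\<close>)

lemma smult_left_hom:
  assumes "left_module R X" "x \<in> carrier X"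
  shows "(\<lambda>r. r \<odot>\<^bsub>X\<^esub> x) \<in> left_module_hom R (regular_module R) X"
proof -
  interpret X: left_module R X by fact
  show ?thesis
    using assms(2) by (auto simp: left_module_hom_def regular_module_simps X.smult_closed
        X.smult_l_distr X.smult_assoc)
qed

lemma free_hom_hom:
  assumes "left_module R X" "\<And>i. i < n \<Longrightarrow> x i \<in> carrier X"
  shows "free_hom X n x \<in> left_module_hom R (free_module R n) X"
proof -
  have "ring R" using assms(1) by (rule left_module.axioms(1))
  then show ?thesis
    unfolding free_hom_def free_module_eq_product_module
    using assms by (intro coordinate_sum_module_hom smult_left_hom left_module_regular) auto
qed

lemma free_hom_single:
  assumes "left_module R X" "\<And>i. i < n \<Longrightarrow> x i \<in> carrier X" "j < n" "r \<in> carrier R"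
  shows "free_hom X n x (free_single R n j r) = r \<odot>\<^bsub>X\<^esub> x j"
proof -
  interpret X: left_module R X by fact
  interpret P: left_module R "regular_module R" using X.R.ring_axioms by (rule left_module_regular)
  have hom: "(\<lambda>r. r \<odot>\<^bsub>X\<^esub> x i) \<in> additive_hom (regular_module R) X" if "i \<in> {..<n}" for i
    using smult_left_hom[OF assms(1), of "x i"] assms(2) that left_module_homD(1) by blast
  show ?thesis
    unfolding free_hom_def
    using finite_lessThan X.M.abelian_group_axioms hom P.M.abelian_group_axioms
    by (rule coordinate_sum_single) (use assms in \<open>auto simp: regular_module_simps\<close>)
qed

lemma additive_hom_free_eqI:
  assumes "ring R" "abelian_group Y"
    and "f \<in> additive_hom (free_module R n) Y" "g \<in> additive_hom (free_module R n) Y"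
    and "\<And>j r. \<lbrakk>j < n; r \<in> carrier R\<rbrakk> \<Longrightarrow> f (free_single R n j r) = g (free_single R n j r)"
    and "v \<in> carrier (free_module R n)"
  shows "f v = g v"
proof -
  have "abelian_group (regular_module R)"
    using left_module.axioms(2)[OF left_module_regular[OF assms(1)]] .
  then show ?thesis
    by (intro additive_hom_product_eqI[of "{..<n}" "\<lambda>_. regular_module R" Y f g v])
      (use assms in \<open>auto simp: free_module_eq_product_module regular_module_simps\<close>)
qed

lemma left_module_hom_free_single:
  assumes "ring R" "f \<in> left_module_hom R (free_module R n) X" "r \<in> carrier R"
  shows "f (free_single R n j r) = r \<odot>\<^bsub>X\<^esub> f (free_single R n j \<one>\<^bsub>R\<^esub>)"
proof -
  interpret ring R by fact
  have "r \<odot>\<^bsub>free_module R n\<^esub> free_single R n j \<one>\<^bsub>R\<^esub> = free_single R n j r"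
    unfolding free_module_eq_product_module
    using single_smult[of "{..<n}" R "\<lambda>_. regular_module R" r j "\<one>\<^bsub>R\<^esub>"] left_module_regular[OF assms(1)] assms(3)
    by (simp add: regular_module_simps)
  then show ?thesis
    using left_module_homD(2)[OF assms(2,3) free_single_closed[OF assms(1) one_closed, of n j]] by simp
qed

lemma free_hom_lift:
  assumes "left_module R X" "left_module R Y" "f \<in> left_module_hom R (free_module R n) X"
    and "g \<in> left_module_hom R Y X" "f ` carrier (free_module R n) \<subseteq> g ` carrier Y"
  obtains h where "h \<in> left_module_hom R (free_module R n) Y"
    "\<And>v. v \<in> carrier (free_module R n) \<Longrightarrow> g (h v) = f v"
proof -
  interpret X: left_module R X by fact
  interpret Y: left_module R Y by fact
  have single: "free_single R n j r \<in> carrier (free_module R n)" if "r \<in> carrier R" for j r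
    using X.R.ring_axioms that by (rule free_single_closed)
  have "\<exists>y\<in>carrier Y. g y = f (free_single R n j \<one>\<^bsub>R\<^esub>)" for j
    using assms(5) single[of "\<one>\<^bsub>R\<^esub>" j] by (force simp: image_subset_iff)
  then obtain y where y: "\<And>j. y j \<in> carrier Y" "\<And>j. g (y j) = f (free_single R n j \<one>\<^bsub>R\<^esub>)"
    by metis
  have h: "free_hom Y n y \<in> left_module_hom R (free_module R n) Y"
    by (rule free_hom_hom[OF assms(2) y(1)])
  show ?thesis
  proof (rule that[OF h])
    fix v assume v: "v \<in> carrier (free_module R n)"
    show "g (free_hom Y n y v) = f v"
    proof (rule additive_hom_free_eqI[OF X.R.ring_axioms X.M.abelian_group_axioms _ _ _ v])
      show "(\<lambda>v. g (free_hom Y n y v)) \<in> additive_hom (free_module R n) X"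
        using left_module_hom_compose[OF h assms(4)] by (rule left_module_homD)
      show "f \<in> additive_hom (free_module R n) X" using assms(3) by (rule left_module_homD)
      fix j r assume j: "j < n" "r \<in> carrier R"
      have "f (free_single R n j r) = r \<odot>\<^bsub>X\<^esub> f (free_single R n j \<one>\<^bsub>R\<^esub>)"
        by (rule left_module_hom_free_single[OF X.R.ring_axioms assms(3) j(2)])
      then show "g (free_hom Y n y (free_single R n j r)) = f (free_single R n j r)"
        using left_module_homD(2)[OF assms(4) j(2) y(1)] y(2)
          free_hom_single[OF assms(2) y(1) j] by simp
    qed
  qed
qed

lemma submodule_hom_image:
  assumes "left_module R X" "left_module R Y" "f \<in> left_module_hom R X Y" "submodule K R X"
  shows "submodule (f ` K) R Y"
proof -
  interpret X: left_module R X by fact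
  interpret Y: left_module R Y by fact
  note K = assms(4)[unfolded X.submodule_iff]
  note f = left_module_homD[OF assms(3)]
  show ?thesis
    unfolding Y.submodule_iff
  proof (intro conjI ballI)
    show "f ` K \<subseteq> carrier Y" using K additive_homD(1)[OF f(1)] by auto
    show "\<zero>\<^bsub>Y\<^esub> \<in> f ` K"
      using K additive_hom_zero[OF f(1) X.M.abelian_group_axioms Y.M.abelian_group_axioms] by force
    fix x assume x: "x \<in> f ` K"
    then obtain a where a: "a \<in> K" "x = f a" by blast
    show "r \<odot>\<^bsub>Y\<^esub> x \<in> f ` K" if r: "r \<in> carrier R" for r
      using K a f(2)[OF r, of a] r by (metis image_eqI subsetD)
    fix y assume "y \<in> f ` K"
    then obtain b where b: "b \<in> K" "y = f b" by blast
    show "x \<oplus>\<^bsub>Y\<^esub> y \<in> f ` K"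
      using K a b additive_homD(2)[OF f(1), of a b] by (metis image_eqI subsetD)
  qed
qed

lemma fg_subset_imp_free_surj:
  assumes "left_module R X" "submodule L R X" "fg_subset R X L"
  obtains n f where "f \<in> left_module_hom R (free_module R n) X" "f ` carrier (free_module R n) = L"
proof -
  interpret X: left_module R X by fact
  obtain S where S: "finite S" "S \<subseteq> L" "\<And>H. submodule H R X \<Longrightarrow> S \<subseteq> H \<Longrightarrow> L \<subseteq> H"
    using assms(3) unfolding fg_subset_def by blast
  obtain n :: nat and x where x: "S = x ` {i. i < n}"
    using finite_imp_nat_seg_image_inj_on[OF S(1)] by blast
  have L: "L \<subseteq> carrier X" using assms(2) by (simp add: X.submodule_iff)
  have xL: "x i \<in> L" if "i < n" for i using S(2) x that by blast
  then have xX: "x i \<in> carrier X" if "i < n" for i using L that by blast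
  let ?F = "free_module R n" and ?f = "free_hom X n x"
  interpret F: left_module R ?F using X.R.ring_axioms by (rule left_module_free)
  have f: "?f \<in> left_module_hom R ?F X" by (rule free_hom_hom[OF assms(1) xX])
  have "?f v \<in> L" if v: "v \<in> carrier ?F" for v
  proof -
    have H: "submodule {v \<in> carrier ?F. ?f v \<in> L} R ?F"
      by (rule F.submodule_preimage[OF assms(1) _ left_module_homD[OF f] assms(2)]) auto
    have "v \<in> {v \<in> carrier ?F. ?f v \<in> L}"
    proof (rule product_module_induct[OF finite_lessThan[of n] v[unfolded free_module_eq_product_module]])
      show "abelian_group (regular_module R)"
        using left_module.axioms(2)[OF left_module_regular[OF X.R.ring_axioms]] .
    next
      fix j r assume j: "j \<in> {..<n}" "r \<in> carrier (regular_module R)"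
      then show "free_single R n j r \<in> {v \<in> carrier ?F. ?f v \<in> L}"
        using free_hom_single[OF assms(1) xX, where j = j and r = r] free_single_closed[OF X.R.ring_axioms, where r = r and n = n and j = j]
          xL assms(2) by (auto simp: regular_module_simps X.submodule_iff)
    qed (use H in \<open>auto simp: F.submodule_iff simp flip: free_module_eq_product_module\<close>)
    then show ?thesis by blast
  qed
  moreover have "L \<subseteq> ?f ` carrier ?F"
  proof (rule S(3)[OF submodule_hom_image[OF F.left_module_axioms assms(1) f F.submodule_carrier]])
    have "x i = ?f (free_single R n i \<one>\<^bsub>R\<^esub>)" if "i < n" for i
      using free_hom_single[OF assms(1) xX that X.R.one_closed] xX[OF that] by (simp add: X.smult_one)
    then show "S \<subseteq> ?f ` carrier ?F"
      using x free_single_closed[OF X.R.ring_axioms X.R.one_closed] by blast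
  qed
  ultimately show thesis using f that by blast
qed

lemma fg_regular_module:
  assumes "ring R" shows "fg_subset R (regular_module R) (carrier (regular_module R))"
proof -
  interpret ring R by fact
  interpret P: left_module R "regular_module R" using assms by (rule left_module_regular)
  show ?thesis
    unfolding fg_subset_def
  proof (intro exI[of _ "{\<one>\<^bsub>R\<^esub>}"] conjI allI impI subsetI)
    fix H x assume H: "submodule H R (regular_module R)" "{\<one>\<^bsub>R\<^esub>} \<subseteq> H" and x: "x \<in> carrier (regular_module R)"
    then have "x \<otimes>\<^bsub>R\<^esub> \<one>\<^bsub>R\<^esub> \<in> H"
      unfolding P.submodule_iff regular_module_simps by blast
    then show "x \<in> H" using x by (simp add: regular_module_simps)
  qed (auto simp: regular_module_simps)
qed

lemma fg_free_module:
  assumes "ring R" shows "fg_subset R (free_module R n) (carrier (free_module R n))"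
  unfolding free_module_eq_product_module
  using assms by (intro fg_product_module left_module_regular fg_regular_module) auto

text \<open>
  Schanuel's argument: if one surjection from a finite free module onto \<open>X\<close> has a finitely
  generated kernel, then so has every surjection from a finitely generated module.
\<close>

lemma fg_kernel_of_finitely_presented:
  assumes "left_module R X" "left_module R Y" "finitely_presented R X"
    and "fg_subset R Y (carrier Y)" "g \<in> left_module_hom R Y X" "g ` carrier Y = carrier X"
  shows "fg_subset R Y (kernel_of Y X g)"
proof -
  interpret X: left_module R X by fact
  interpret Y: left_module R Y by fact
  obtain n f where f: "f \<in> left_module_hom R (free_module R n) X"
    "f ` carrier (free_module R n) = carrier X"
    and fg: "finitely_generated R ((free_module R n)\<lparr>carrier := kernel_of (free_module R n) X f\<rparr>)"
    using assms(3) unfolding finitely_presented_def by blast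
  let ?F = "free_module R n" and ?K = "kernel_of Y X g"
  interpret F: left_module R ?F using X.R.ring_axioms by (rule left_module_free)
  have "fg_subset R ?F (kernel_of ?F X f)"
    using fg finitely_generated_submodule_iff[OF F.left_module_axioms
        submodule_kernel[OF F.left_module_axioms assms(1) f(1)]] by simp
  then obtain S where S: "finite S" "S \<subseteq> kernel_of ?F X f"
    "\<And>H. submodule H R ?F \<Longrightarrow> S \<subseteq> H \<Longrightarrow> kernel_of ?F X f \<subseteq> H"
    unfolding fg_subset_def by blast
  obtain T where T: "finite T" "T \<subseteq> carrier Y" "\<And>H. submodule H R Y \<Longrightarrow> T \<subseteq> H \<Longrightarrow> carrier Y \<subseteq> H"
    using assms(4) unfolding fg_subset_def by blast
  obtain h where h: "h \<in> left_module_hom R ?F Y" "\<And>v. v \<in> carrier ?F \<Longrightarrow> g (h v) = f v"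
    using free_hom_lift[OF assms(1,2) f(1) assms(5)] f(2) assms(6) by blast
  note hD = left_module_homD[OF h(1)] and gD = left_module_homD[OF assms(5)] and fD = left_module_homD[OF f(1)]
  have "\<forall>y\<in>carrier Y. \<exists>v\<in>carrier ?F. f v = g y"
    using additive_homD(1)[OF gD(1)] f(2) by (metis imageE)
  then obtain p where p: "\<And>y. y \<in> carrier Y \<Longrightarrow> p y \<in> carrier ?F" "\<And>y. y \<in> carrier Y \<Longrightarrow> f (p y) = g y"
    by metis
  have hc: "h v \<in> carrier Y" if "v \<in> carrier ?F" for v using additive_homD(1)[OF hD(1)] that .
  have gc: "g y \<in> carrier X" if "y \<in> carrier Y" for y using additive_homD(1)[OF gD(1)] that .
  \<comment> \<open>With \<open>h : F \<rightarrow> Y\<close> lifting \<open>f\<close> along \<open>g\<close>, the kernel of \<open>g\<close> is generated by the images of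
      the generators of \<open>ker f\<close> and by the defects of the generators of \<open>Y\<close>.\<close>
  let ?U = "h ` S \<union> (\<lambda>y. y \<ominus>\<^bsub>Y\<^esub> h (p y)) ` T"
  show ?thesis
    unfolding fg_subset_def
  proof (intro exI[of _ ?U] conjI allI impI)
    show "finite ?U" using S(1) T(1) by simp
    have "g (y \<ominus>\<^bsub>Y\<^esub> h (p y)) = \<zero>\<^bsub>X\<^esub>" if "y \<in> carrier Y" for y
      using that p h(2) hc gc[OF that]
        additive_hom_minus[OF gD(1) Y.M.abelian_group_axioms X.M.abelian_group_axioms, of y "h (p y)"]
      by (simp add: X.M.r_neg a_minus_def)
    then show "?U \<subseteq> ?K" using S(2) T(2) h(2) hc p by (auto simp: subset_iff)
    fix H assume H: "submodule H R Y" "?U \<subseteq> H"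
    note HD = H(1)[unfolded Y.submodule_iff]
    have "submodule {v \<in> carrier ?F. h v \<in> H} R ?F"
      by (rule F.submodule_preimage[OF assms(2) _ hD H(1)]) auto
    from S(3)[OF this] have hH: "h v \<in> H" if "v \<in> kernel_of ?F X f" for v
      using H(2) S(2) that by blast
    \<comment> \<open>An element \<open>y\<close> of \<open>ker g\<close> in this submodule differs by an element of \<open>H\<close> from some \<open>h v\<close>
        with \<open>v \<in> ker f\<close>.\<close>
    let ?D = "{y \<in> carrier Y. \<exists>v\<in>carrier ?F. f v = g y \<and> y \<ominus>\<^bsub>Y\<^esub> h v \<in> H}"
    have "submodule ?D R Y"
      unfolding Y.submodule_iff
    proof (intro conjI ballI)
      have "\<zero>\<^bsub>Y\<^esub> \<ominus>\<^bsub>Y\<^esub> h \<zero>\<^bsub>?F\<^esub> = \<zero>\<^bsub>Y\<^esub>" "f \<zero>\<^bsub>?F\<^esub> = g \<zero>\<^bsub>Y\<^esub>"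
        using additive_hom_zero[OF hD(1) F.M.abelian_group_axioms Y.M.abelian_group_axioms]
         additive_hom_zero[OF gD(1) Y.M.abelian_group_axioms X.M.abelian_group_axioms]
         additive_hom_zero[OF fD(1) F.M.abelian_group_axioms X.M.abelian_group_axioms]
        by (simp_all add: a_minus_def)
      then show "\<zero>\<^bsub>Y\<^esub> \<in> ?D" using HD by (auto intro!: bexI[of _ "\<zero>\<^bsub>?F\<^esub>"])
    next
      fix y z assume "y \<in> ?D" "z \<in> ?D"
      then obtain v w where y: "y \<in> carrier Y" "v \<in> carrier ?F" "f v = g y" "y \<ominus>\<^bsub>Y\<^esub> h v \<in> H"
        and z: "z \<in> carrier Y" "w \<in> carrier ?F" "f w = g z" "z \<ominus>\<^bsub>Y\<^esub> h w \<in> H" by blast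
      have "(y \<oplus>\<^bsub>Y\<^esub> z) \<ominus>\<^bsub>Y\<^esub> h (v \<oplus>\<^bsub>?F\<^esub> w) = (y \<ominus>\<^bsub>Y\<^esub> h v) \<oplus>\<^bsub>Y\<^esub> (z \<ominus>\<^bsub>Y\<^esub> h w)"
        using y z hc by (simp add: additive_homD(2)[OF hD(1)] a_minus_def Y.M.minus_add Y.M.a_ac)
      then have "(y \<oplus>\<^bsub>Y\<^esub> z) \<ominus>\<^bsub>Y\<^esub> h (v \<oplus>\<^bsub>?F\<^esub> w) \<in> H" using HD y z by simp
      moreover have "f (v \<oplus>\<^bsub>?F\<^esub> w) = g (y \<oplus>\<^bsub>Y\<^esub> z)"
        using y z by (simp add: additive_homD(2)[OF fD(1)] additive_homD(2)[OF gD(1)])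
      ultimately show "y \<oplus>\<^bsub>Y\<^esub> z \<in> ?D" using y z by blast
    next
      fix r y assume r: "r \<in> carrier R" and "y \<in> ?D"
      then obtain v where y: "y \<in> carrier Y" "v \<in> carrier ?F" "f v = g y" "y \<ominus>\<^bsub>Y\<^esub> h v \<in> H" by blast
      have rhom: "(\<lambda>y. r \<odot>\<^bsub>Y\<^esub> y) \<in> additive_hom Y Y"
        by (intro additive_homI) (use r in \<open>auto simp: Y.smult_closed Y.smult_r_distr\<close>)
      have "r \<odot>\<^bsub>Y\<^esub> y \<ominus>\<^bsub>Y\<^esub> h (r \<odot>\<^bsub>?F\<^esub> v) = r \<odot>\<^bsub>Y\<^esub> (y \<ominus>\<^bsub>Y\<^esub> h v)"
        using y r hc by (simp add: hD(2) additive_hom_minus[OF rhom Y.M.abelian_group_axioms Y.M.abelian_group_axioms])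
      then have "r \<odot>\<^bsub>Y\<^esub> y \<ominus>\<^bsub>Y\<^esub> h (r \<odot>\<^bsub>?F\<^esub> v) \<in> H" using HD y r by simp
      moreover have "f (r \<odot>\<^bsub>?F\<^esub> v) = g (r \<odot>\<^bsub>Y\<^esub> y)" using y r by (simp add: fD(2) gD(2))
      ultimately show "r \<odot>\<^bsub>Y\<^esub> y \<in> ?D" using y r by (auto intro: Y.smult_closed F.smult_closed)
    qed auto
    from T(3)[OF this] have D: "carrier Y \<subseteq> ?D" using H(2) T(2) p by blast
    show "?K \<subseteq> H"
    proof
      fix y assume y: "y \<in> ?K"
      then obtain v where v: "v \<in> carrier ?F" "f v = g y" "y \<ominus>\<^bsub>Y\<^esub> h v \<in> H" using D by blast
      then have "h v \<in> H" using y hH by auto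
      then have "(y \<ominus>\<^bsub>Y\<^esub> h v) \<oplus>\<^bsub>Y\<^esub> h v \<in> H" using v HD by blast
      then show "y \<in> H" using y v hc by (simp add: a_minus_def Y.M.a_assoc Y.M.l_neg)
    qed
  qed
qed

section \<open>Pseudo-coherent modules\<close>

text \<open>
  A module is pseudo-coherent if the relations between any finite number of its elements are
  finitely generated; equivalently, if its finitely generated submodules are finitely
  presented. The module itself need not be finitely generated.
\<close>

definition pseudo_coherent ::
  "('r, 'x) ring_scheme \<Rightarrow> ('r, 'm, 'y) module_scheme \<Rightarrow> bool" where
  "pseudo_coherent R Y \<longleftrightarrow>
    (\<forall>n. \<forall>f \<in> left_module_hom R (free_module R n) Y.
      fg_subset R (free_module R n) (kernel_of (free_module R n) Y f))"

lemma fg_kernel_of_pseudo_coherent: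
  assumes "pseudo_coherent R Y" "left_module R X" "left_module R Y"
    and "submodule L R X" "fg_subset R X L" "g \<in> left_module_hom R X Y"
  shows "fg_subset R X {x \<in> L. g x = \<zero>\<^bsub>Y\<^esub>}"
proof -
  interpret X: left_module R X by fact
  obtain n f where f: "f \<in> left_module_hom R (free_module R n) X" "f ` carrier (free_module R n) = L"
    using fg_subset_imp_free_surj[OF assms(2,4,5)] by blast
  have "fg_subset R (free_module R n) {v \<in> carrier (free_module R n). g (f v) = \<zero>\<^bsub>Y\<^esub>}"
    by (rule bspec[OF spec[OF assms(1)[unfolded pseudo_coherent_def]] left_module_hom_compose[OF f(1) assms(6)]])
  then show ?thesis
    by (rule fg_subset_hom_image[OF left_module_free[OF X.R.ring_axioms] assms(2) f(1)]) (use f(2) in auto)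
qed

text \<open>
  Finitely many homomorphisms from a finitely generated module to pseudo-coherent modules have
  a finitely generated common kernel: impose the conditions one at a time.
\<close>

lemma fg_common_kernel:
  assumes "finite I" "left_module R X" "fg_subset R X (carrier X)"
    and "\<And>i. i \<in> I \<Longrightarrow> left_module R (Y i)" "\<And>i. i \<in> I \<Longrightarrow> pseudo_coherent R (Y i)"
    and "\<And>i. i \<in> I \<Longrightarrow> g i \<in> left_module_hom R X (Y i)"
  shows "fg_subset R X {x \<in> carrier X. \<forall>i\<in>I. g i x = \<zero>\<^bsub>Y i\<^esub>}
    \<and> submodule {x \<in> carrier X. \<forall>i\<in>I. g i x = \<zero>\<^bsub>Y i\<^esub>} R X"
  using assms(1,4-6)
proof (induction I rule: finite_induct)
  case empty
  then show ?case using assms(3) left_module.submodule_carrier[OF assms(2)] by simp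
next
  case (insert j J)
  interpret X: left_module R X by fact
  let ?L = "{x \<in> carrier X. \<forall>i\<in>J. g i x = \<zero>\<^bsub>Y i\<^esub>}"
  have eq: "{x \<in> carrier X. \<forall>i\<in>insert j J. g i x = \<zero>\<^bsub>Y i\<^esub>} = {x \<in> ?L. g j x = \<zero>\<^bsub>Y j\<^esub>}"
    "{x \<in> ?L. g j x = \<zero>\<^bsub>Y j\<^esub>} = ?L \<inter> kernel_of X (Y j) (g j)"
    by auto
  have L: "fg_subset R X ?L" "submodule ?L R X" using insert by auto
  have "submodule (kernel_of X (Y j) (g j)) R X"
    using insert.prems by (intro submodule_kernel assms(2)) auto
  then have "submodule (?L \<inter> kernel_of X (Y j) (g j)) R X"
    using L(2) by (auto simp: X.submodule_iff)
  moreover have "fg_subset R X {x \<in> ?L. g j x = \<zero>\<^bsub>Y j\<^esub>}"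
    using insert.prems L by (intro fg_kernel_of_pseudo_coherent[OF _ assms(2)]) auto
  ultimately show ?case unfolding eq by simp
qed

lemma pseudo_coherent_product_module:
  assumes "ring R" "finite I" "\<And>i. i \<in> I \<Longrightarrow> left_module R (Y i)" "\<And>i. i \<in> I \<Longrightarrow> pseudo_coherent R (Y i)"
  shows "pseudo_coherent R (product_module I Y)"
  unfolding pseudo_coherent_def
proof (intro allI ballI)
  fix n f assume f: "f \<in> left_module_hom R (free_module R n) (product_module I Y)"
  let ?F = "free_module R n"
  have c: "f v \<in> carrier (product_module I Y)" if "v \<in> carrier ?F" for v
    using additive_homD(1)[OF left_module_homD(1)[OF f]] that .
  have "left_module R (product_module I Y)" using assms(1,3) by (rule left_module_product_module)
  then have z: "\<zero>\<^bsub>product_module I Y\<^esub> \<in> carrier (product_module I Y)"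
    by (intro abelian_groupE(2) left_module.axioms(2))
  have "f v = \<zero>\<^bsub>product_module I Y\<^esub> \<longleftrightarrow> (\<forall>i\<in>I. f v i = \<zero>\<^bsub>Y i\<^esub>)" if v: "v \<in> carrier ?F" for v
  proof
    assume "f v = \<zero>\<^bsub>product_module I Y\<^esub>"
    then show "\<forall>i\<in>I. f v i = \<zero>\<^bsub>Y i\<^esub>" by (simp add: product_module_simps(2))
  next
    assume "\<forall>i\<in>I. f v i = \<zero>\<^bsub>Y i\<^esub>"
    then show "f v = \<zero>\<^bsub>product_module I Y\<^esub>"
      by (intro product_module_eqI[OF c[OF v] z]) (simp add: product_module_simps(2))
  qed
  then have "kernel_of ?F (product_module I Y) f = {v \<in> carrier ?F. \<forall>i\<in>I. f v i = \<zero>\<^bsub>Y i\<^esub>}"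
    by auto
  moreover have "fg_subset R ?F {v \<in> carrier ?F. \<forall>i\<in>I. f v i = \<zero>\<^bsub>Y i\<^esub>}"
    by (rule conjunct1[OF fg_common_kernel[OF assms(2) left_module_free[OF assms(1)]
            fg_free_module[OF assms(1)] assms(3,4), where g = "\<lambda>i v. f v i"]])
      (assumption | rule left_module_hom_compose[OF f coordinate_hom])+
  ultimately show "fg_subset R ?F (kernel_of ?F (product_module I Y) f)" by simp
qed

text \<open>
  A relation in \<open>Q / K\<close> is a relation in \<open>Q\<close> between lifts of the given elements and generators
  of \<open>K\<close>, so the relations in \<open>Q / K\<close> are the projection of the latter.
\<close>

lemma pseudo_coherent_quotient:
  assumes "left_module R Q" "left_module R P" "\<psi> \<in> left_module_hom R Q P" "\<psi> ` carrier Q = carrier P"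
    and "pseudo_coherent R Q" "fg_subset R Q (kernel_of Q P \<psi>)"
  shows "pseudo_coherent R P"
  unfolding pseudo_coherent_def
proof (intro allI ballI)
  fix n f assume f: "f \<in> left_module_hom R (free_module R n) P"
  interpret Q: left_module R Q by fact
  interpret P: left_module R P by fact
  note R = Q.R.ring_axioms
  let ?K = "kernel_of Q P \<psi>"
  have K: "submodule ?K R Q" by (rule submodule_kernel[OF assms(1-3)])
  obtain k p where p: "p \<in> left_module_hom R (free_module R k) Q" "p ` carrier (free_module R k) = ?K"
    by (rule fg_subset_imp_free_surj[OF assms(1) K assms(6)])
  let ?F = "free_module R n" and ?G = "free_module R k"
  interpret F: left_module R ?F using R by (rule left_module_free)
  interpret G: left_module R ?G using R by (rule left_module_free)
  have "f ` carrier ?F \<subseteq> \<psi> ` carrier Q"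
    using additive_homD(1)[OF left_module_homD(1)[OF f]] assms(4) by auto
  then obtain h where h: "h \<in> left_module_hom R ?F Q" "\<And>v. v \<in> carrier ?F \<Longrightarrow> \<psi> (h v) = f v"
    using free_hom_lift[OF assms(2,1) f assms(3)] by blast
  \<comment> \<open>the direct sum of \<open>F\<close> and \<open>G\<close>, indexed by truth values, with the map \<open>(v, u) \<mapsto> h v + p u\<close>
      to \<open>Q\<close>\<close>
  let ?X = "\<lambda>b. if b then ?F else ?G" and ?\<alpha> = "\<lambda>b. if b then h else p"
  let ?B = "product_module UNIV ?X" and ?s = "coordinate_sum Q UNIV ?\<alpha>"
  have X: "left_module R (?X b)" for b by (simp add: F.left_module_axioms G.left_module_axioms)
  interpret B: left_module R ?B using R X by (rule left_module_product_module)
  have s: "?s \<in> left_module_hom R ?B Q"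
    using h(1) p(1) X by (intro coordinate_sum_module_hom assms(1)) auto
  have s_eq: "?s w = h (w True) \<oplus>\<^bsub>Q\<^esub> p (w False)" if "w \<in> carrier ?B" for w
  proof -
    have "w True \<in> carrier ?F" "w False \<in> carrier ?G"
      using that by (auto simp: product_module_simps PiE_iff split: if_splits)
    then have c: "h (w True) \<in> carrier Q" "p (w False) \<in> carrier Q"
      using additive_homD(1)[OF left_module_homD(1)[OF h(1)]] additive_homD(1)[OF left_module_homD(1)[OF p(1)]]
      by blast+
    then show ?thesis
      unfolding coordinate_sum_def UNIV_bool by (simp add: Q.M.a_comm)
  qed
  have fg: "fg_subset R ?B {w \<in> carrier ?B. ?s w = \<zero>\<^bsub>Q\<^esub>}"
    by (rule fg_kernel_of_pseudo_coherent[OF assms(5) B.left_module_axioms assms(1) B.submodule_carrier _ s])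
      (intro fg_product_module R X, auto simp: fg_free_module R)
  show "fg_subset R ?F (kernel_of ?F P f)"
  proof (rule fg_subset_hom_image[OF B.left_module_axioms F.left_module_axioms _ fg, where f = "\<lambda>w. w True"])
    show "(\<lambda>w. w True) \<in> left_module_hom R ?B ?F"
      using coordinate_hom[of True UNIV R ?X] by simp
    show "(\<lambda>w. w True) ` {w \<in> carrier ?B. ?s w = \<zero>\<^bsub>Q\<^esub>} = kernel_of ?F P f" (is "?l = ?r")
    proof (intro equalityI subsetI)
      fix v assume "v \<in> ?l"
      then obtain w where w: "v = w True" "w \<in> carrier ?B" "?s w = \<zero>\<^bsub>Q\<^esub>" by blast
      then have wc: "w True \<in> carrier ?F" "w False \<in> carrier ?G"
        by (auto simp: product_module_simps PiE_iff split: if_splits)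
      have c: "h (w True) \<in> carrier Q"
        using additive_homD(1)[OF left_module_homD(1)[OF h(1)]] wc by blast
      have pK: "p (w False) \<in> ?K" using p(2) wc by blast
      have "\<psi> (h (w True)) = \<psi> (h (w True)) \<oplus>\<^bsub>P\<^esub> \<psi> (p (w False))"
        using c pK additive_homD(1)[OF left_module_homD(1)[OF assms(3)]] by simp
      also have "\<dots> = \<psi> (h (w True) \<oplus>\<^bsub>Q\<^esub> p (w False))"
        using c pK additive_homD(2)[OF left_module_homD(1)[OF assms(3)]] by simp
      also have "\<dots> = \<zero>\<^bsub>P\<^esub>"
        using w s_eq additive_hom_zero[OF left_module_homD(1)[OF assms(3)] Q.M.abelian_group_axioms
            P.M.abelian_group_axioms] by simp
      finally show "v \<in> ?r" using w(1) wc h(2) by simp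
    next
      fix v assume v: "v \<in> ?r"
      then have c: "h v \<in> carrier Q"
        using additive_homD(1)[OF left_module_homD(1)[OF h(1)]] by blast
      then have "h v \<in> ?K" using v h(2) by simp
      then have "\<zero>\<^bsub>Q\<^esub> \<ominus>\<^bsub>Q\<^esub> h v \<in> ?K"
        using K Q.submodule_minus[OF K] by (simp add: Q.submodule_iff)
      then obtain u where u: "u \<in> carrier ?G" "p u = \<zero>\<^bsub>Q\<^esub> \<ominus>\<^bsub>Q\<^esub> h v"
        unfolding p(2)[symmetric] by (metis imageE)
      let ?w = "\<lambda>b. if b then v else u"
      have w: "?w \<in> carrier ?B" using v u by (simp add: product_module_simps PiE_iff)
      have "?s ?w = \<zero>\<^bsub>Q\<^esub>" using s_eq[OF w] u(2) c by (simp add: a_minus_def Q.M.r_neg)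
      then show "v \<in> ?l" using w by (intro image_eqI[of _ _ ?w]) auto
    qed
  qed auto
qed

lemma finitely_presented_iff_pseudo_coherent:
  assumes "left_module R X" "pseudo_coherent R (regular_module R)"
  shows "finitely_presented R X \<longleftrightarrow> finitely_generated R X \<and> pseudo_coherent R X"
proof -
  interpret X: left_module R X by fact
  note R = X.R.ring_axioms
  interpret F: left_module R "free_module R n" for n using R by (rule left_module_free)
  have free: "pseudo_coherent R (free_module R n)" for n
    unfolding free_module_eq_product_module
    using R assms(2) by (intro pseudo_coherent_product_module left_module_regular) auto
  show ?thesis
  proof (intro iffI conjI)
    assume "finitely_presented R X"
    then obtain n f where f: "f \<in> left_module_hom R (free_module R n) X"
        "f ` carrier (free_module R n) = carrier X"
      and fg: "finitely_generated R ((free_module R n)\<lparr>carrier := kernel_of (free_module R n) X f\<rparr>)"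
      unfolding finitely_presented_def by blast
    show "finitely_generated R X"
      unfolding finitely_generated_iff[OF assms(1)]
      by (rule fg_subset_hom_image[OF F.left_module_axioms assms(1) f(1) fg_free_module[OF R] _ f(2)]) simp
    show "pseudo_coherent R X"
      by (rule pseudo_coherent_quotient[OF F.left_module_axioms assms(1) f free])
        (use fg finitely_generated_submodule_iff[OF F.left_module_axioms submodule_kernel[OF F.left_module_axioms assms(1) f(1)]] in simp)
  next
    assume "finitely_generated R X \<and> pseudo_coherent R X"
    then have X: "fg_subset R X (carrier X)" "pseudo_coherent R X"
      by (simp_all add: finitely_generated_iff[OF assms(1)])
    obtain n f where f: "f \<in> left_module_hom R (free_module R n) X"
        "f ` carrier (free_module R n) = carrier X"
      using fg_subset_imp_free_surj[OF assms(1) X.submodule_carrier X(1)] by blast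
    then show "finitely_presented R X"
      unfolding finitely_presented_def
      using X(2) finitely_generated_submodule_iff[OF F.left_module_axioms submodule_kernel[OF F.left_module_axioms assms(1) f(1)]]
      unfolding pseudo_coherent_def by blast
  qed
qed

lemma left_coherent_iff:
  assumes "ring R"
  shows "left_coherent R \<longleftrightarrow> pseudo_coherent R (regular_module R)"
proof -
  interpret P: left_module R "regular_module R" using assms by (rule left_module_regular)
  interpret F: left_module R "free_module R n" for n using assms by (rule left_module_free)
  let ?P = "regular_module R"
  show ?thesis
  proof
    assume coh: "left_coherent R"
    show "pseudo_coherent R ?P"
      unfolding pseudo_coherent_def
    proof (intro allI ballI)
      fix n f assume f: "f \<in> left_module_hom R (free_module R n) ?P"
      let ?I = "f ` carrier (free_module R n)"
      have I: "submodule ?I R ?P"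
        by (rule submodule_hom_image[OF F.left_module_axioms P.left_module_axioms f F.submodule_carrier])
      have "fg_subset R ?P ?I"
        by (rule fg_subset_hom_image[OF F.left_module_axioms P.left_module_axioms f fg_free_module[OF assms]]) auto
      then have "finitely_presented R (?P\<lparr>carrier := ?I\<rparr>)"
        using coh I finitely_generated_submodule_iff[OF P.left_module_axioms I]
        unfolding left_coherent_def by blast
      moreover have "f \<in> left_module_hom R (free_module R n) (?P\<lparr>carrier := ?I\<rparr>)"
        using f by (auto simp: left_module_hom_def)
      ultimately have "fg_subset R (free_module R n) (kernel_of (free_module R n) (?P\<lparr>carrier := ?I\<rparr>) f)"
        by (intro fg_kernel_of_finitely_presented P.left_module_submodule I F.left_module_axioms
            fg_free_module assms) auto
      then show "fg_subset R (free_module R n) (kernel_of (free_module R n) ?P f)" by simp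
    qed
  next
    assume pc: "pseudo_coherent R ?P"
    show "left_coherent R"
      unfolding left_coherent_def
    proof (intro allI impI)
      fix I assume I: "submodule I R ?P" and fg: "finitely_generated R (?P\<lparr>carrier := I\<rparr>)"
      have "I \<subseteq> carrier ?P" using I by (simp add: P.submodule_iff)
      then have "f \<in> left_module_hom R (free_module R n) ?P"
        if "f \<in> left_module_hom R (free_module R n) (?P\<lparr>carrier := I\<rparr>)" for f n
        using that by (auto simp: left_module_hom_def)
      then have "pseudo_coherent R (?P\<lparr>carrier := I\<rparr>)"
        using pc unfolding pseudo_coherent_def by simp
      then show "finitely_presented R (?P\<lparr>carrier := I\<rparr>)"
        using finitely_presented_iff_pseudo_coherent[OF P.left_module_submodule[OF I] pc] fg by simp
    qed
  qed
qed

lemma pseudo_coherent_zero: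
  assumes "left_module R X" "carrier X = {\<zero>\<^bsub>X\<^esub>}"
  shows "pseudo_coherent R X"
  unfolding pseudo_coherent_def
proof (intro allI ballI)
  fix n f assume f: "f \<in> left_module_hom R (free_module R n) X"
  have "f v = \<zero>\<^bsub>X\<^esub>" if "v \<in> carrier (free_module R n)" for v
    using f assms(2) that by (auto simp: left_module_hom_def)
  then have "kernel_of (free_module R n) X f = carrier (free_module R n)" by auto
  then show "fg_subset R (free_module R n) (kernel_of (free_module R n) X f)"
    using fg_free_module left_module.axioms(1)[OF assms(1)] by metis
qed

text \<open>
  Descent of pseudo-coherence along a retraction \<open>\<pi> : T \<rightarrow> R\<close> with section \<open>\<iota>\<close>. The map \<open>\<tau>\<close>
  embeds \<open>X\<close> into \<open>T\<close>, and \<open>\<rho>\<close> extracts the component of an element of \<open>T\<close> in \<open>X\<close>; the last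
  hypothesis gives \<open>\<rho> (\<tau> x) = x\<close> whenever \<open>\<pi>\<close> preserves the unit.
\<close>

lemma pseudo_coherent_descent:
  assumes "ring T" "left_module R X" "pseudo_coherent T (regular_module T)"
    and \<pi>: "\<pi> \<in> additive_hom T R" "\<And>s t. \<lbrakk>s \<in> carrier T; t \<in> carrier T\<rbrakk> \<Longrightarrow> \<pi> (s \<otimes>\<^bsub>T\<^esub> t) = \<pi> s \<otimes>\<^bsub>R\<^esub> \<pi> t"
    and \<iota>: "\<iota> \<in> additive_hom R T" "\<And>r. r \<in> carrier R \<Longrightarrow> \<pi> (\<iota> r) = r"
    and \<tau>: "\<tau> \<in> additive_hom X T"
      "\<And>r x. \<lbrakk>r \<in> carrier R; x \<in> carrier X\<rbrakk> \<Longrightarrow> \<iota> r \<otimes>\<^bsub>T\<^esub> \<tau> x = \<tau> (r \<odot>\<^bsub>X\<^esub> x)"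
    and \<rho>: "\<rho> \<in> additive_hom T X"
      "\<And>t x. \<lbrakk>t \<in> carrier T; x \<in> carrier X\<rbrakk> \<Longrightarrow> \<rho> (t \<otimes>\<^bsub>T\<^esub> \<tau> x) = \<pi> t \<odot>\<^bsub>X\<^esub> x"
  shows "pseudo_coherent R X"
  unfolding pseudo_coherent_def
proof (intro allI ballI)
  fix n f assume f: "f \<in> left_module_hom R (free_module R n) X"
  interpret X: left_module R X by fact
  interpret T: ring T by fact
  note R = X.R.ring_axioms
  interpret P: left_module T "regular_module T" using assms(1) by (rule left_module_regular)
  interpret F: left_module R "free_module R n" using R by (rule left_module_free)
  interpret G: left_module T "free_module T n" using assms(1) by (rule left_module_free)
  let ?F = "free_module R n" and ?G = "free_module T n"
  note fD = left_module_homD[OF f]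
  define x where "x j = f (free_single R n j \<one>\<^bsub>R\<^esub>)" for j
  have x: "x j \<in> carrier X" for j
    unfolding x_def by (intro additive_homD(1)[OF fD(1)] free_single_closed R X.R.one_closed)
  have \<tau>x: "\<tau> (x j) \<in> carrier (regular_module T)" for j
    using additive_homD(1)[OF \<tau>(1) x] by (simp add: regular_module_simps)
  let ?f = "free_hom (regular_module T) n (\<lambda>j. \<tau> (x j))"
  have F': "?f \<in> left_module_hom T ?G (regular_module T)"
    by (rule free_hom_hom[OF P.left_module_axioms \<tau>x])
  have F'add: "?f \<in> additive_hom ?G T"
    using left_module_homD(1)[OF F'] by (simp add: hom_def regular_module_simps)
  \<comment> \<open>\<open>\<pi>\<close> and \<open>\<iota>\<close> on coefficient vectors; the former maps \<open>T\<close>-relations between the \<open>\<tau> (x j)\<close>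
      onto \<open>R\<close>-relations between the \<open>x j\<close>\<close>
  let ?\<pi> = "\<lambda>w. \<lambda>i\<in>{..<n}. \<pi> (w i)" and ?\<iota> = "\<lambda>v. \<lambda>i\<in>{..<n}. \<iota> (v i)"
  have \<pi>n: "?\<pi> \<in> additive_hom ?G ?F"
    by (intro additive_homI) (auto simp: free_module_def additive_homD[OF \<pi>(1)] PiE_iff)
  have \<iota>n: "?\<iota> \<in> additive_hom ?F ?G"
    by (intro additive_homI) (auto simp: free_module_def additive_homD[OF \<iota>(1)] PiE_iff)
  have \<pi>0: "\<pi> \<zero>\<^bsub>T\<^esub> = \<zero>\<^bsub>R\<^esub>" and \<iota>0: "\<iota> \<zero>\<^bsub>R\<^esub> = \<zero>\<^bsub>T\<^esub>"
    using additive_hom_zero[OF \<pi>(1)] additive_hom_zero[OF \<iota>(1)] T.abelian_group_axioms X.R.abelian_group_axioms by auto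
  have \<pi>_single: "?\<pi> (free_single T n j t) = free_single R n j (\<pi> t)" for j t
    using \<pi>0 by (auto simp: single_def regular_module_simps)
  have \<iota>_single: "?\<iota> (free_single R n j r) = free_single T n j (\<iota> r)" for j r
    using \<iota>0 by (auto simp: single_def regular_module_simps)
  have f_single: "f (free_single R n j r) = r \<odot>\<^bsub>X\<^esub> x j" if "r \<in> carrier R" for j r
    unfolding x_def by (rule left_module_hom_free_single[OF R f that])
  have \<rho>f: "\<rho> (?f w) = f (?\<pi> w)" if "w \<in> carrier ?G" for w
  proof (rule additive_hom_free_eqI[OF assms(1) X.M.abelian_group_axioms _ _ _ that])
    show "(\<lambda>w. \<rho> (?f w)) \<in> additive_hom ?G X"
      by (intro additive_homI) (simp_all add: additive_homD[OF F'add] additive_homD[OF \<rho>(1)])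
    show "(\<lambda>w. f (?\<pi> w)) \<in> additive_hom ?G X"
      by (intro additive_homI)
        (simp_all only: additive_homD[OF \<pi>n] additive_homD[OF fD(1)])
    fix j t assume j: "j < n" "t \<in> carrier T"
    then show "\<rho> (?f (free_single T n j t)) = f (?\<pi> (free_single T n j t))"
      using free_hom_single[OF P.left_module_axioms \<tau>x j] f_single additive_homD(1)[OF \<pi>(1) j(2)]
      unfolding \<pi>_single by (simp add: regular_module_simps \<rho>(2) x)
  qed
  have \<tau>f: "?f (?\<iota> v) = \<tau> (f v)" if "v \<in> carrier ?F" for v
  proof (rule additive_hom_free_eqI[OF R T.abelian_group_axioms _ _ _ that])
    show "(\<lambda>v. ?f (?\<iota> v)) \<in> additive_hom ?F T"
      by (intro additive_homI)
        (simp_all only: additive_homD[OF \<iota>n] additive_homD[OF F'add])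
    show "(\<lambda>v. \<tau> (f v)) \<in> additive_hom ?F T"
      by (intro additive_homI) (simp_all add: additive_homD[OF fD(1)] additive_homD[OF \<tau>(1)])
    fix j r assume j: "j < n" "r \<in> carrier R"
    then show "?f (?\<iota> (free_single R n j r)) = \<tau> (f (free_single R n j r))"
      using free_hom_single[OF P.left_module_axioms \<tau>x j(1), of "\<iota> r"] f_single additive_homD(1)[OF \<iota>(1) j(2)]
      unfolding \<iota>_single by (simp add: regular_module_simps \<tau>(2) x)
  qed
  have fg: "fg_subset T ?G (kernel_of ?G (regular_module T) ?f)"
    using assms(3) F' unfolding pseudo_coherent_def by blast
  show "fg_subset R ?F (kernel_of ?F X f)"
  proof (rule fg_subset_image[OF G.left_module_axioms F.left_module_axioms _ \<pi>n _ fg])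
    show "\<pi> \<in> carrier T \<rightarrow> carrier R" using additive_homD(1)[OF \<pi>(1)] by blast
    show "?\<pi> (t \<odot>\<^bsub>?G\<^esub> w) = \<pi> t \<odot>\<^bsub>?F\<^esub> ?\<pi> w" if "t \<in> carrier T" "w \<in> carrier ?G" for t w
      using that by (auto simp: free_module_def PiE_iff \<pi>(2) intro!: restrict_ext)
    show "?\<pi> ` kernel_of ?G (regular_module T) ?f = kernel_of ?F X f" (is "?l = ?r")
    proof (intro equalityI subsetI)
      fix v assume "v \<in> ?l"
      then obtain w where w: "v = ?\<pi> w" "w \<in> carrier ?G" "?f w = \<zero>\<^bsub>T\<^esub>"
        by (auto simp: regular_module_simps)
      have "f v = \<rho> \<zero>\<^bsub>T\<^esub>" unfolding w(1) using \<rho>f[OF w(2)] w(3) by simp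
      then show "v \<in> ?r"
        using additive_homD(1)[OF \<pi>n w(2)] w(1) additive_hom_zero[OF \<rho>(1) T.abelian_group_axioms X.M.abelian_group_axioms]
        by simp
    next
      fix v assume v: "v \<in> ?r"
      have "?f (?\<iota> v) = \<zero>\<^bsub>T\<^esub>"
        using \<tau>f[of v] v additive_hom_zero[OF \<tau>(1) X.M.abelian_group_axioms T.abelian_group_axioms] by simp
      moreover have "?\<pi> (?\<iota> v) = v"
        using v \<iota>(2) by (auto simp: free_module_def PiE_iff extensional_def fun_eq_iff)
      ultimately show "v \<in> ?l"
        using additive_homD(1)[OF \<iota>n, of v] v by (intro image_eqI[of _ _ "?\<iota> v"]) (simp_all add: regular_module_simps)
    qed
  qed auto
qed

section \<open>The universal property of the tensor product\<close>

context abelian_group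
begin

lemma minus_self: "x \<in> carrier G \<Longrightarrow> x \<ominus> x = \<zero>"
  by (simp add: a_minus_def r_neg)

lemma minus_add_cancel:
  assumes "x \<in> carrier G" "y \<in> carrier G"
  shows "x \<oplus> y \<ominus> x \<ominus> y = \<zero>"
proof -
  have "x \<oplus> y \<ominus> x \<ominus> y = (x \<oplus> y) \<ominus> (x \<oplus> y)"
    using assms by (simp add: a_minus_def minus_add a_assoc)
  then show ?thesis using assms by (simp add: minus_self)
qed

end

text \<open>
  The additive extension of \<open>\<phi>\<close> to formal sums of pairs.
\<close>

definition frag_sum ::
  "('c, 'z) ring_scheme \<Rightarrow> ('a \<Rightarrow> 'b \<Rightarrow> 'c) \<Rightarrow> ('a \<times> 'b \<Rightarrow>\<^sub>0 int) \<Rightarrow> 'c" where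
  "frag_sum C \<phi> f =
    (\<Oplus>\<^bsub>C\<^esub>p\<in>Poly_Mapping.keys f. [Poly_Mapping.lookup f p] \<cdot>\<^bsub>C\<^esub> \<phi> (fst p) (snd p))"

lemma tensor_lift_eq: "tensor_lift C \<phi> c = frag_sum C \<phi> (SOME f. f \<in> c)"
  by (simp add: tensor_lift_def frag_sum_def Let_def)

text \<open>
  An arbitrary map \<open>\<phi>\<close> from \<open>A \<times> B\<close> to an abelian group; no additivity is required.
\<close>

locale map_into_group = abelian_group C for C :: "('c, 'z) ring_scheme" (structure) +
  fixes A :: "'a set" and B :: "'b set" and \<phi> :: "'a \<Rightarrow> 'b \<Rightarrow> 'c"
  assumes map_closed: "\<lbrakk>a \<in> A; b \<in> B\<rbrakk> \<Longrightarrow> \<phi> a b \<in> carrier C"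
begin

lemma frag_sum_superset:
  assumes "finite S" "Poly_Mapping.keys f \<subseteq> S" "S \<subseteq> A \<times> B"
  shows "frag_sum C \<phi> f = (\<Oplus>p\<in>S. [Poly_Mapping.lookup f p] \<cdot> \<phi> (fst p) (snd p))"
  unfolding frag_sum_def
proof (rule add.finprod_mono_neutral_cong_left[OF assms(1,2)])
  have "\<phi> (fst p) (snd p) \<in> carrier C" if "p \<in> S" for p using that assms(3) map_closed by auto
  then show "(\<lambda>p. [Poly_Mapping.lookup f p] \<cdot> \<phi> (fst p) (snd p)) \<in> S \<rightarrow> carrier C"
    by (auto intro: add.int_pow_closed)
  show "[Poly_Mapping.lookup f p] \<cdot> \<phi> (fst p) (snd p) = \<zero>" if "p \<in> S - Poly_Mapping.keys f" for p
    using that by (simp add: in_keys_iff add_pow_def)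
qed auto

lemma term_closed:
  assumes "p \<in> A \<times> B" shows "[(k :: int)] \<cdot> \<phi> (fst p) (snd p) \<in> carrier C"
  using assms map_closed by (intro add.int_pow_closed) auto

lemma frag_sum_closed:
  assumes "Poly_Mapping.keys f \<subseteq> A \<times> B" shows "frag_sum C \<phi> f \<in> carrier C"
  unfolding frag_sum_def using assms term_closed by (intro finsum_closed) auto

lemma frag_sum_add:
  assumes "Poly_Mapping.keys f \<subseteq> A \<times> B" "Poly_Mapping.keys g \<subseteq> A \<times> B"
  shows "frag_sum C \<phi> (f + g) = frag_sum C \<phi> f \<oplus> frag_sum C \<phi> g"
proof -
  let ?S = "Poly_Mapping.keys f \<union> Poly_Mapping.keys g"
  have S: "finite ?S" "?S \<subseteq> A \<times> B" "Poly_Mapping.keys (f + g) \<subseteq> ?S"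
    using assms Poly_Mapping.keys_add[of f g] by auto
  have c: "\<phi> (fst p) (snd p) \<in> carrier C" if "p \<in> ?S" for p using that S(2) map_closed by auto
  have "frag_sum C \<phi> (f + g)
      = (\<Oplus>p\<in>?S. [(Poly_Mapping.lookup f p + Poly_Mapping.lookup g p)] \<cdot> \<phi> (fst p) (snd p))"
    using frag_sum_superset[OF S(1,3,2)] by (simp add: lookup_add)
  also have "\<dots> = (\<Oplus>p\<in>?S. [Poly_Mapping.lookup f p] \<cdot> \<phi> (fst p) (snd p)
      \<oplus> [Poly_Mapping.lookup g p] \<cdot> \<phi> (fst p) (snd p))"
    using c by (intro add.finprod_cong') (auto simp: add.int_pow_mult)
  also have "\<dots> = (\<Oplus>p\<in>?S. [Poly_Mapping.lookup f p] \<cdot> \<phi> (fst p) (snd p))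
      \<oplus> (\<Oplus>p\<in>?S. [Poly_Mapping.lookup g p] \<cdot> \<phi> (fst p) (snd p))"
    using c by (intro finsum_addf) auto
  also have "\<dots> = frag_sum C \<phi> f \<oplus> frag_sum C \<phi> g"
    using frag_sum_superset[OF S(1) _ S(2), of f] frag_sum_superset[OF S(1) _ S(2), of g] by auto
  finally show ?thesis .
qed

lemma frag_sum_zero: "frag_sum C \<phi> 0 = \<zero>"
  by (simp add: frag_sum_def)

lemma frag_sum_minus:
  assumes "Poly_Mapping.keys f \<subseteq> A \<times> B"
  shows "frag_sum C \<phi> (- f) = \<ominus> frag_sum C \<phi> f"
proof -
  have "frag_sum C \<phi> (- f) \<oplus> frag_sum C \<phi> f = \<zero>"
    using frag_sum_add[of "- f" f] assms frag_sum_zero by simp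
  then show ?thesis using assms frag_sum_closed minus_equality by simp
qed

lemma frag_sum_diff:
  assumes "Poly_Mapping.keys f \<subseteq> A \<times> B" "Poly_Mapping.keys g \<subseteq> A \<times> B"
  shows "frag_sum C \<phi> (f - g) = frag_sum C \<phi> f \<ominus> frag_sum C \<phi> g"
  using frag_sum_add[of f "- g"] assms by (simp add: frag_sum_minus a_minus_def)

lemma frag_sum_frag_of:
  assumes "a \<in> A" "b \<in> B" shows "frag_sum C \<phi> (frag_of (a, b)) = \<phi> a b"
  using map_closed[OF assms] by (simp add: frag_sum_def add.int_pow_1)

end

context bimodule
begin

lemma op_module_simps:
  "carrier (op_module M) = carrier M" "\<zero>\<^bsub>op_module M\<^esub> = \<zero>\<^bsub>M\<^esub>"
  "x \<oplus>\<^bsub>op_module M\<^esub> y = x \<oplus>\<^bsub>M\<^esub> y" "r \<odot>\<^bsub>op_module M\<^esub> x = rsmult M x r"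
  by (simp_all add: op_module_def)

lemma rsmult_closed: "\<lbrakk>x \<in> carrier M; r \<in> carrier R\<rbrakk> \<Longrightarrow> rsmult M x r \<in> carrier M"
  using left_module.smult_closed[OF right_module, of r x]
  by (simp add: opposite_ring_def op_module_simps)

lemma rsmult_mult: "\<lbrakk>x \<in> carrier M; r \<in> carrier R; s \<in> carrier R\<rbrakk>
    \<Longrightarrow> rsmult M x (r \<otimes> s) = rsmult M (rsmult M x r) s"
  using left_module.smult_assoc[OF right_module, of s r x]
  by (simp add: opposite_ring_def op_module_simps)

lemma rsmult_one: "x \<in> carrier M \<Longrightarrow> rsmult M x \<one> = x"
  using left_module.smult_one[OF right_module, of x]
  by (simp add: opposite_ring_def op_module_simps)

lemma rsmult_add_left: "\<lbrakk>x \<in> carrier M; y \<in> carrier M; r \<in> carrier R\<rbrakk>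
    \<Longrightarrow> rsmult M (x \<oplus>\<^bsub>M\<^esub> y) r = rsmult M x r \<oplus>\<^bsub>M\<^esub> rsmult M y r"
  using left_module.smult_r_distr[OF right_module, of r x y]
  by (simp add: opposite_ring_def op_module_simps)

lemma rsmult_add_right: "\<lbrakk>x \<in> carrier M; r \<in> carrier R; s \<in> carrier R\<rbrakk>
    \<Longrightarrow> rsmult M x (r \<oplus> s) = rsmult M x r \<oplus>\<^bsub>M\<^esub> rsmult M x s"
  using left_module.smult_l_distr[OF right_module, of r s x]
  by (simp add: opposite_ring_def op_module_simps)

text \<open>
  A map on \<open>M \<times> B\<close> with values in \<open>C\<close> that is biadditive and balanced modulo \<open>W\<close>.
\<close>

definition balanced_mod ::
  "('c, 'z) ring_scheme \<Rightarrow> 'c set \<Rightarrow> ('r, 'b) module \<Rightarrow> ('m \<Rightarrow> 'b \<Rightarrow> 'c) \<Rightarrow> bool" where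
  "balanced_mod C W B \<phi> \<longleftrightarrow> (\<forall>a\<in>carrier M. \<forall>b\<in>carrier B. \<phi> a b \<in> carrier C \<and>
    (\<forall>a'\<in>carrier M. \<phi> (a \<oplus>\<^bsub>M\<^esub> a') b \<ominus>\<^bsub>C\<^esub> \<phi> a b \<ominus>\<^bsub>C\<^esub> \<phi> a' b \<in> W) \<and>
    (\<forall>b'\<in>carrier B. \<phi> a (b \<oplus>\<^bsub>B\<^esub> b') \<ominus>\<^bsub>C\<^esub> \<phi> a b \<ominus>\<^bsub>C\<^esub> \<phi> a b' \<in> W) \<and>
    (\<forall>r\<in>carrier R. \<phi> (rsmult M a r) b \<ominus>\<^bsub>C\<^esub> \<phi> a (r \<odot>\<^bsub>B\<^esub> b) \<in> W))"

text \<open>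
  A biadditive map on \<open>M \<times> B\<close> with \<open>\<phi> (a r) b = \<phi> a (r b)\<close>.
\<close>

definition balanced_map ::
  "('c, 'z) ring_scheme \<Rightarrow> ('r, 'b) module \<Rightarrow> ('m \<Rightarrow> 'b \<Rightarrow> 'c) \<Rightarrow> bool" where
  "balanced_map C B \<phi> \<longleftrightarrow> (\<forall>a\<in>carrier M. \<forall>b\<in>carrier B. \<phi> a b \<in> carrier C \<and>
    (\<forall>a'\<in>carrier M. \<phi> (a \<oplus>\<^bsub>M\<^esub> a') b = \<phi> a b \<oplus>\<^bsub>C\<^esub> \<phi> a' b) \<and>
    (\<forall>b'\<in>carrier B. \<phi> a (b \<oplus>\<^bsub>B\<^esub> b') = \<phi> a b \<oplus>\<^bsub>C\<^esub> \<phi> a b') \<and>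
    (\<forall>r\<in>carrier R. \<phi> (rsmult M a r) b = \<phi> a (r \<odot>\<^bsub>B\<^esub> b)))"

lemma balanced_map_imp_balanced_mod:
  assumes "abelian_group C" "left_module R B" "balanced_map C B \<phi>"
  shows "balanced_mod C {\<zero>\<^bsub>C\<^esub>} B \<phi>"
proof -
  interpret C: abelian_group C by fact
  show ?thesis
    using assms(3) left_module.smult_closed[OF assms(2)]
    unfolding balanced_map_def balanced_mod_def by (simp add: C.minus_add_cancel C.minus_self)
qed

end

text \<open>
  The tensor product of the bimodule \<open>M\<close> with a left module \<open>B\<close>. The abbreviations denote the
  free abelian group on pairs, the subgroup of relations, the quotient as an abelian group, the
  map to pure tensors, and (below) the quotient as a left \<open>R\<close>-module.
\<close>

locale bimodule_tensor = bimodule R M + B: left_module R B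
  for R :: "'r ring" (structure) and M :: "('r, 'm) bimodule" (structure) and B :: "('r, 'b) module"
begin

abbreviation formal_sum :: "('m \<times> 'b \<Rightarrow>\<^sub>0 int) \<Rightarrow> bool" where
  "formal_sum f \<equiv> Poly_Mapping.keys f \<subseteq> carrier M \<times> carrier B"
abbreviation "\<G> \<equiv> free_Abelian_group (carrier (op_module M) \<times> carrier B)"
abbreviation "\<K> \<equiv> tensor_kernel R (op_module M) B"
abbreviation "\<T> \<equiv> tensor_group R (op_module M) B"
abbreviation "pure \<equiv> pure_tensor R (op_module M) B"

text \<open>
  The class of a formal sum of pairs in the tensor product.
\<close>

definition tensor_class :: "('m \<times> 'b \<Rightarrow>\<^sub>0 int) \<Rightarrow> ('m \<times> 'b \<Rightarrow>\<^sub>0 int) set" where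
  "tensor_class f = \<K> #>\<^bsub>\<G>\<^esub> f"

lemma kernel_subgroup: "subgroup \<K> \<G>"
  by (rule tensor_kernel_subgroup) (rule bimodule_axioms, rule B.left_module_axioms)

lemma kernel_normal: "\<K> \<lhd> \<G>"
  by (rule comm_group.subgroup_imp_normal[OF abelian_free_Abelian_group kernel_subgroup])

lemma tensor_group_simps:
  "carrier \<T> = carrier (\<G> Mod \<K>)" "\<zero>\<^bsub>\<T>\<^esub> = \<one>\<^bsub>\<G> Mod \<K>\<^esub>" "x \<oplus>\<^bsub>\<T>\<^esub> y = x \<otimes>\<^bsub>\<G> Mod \<K>\<^esub> y"
  by (simp_all add: tensor_group_def)

lemma abelian_group_tensor: "abelian_group \<T>"
proof -
  have "comm_group (\<G> Mod \<K>)"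
    by (rule comm_group.abelian_FactGroup[OF abelian_free_Abelian_group kernel_subgroup])
  then interpret Q: comm_group "\<G> Mod \<K>" .
  have inv: "\<exists>y\<in>carrier (\<G> Mod \<K>). y \<otimes>\<^bsub>\<G> Mod \<K>\<^esub> x = \<one>\<^bsub>\<G> Mod \<K>\<^esub>" if "x \<in> carrier (\<G> Mod \<K>)" for x
    using Q.l_inv[OF that] Q.inv_closed[OF that] by (rule bexI)
  show ?thesis
    by (rule abelian_groupI; simp only: tensor_group_simps)
      (use inv in \<open>simp_all only: Q.m_ac Q.m_closed Q.one_closed Q.r_one Q.l_one\<close>)
qed

lemma tensor_class_closed:
  "formal_sum f \<Longrightarrow> tensor_class f \<in> carrier \<T>"
  by (auto simp: tensor_class_def tensor_group_simps FactGroup_def RCOSETS_def op_module_simps)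

lemma tensor_class_surj:
  assumes "c \<in> carrier \<T>"
  obtains f where "formal_sum f" "c = tensor_class f"
  using assms by (auto simp: tensor_class_def tensor_group_simps FactGroup_def RCOSETS_def op_module_simps)

lemma tensor_class_add:
  assumes "formal_sum f" "formal_sum g"
  shows "tensor_class f \<oplus>\<^bsub>\<T>\<^esub> tensor_class g = tensor_class (f + g)"
  using normal.rcos_sum[OF kernel_normal, of f g] assms
  by (simp add: tensor_class_def tensor_group_simps FactGroup_def op_module_simps)

lemma tensor_class_zero: "\<zero>\<^bsub>\<T>\<^esub> = tensor_class 0"
  using group.coset_mult_one[OF group_free_Abelian_group, of \<K> "carrier (op_module M) \<times> carrier B"]
    subgroup.subset[OF kernel_subgroup]
  by (simp add: tensor_class_def tensor_group_simps FactGroup_def)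

lemma tensor_class_eq_iff:
  assumes "formal_sum f" "formal_sum g"
  shows "tensor_class f = tensor_class g \<longleftrightarrow> f - g \<in> \<K>"
proof -
  interpret G: group \<G> by simp
  have "tensor_class f = tensor_class g \<longleftrightarrow> f \<in> tensor_class g"
    unfolding tensor_class_def
    using G.rcos_self[of f \<K>] G.repr_independence[of f \<K> g] kernel_subgroup assms
    by (auto simp: op_module_simps)
  also have "\<dots> \<longleftrightarrow> f - g \<in> \<K>"
  proof -
    have "f = h + g \<longleftrightarrow> f - g = h" for h by (auto simp: algebra_simps)
    then show ?thesis unfolding tensor_class_def r_coset_def by simp
  qed
  finally show ?thesis .
qed

lemma pure_eq: "pure a b = tensor_class (frag_of (a, b))"
  by (simp add: pure_tensor_def tensor_class_def)

lemma pure_closed: "\<lbrakk>a \<in> carrier M; b \<in> carrier B\<rbrakk> \<Longrightarrow> pure a b \<in> carrier \<T>"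
  unfolding pure_eq by (rule tensor_class_closed) auto

lemma relator_in_kernel: "x \<in> tensor_relators R (op_module M) B \<Longrightarrow> x \<in> \<K>"
  unfolding tensor_kernel_def by (rule generate.incl)

lemma keys_frag_add:
  "Poly_Mapping.keys f \<subseteq> S \<Longrightarrow> Poly_Mapping.keys g \<subseteq> S \<Longrightarrow> Poly_Mapping.keys (f + g) \<subseteq> S"
  using Poly_Mapping.keys_add[of f g] by blast

lemma pure_add_left:
  assumes "a \<in> carrier M" "a' \<in> carrier M" "b \<in> carrier B"
  shows "pure (a \<oplus>\<^bsub>M\<^esub> a') b = pure a b \<oplus>\<^bsub>\<T>\<^esub> pure a' b"
proof -
  have "frag_of (a \<oplus>\<^bsub>M\<^esub> a', b) - frag_of (a, b) - frag_of (a', b) \<in> \<K>"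
    by (rule relator_in_kernel) (use assms in \<open>auto simp: tensor_relators_def op_module_simps\<close>)
  then show ?thesis
    unfolding pure_eq using assms
    by (subst tensor_class_add) (auto simp: tensor_class_eq_iff keys_frag_add diff_diff_eq)
qed

lemma pure_add_right:
  assumes "a \<in> carrier M" "b \<in> carrier B" "b' \<in> carrier B"
  shows "pure a (b \<oplus>\<^bsub>B\<^esub> b') = pure a b \<oplus>\<^bsub>\<T>\<^esub> pure a b'"
proof -
  have "frag_of (a, b \<oplus>\<^bsub>B\<^esub> b') - frag_of (a, b) - frag_of (a, b') \<in> \<K>"
    by (rule relator_in_kernel) (use assms in \<open>auto simp: tensor_relators_def op_module_simps\<close>)
  then show ?thesis
    unfolding pure_eq using assms
    by (subst tensor_class_add) (auto simp: tensor_class_eq_iff keys_frag_add diff_diff_eq)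
qed

lemma pure_balanced:
  assumes "a \<in> carrier M" "b \<in> carrier B" "r \<in> carrier R"
  shows "pure (rsmult M a r) b = pure a (r \<odot>\<^bsub>B\<^esub> b)"
proof -
  have "frag_of (rsmult M a r, b) - frag_of (a, r \<odot>\<^bsub>B\<^esub> b) \<in> \<K>"
    by (rule relator_in_kernel) (use assms in \<open>auto simp: tensor_relators_def op_module_simps\<close>)
  then show ?thesis
    unfolding pure_eq using assms
    by (auto simp: tensor_class_eq_iff rsmult_closed B.smult_closed)
qed

lemma tensor_induct [consumes 1, case_names zero pure add]:
  assumes "c \<in> carrier \<T>"
    and zero: "P \<zero>\<^bsub>\<T>\<^esub>"
    and pure: "\<And>a b. \<lbrakk>a \<in> carrier M; b \<in> carrier B\<rbrakk> \<Longrightarrow> P (pure a b)"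
    and add: "\<And>x y. \<lbrakk>x \<in> carrier \<T>; y \<in> carrier \<T>; P x; P y\<rbrakk> \<Longrightarrow> P (x \<oplus>\<^bsub>\<T>\<^esub> y)"
  shows "P c"
proof -
  interpret T: abelian_group \<T> by (rule abelian_group_tensor)
  obtain f where f: "formal_sum f" and c: "c = tensor_class f"
    using tensor_class_surj[OF assms(1)] .
  have neg: "tensor_class (- g) = \<ominus>\<^bsub>\<T>\<^esub> tensor_class g"
    if "formal_sum g" for g
    using that tensor_class_add[of "- g" g] tensor_class_closed[of g] tensor_class_closed[of "- g"]
    by (intro T.minus_equality[symmetric]) (simp_all add: tensor_class_zero)
  have "formal_sum f \<and> P (tensor_class f) \<and> P (\<ominus>\<^bsub>\<T>\<^esub> tensor_class f)"
    using f
  proof (induction f rule: frag_induction)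
    case zero
    have minus0: "\<ominus>\<^bsub>\<T>\<^esub> \<zero>\<^bsub>\<T>\<^esub> = \<zero>\<^bsub>\<T>\<^esub>" by (rule T.minus_equality) auto
    show ?case unfolding tensor_class_zero[symmetric] minus0 using assms(2) by simp
  next
    case (one p)
    then obtain a b where p: "p = (a, b)" "a \<in> carrier M" "b \<in> carrier B" by auto
    have "pure (\<ominus>\<^bsub>M\<^esub> a) b = \<ominus>\<^bsub>\<T>\<^esub> pure a b"
      using p by (intro additive_hom_inv[where f = "\<lambda>a. pure a b"] additive_homI)
        (auto simp: pure_closed pure_add_left abelian_group_tensor M.abelian_group_axioms)
    then show ?case using pure[of a b] pure[of "\<ominus>\<^bsub>M\<^esub> a" b] p by (simp add: pure_eq)
  next
    case (diff f g)
    let ?f = "tensor_class f" and ?g = "tensor_class g"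
    have c: "?f \<in> carrier \<T>" "?g \<in> carrier \<T>" using diff by (auto intro: tensor_class_closed)
    have "tensor_class (f - g) = ?f \<oplus>\<^bsub>\<T>\<^esub> \<ominus>\<^bsub>\<T>\<^esub> ?g"
      using diff tensor_class_add[of f "- g"] by (simp add: neg)
    moreover have "\<ominus>\<^bsub>\<T>\<^esub> (?f \<oplus>\<^bsub>\<T>\<^esub> \<ominus>\<^bsub>\<T>\<^esub> ?g) = (\<ominus>\<^bsub>\<T>\<^esub> ?f) \<oplus>\<^bsub>\<T>\<^esub> ?g"
      using c by (simp add: T.minus_add)
    moreover have "formal_sum (f - g)"
      using diff keys_diff[of f g] by blast
    ultimately show ?case using diff c by (auto intro!: add)
  qed
  then show ?thesis using c by simp
qed

lemma additive_hom_tensor_eqI: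
  assumes "abelian_group Y" "f \<in> additive_hom \<T> Y" "g \<in> additive_hom \<T> Y"
    and "\<And>a b. \<lbrakk>a \<in> carrier M; b \<in> carrier B\<rbrakk> \<Longrightarrow> f (pure a b) = g (pure a b)"
    and "c \<in> carrier \<T>"
  shows "f c = g c"
  using assms(5)
  by (induction rule: tensor_induct)
    (simp_all add: additive_hom_zero[OF assms(2) abelian_group_tensor assms(1)]
      additive_hom_zero[OF assms(3) abelian_group_tensor assms(1)] assms(4)
      additive_homD(2)[OF assms(2)] additive_homD(2)[OF assms(3)])

text \<open>
  A version of the universal property for maps that are biadditive and balanced only modulo a
  subgroup \<open>W\<close>. With \<open>W = 0\<close> it shows that \<open>tensor_lift\<close> is well defined.
\<close>

lemma frag_sum_kernel:
  assumes C: "abelian_group C" and W: "subgroup W (add_monoid C)"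
    and bal: "balanced_mod C W B \<phi>"
    and "f \<in> \<K>"
  shows "frag_sum C \<phi> f \<in> W"
proof -
  interpret C: map_into_group C "carrier M" "carrier B" \<phi>
    using C bal by (intro map_into_group.intro map_into_group_axioms.intro) (auto simp: balanced_mod_def)
  interpret W: subgroup W "add_monoid C" by fact
  have keys: "formal_sum g" if "g \<in> \<K>" for g
    using that subgroup.subset[OF kernel_subgroup] unfolding op_module_simps
    by (meson carrier_free_Abelian_group_iff subsetD)
  have diff: "formal_sum (g - h)"
    if "formal_sum g" "formal_sum h" for g h
    using that keys_diff[of g h] by blast
  have rel: "frag_sum C \<phi> g \<in> W" if "g \<in> tensor_relators R (op_module M) B" for g
    using that bal unfolding tensor_relators_def op_module_simps balanced_mod_def
    by (auto simp: C.frag_sum_diff C.frag_sum_frag_of diff rsmult_closed B.smult_closed)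
  have mem: "g \<in> \<K>" if "g \<in> generate \<G> (tensor_relators R (op_module M) B)" for g
    using that by (simp add: tensor_kernel_def)
  have "f \<in> generate \<G> (tensor_relators R (op_module M) B)"
    using assms(4) by (simp add: tensor_kernel_def)
  then show ?thesis
  proof (induction rule: generate.induct)
    case one
    then show ?case using W.one_closed by (simp add: C.frag_sum_zero)
  next
    case (incl h)
    then show ?case by (rule rel)
  next
    case (inv h)
    have "formal_sum h" by (rule keys[OF relator_in_kernel[OF inv]])
    then show ?case
      using W.m_inv_closed[OF rel[OF inv]] by (simp add: C.frag_sum_minus op_module_simps a_inv_def)
  next
    case (eng g h)
    then show ?case
      using W.m_closed[OF eng.IH] keys[OF mem] by (simp add: C.frag_sum_add)
  qed
qed

lemma tensor_lift_class:
  assumes C: "abelian_group C"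
    and bal: "balanced_map C B \<phi>"
    and f: "formal_sum f"
  shows "tensor_lift C \<phi> (tensor_class f) = frag_sum C \<phi> f"
proof -
  interpret C: map_into_group C "carrier M" "carrier B" \<phi>
    using C bal by (intro map_into_group.intro map_into_group_axioms.intro) (auto simp: balanced_map_def)
  interpret G: group \<G> by simp
  define g where "g = (SOME g. g \<in> tensor_class f)"
  have "f \<in> tensor_class f"
    unfolding tensor_class_def using f by (intro G.rcos_self kernel_subgroup) (simp add: op_module_simps)
  then have gf: "g \<in> tensor_class f" unfolding g_def by (rule someI)
  have "tensor_class f \<subseteq> carrier \<G>"
    unfolding tensor_class_def
    using f subgroup.subset[OF kernel_subgroup] by (intro G.r_coset_subset_G) (simp_all add: op_module_simps)
  then have g: "formal_sum g" using gf
    unfolding op_module_simps by (meson carrier_free_Abelian_group_iff subsetD)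
  have "g - f \<in> \<K>" using gf unfolding tensor_class_def r_coset_def by auto
  moreover have "subgroup {\<zero>\<^bsub>C\<^esub>} (add_monoid C)"
    using group.triv_subgroup[OF C.a_group] by simp
  ultimately have "frag_sum C \<phi> (g - f) \<in> {\<zero>\<^bsub>C\<^esub>}"
    using balanced_map_imp_balanced_mod[OF C B.left_module_axioms bal] by (intro frag_sum_kernel[OF C])
  then have "frag_sum C \<phi> g = frag_sum C \<phi> f"
    using f g C.frag_sum_closed C.minus_equality[of "frag_sum C \<phi> g" "\<ominus>\<^bsub>C\<^esub> frag_sum C \<phi> f"]
    by (simp add: C.frag_sum_diff a_minus_def)
  then show ?thesis by (simp add: tensor_lift_eq g_def)
qed

lemma tensor_lift_hom:
  assumes C: "abelian_group C"
    and bal: "balanced_map C B \<phi>"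
  shows "tensor_lift C \<phi> \<in> additive_hom \<T> C"
    and "\<And>a b. \<lbrakk>a \<in> carrier M; b \<in> carrier B\<rbrakk> \<Longrightarrow> tensor_lift C \<phi> (pure a b) = \<phi> a b"
proof -
  interpret C: map_into_group C "carrier M" "carrier B" \<phi>
    using C bal by (intro map_into_group.intro map_into_group_axioms.intro) (auto simp: balanced_map_def)
  have lift: "tensor_lift C \<phi> (tensor_class f) = frag_sum C \<phi> f"
    if "formal_sum f" for f
    using assms that by (rule tensor_lift_class)
  show "tensor_lift C \<phi> (pure a b) = \<phi> a b" if "a \<in> carrier M" "b \<in> carrier B" for a b
    using that by (simp add: pure_eq lift C.frag_sum_frag_of)
  show "tensor_lift C \<phi> \<in> additive_hom \<T> C"
  proof (rule additive_homI)
    fix x y assume "x \<in> carrier \<T>" "y \<in> carrier \<T>"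
    then obtain f g where "formal_sum f" "x = tensor_class f"
      "formal_sum g" "y = tensor_class g"
      using tensor_class_surj by metis
    then show "tensor_lift C \<phi> (x \<oplus>\<^bsub>\<T>\<^esub> y) = tensor_lift C \<phi> x \<oplus>\<^bsub>C\<^esub> tensor_lift C \<phi> y"
      by (simp add: tensor_class_add lift keys_frag_add C.frag_sum_add)
  next
    fix x assume "x \<in> carrier \<T>"
    then obtain f where "formal_sum f" "x = tensor_class f"
      by (rule tensor_class_surj)
    then show "tensor_lift C \<phi> x \<in> carrier C" by (simp add: lift C.frag_sum_closed)
  qed
qed

text \<open>
  If a sum of pure tensors vanishes, then the corresponding sum of values of \<open>\<phi>\<close> lies in \<open>W\<close>,
  for every \<open>\<phi>\<close> that is biadditive and balanced modulo \<open>W\<close>. This replaces a map to a quotient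
  group, and applies to maps that involve an arbitrary choice of representatives.
\<close>

lemma tensor_relation:
  assumes C: "abelian_group C" and W: "subgroup W (add_monoid C)"
    and bal: "balanced_mod C W B \<phi>"
    and J: "finite J" "\<And>j. j \<in> J \<Longrightarrow> a j \<in> carrier M" "\<And>j. j \<in> J \<Longrightarrow> b j \<in> carrier B"
    and sum: "(\<Oplus>\<^bsub>\<T>\<^esub>j\<in>J. pure (a j) (b j)) = \<zero>\<^bsub>\<T>\<^esub>"
  shows "(\<Oplus>\<^bsub>C\<^esub>j\<in>J. \<phi> (a j) (b j)) \<in> W"
proof -
  interpret C: map_into_group C "carrier M" "carrier B" \<phi>
    using C bal by (intro map_into_group.intro map_into_group_axioms.intro) (auto simp: balanced_mod_def)
  interpret T: abelian_group \<T> by (rule abelian_group_tensor)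
  have ind: "formal_sum (\<Sum>j\<in>J. frag_of (a j, b j))
      \<and> (\<Oplus>\<^bsub>\<T>\<^esub>j\<in>J. pure (a j) (b j)) = tensor_class (\<Sum>j\<in>J. frag_of (a j, b j))
      \<and> (\<Oplus>\<^bsub>C\<^esub>j\<in>J. \<phi> (a j) (b j)) = frag_sum C \<phi> (\<Sum>j\<in>J. frag_of (a j, b j))"
    using J
  proof (induction J rule: finite_induct)
    case empty
    then show ?case by (simp add: tensor_class_zero C.frag_sum_zero)
  next
    case (insert i J)
    have k: "formal_sum (frag_of (a i, b i))" using insert.prems by simp
    have "(\<Oplus>\<^bsub>\<T>\<^esub>j\<in>insert i J. pure (a j) (b j)) = pure (a i) (b i) \<oplus>\<^bsub>\<T>\<^esub> (\<Oplus>\<^bsub>\<T>\<^esub>j\<in>J. pure (a j) (b j))"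
      using insert by (intro T.finsum_insert) (auto simp: pure_closed)
    moreover have "(\<Oplus>\<^bsub>C\<^esub>j\<in>insert i J. \<phi> (a j) (b j)) = \<phi> (a i) (b i) \<oplus>\<^bsub>C\<^esub> (\<Oplus>\<^bsub>C\<^esub>j\<in>J. \<phi> (a j) (b j))"
      using insert by (intro C.finsum_insert) (auto simp: C.map_closed)
    ultimately show ?case
      using insert k
      by (simp add: pure_eq tensor_class_add keys_frag_add C.frag_sum_add C.frag_sum_frag_of)
  qed
  then have "(\<Sum>j\<in>J. frag_of (a j, b j)) \<in> \<K>"
    using sum tensor_class_eq_iff[of "\<Sum>j\<in>J. frag_of (a j, b j)" 0] by (simp add: tensor_class_zero)
  then have "frag_sum C \<phi> (\<Sum>j\<in>J. frag_of (a j, b j)) \<in> W"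
    by (rule frag_sum_kernel[OF C W bal])
  then show ?thesis using ind by simp
qed

abbreviation "\<M> \<equiv> tensor_module R M B"

lemma tensor_module_simps:
  "carrier \<M> = carrier \<T>" "\<zero>\<^bsub>\<M>\<^esub> = \<zero>\<^bsub>\<T>\<^esub>" "x \<oplus>\<^bsub>\<M>\<^esub> y = x \<oplus>\<^bsub>\<T>\<^esub> y"
  by (simp_all add: tensor_module_def)

lemma tensor_smult:
  assumes "r \<in> carrier R"
  shows "(\<lambda>x. r \<odot>\<^bsub>\<M>\<^esub> x) \<in> additive_hom \<T> \<T>"
    and "\<And>a b. \<lbrakk>a \<in> carrier M; b \<in> carrier B\<rbrakk> \<Longrightarrow> r \<odot>\<^bsub>\<M>\<^esub> pure a b = pure (r \<odot>\<^bsub>M\<^esub> a) b"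
proof -
  have eq: "r \<odot>\<^bsub>\<M>\<^esub> x = tensor_lift \<T> (\<lambda>m b. pure (r \<odot>\<^bsub>M\<^esub> m) b) x" for x
    by (simp add: tensor_module_def)
  have bal: "balanced_map \<T> B (\<lambda>m b. pure (r \<odot>\<^bsub>M\<^esub> m) b)"
    unfolding balanced_map_def using assms
    by (simp add: pure_closed smult_closed smult_r_distr pure_add_left pure_add_right
      rsmult_closed B.smult_closed flip: smult_rsmult pure_balanced)
  note lift = tensor_lift_hom[OF abelian_group_tensor bal]
  show "(\<lambda>x. r \<odot>\<^bsub>\<M>\<^esub> x) \<in> additive_hom \<T> \<T>"
    unfolding eq by (rule lift(1))
  show "r \<odot>\<^bsub>\<M>\<^esub> pure a b = pure (r \<odot>\<^bsub>M\<^esub> a) b" if "a \<in> carrier M" "b \<in> carrier B" for a b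
    unfolding eq using that by (rule lift(2))
qed

lemma left_module_tensor: "left_module R \<M>"
proof -
  interpret T: abelian_group \<T> by (rule abelian_group_tensor)
  interpret N: abelian_group \<M>
    by (rule abelian_groupI)
      (simp_all add: tensor_module_simps T.a_ac abelian_groupE(6)[OF abelian_group_tensor])
  note hom = tensor_smult(1) and smult_pure = tensor_smult(2)
  have closed: "r \<odot>\<^bsub>\<M>\<^esub> x \<in> carrier \<T>" if "r \<in> carrier R" "x \<in> carrier \<T>" for r x
    using additive_homD(1)[OF hom] that .
  show ?thesis
  proof (intro left_module.intro left_module_axioms.intro R.ring_axioms N.abelian_group_axioms;
      simp only: tensor_module_simps)
    fix r s x assume r: "r \<in> carrier R" and s: "s \<in> carrier R" and x: "x \<in> carrier \<T>"
    show "(r \<oplus> s) \<odot>\<^bsub>\<M>\<^esub> x = r \<odot>\<^bsub>\<M>\<^esub> x \<oplus>\<^bsub>\<T>\<^esub> s \<odot>\<^bsub>\<M>\<^esub> x"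
    proof (rule additive_hom_tensor_eqI[OF abelian_group_tensor _ _ _ x])
      show "(\<lambda>x. r \<odot>\<^bsub>\<M>\<^esub> x \<oplus>\<^bsub>\<T>\<^esub> s \<odot>\<^bsub>\<M>\<^esub> x) \<in> additive_hom \<T> \<T>"
        by (rule additive_homI) (use r s closed in \<open>simp_all add: additive_homD(2)[OF hom] T.a_ac\<close>)
      show "(\<lambda>x. (r \<oplus> s) \<odot>\<^bsub>\<M>\<^esub> x) \<in> additive_hom \<T> \<T>"
        by (rule hom[OF R.add.m_closed[OF r s]])
    qed (use r s in \<open>simp_all add: smult_pure smult_closed smult_l_distr pure_add_left\<close>)
    show "(r \<otimes> s) \<odot>\<^bsub>\<M>\<^esub> x = r \<odot>\<^bsub>\<M>\<^esub> (s \<odot>\<^bsub>\<M>\<^esub> x)"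
    proof (rule additive_hom_tensor_eqI[OF abelian_group_tensor _ _ _ x])
      show "(\<lambda>x. r \<odot>\<^bsub>\<M>\<^esub> (s \<odot>\<^bsub>\<M>\<^esub> x)) \<in> additive_hom \<T> \<T>"
        by (rule additive_homI) (use r s closed in \<open>simp_all add: additive_homD(2)[OF hom]\<close>)
      show "(\<lambda>x. (r \<otimes> s) \<odot>\<^bsub>\<M>\<^esub> x) \<in> additive_hom \<T> \<T>"
        by (rule hom[OF R.m_closed[OF r s]])
    qed (use r s in \<open>simp_all add: smult_pure smult_closed smult_assoc\<close>)
  next
    fix x assume x: "x \<in> carrier \<T>"
    show "\<one> \<odot>\<^bsub>\<M>\<^esub> x = x"
    proof (rule additive_hom_tensor_eqI[OF abelian_group_tensor _ _ _ x])
      show "(\<lambda>x. \<one> \<odot>\<^bsub>\<M>\<^esub> x) \<in> additive_hom \<T> \<T>"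
        by (rule hom[OF R.one_closed])
      show "(\<lambda>x. x) \<in> additive_hom \<T> \<T>"
        by (rule additive_homI) simp_all
    qed (simp_all add: smult_pure smult_one)
  qed (use closed in \<open>simp_all add: additive_homD(2)[OF hom]\<close>)
qed

end

lemma transport_module:
  assumes inj: "inj_on h (carrier A)" and A: "left_module R A"
  shows "left_module R (transport_module h A)"
    and "h ` carrier A = carrier (transport_module h A)"
    and "h \<zero>\<^bsub>A\<^esub> = \<zero>\<^bsub>transport_module h A\<^esub>"
    and "\<And>x y. \<lbrakk>x \<in> carrier A; y \<in> carrier A\<rbrakk> \<Longrightarrow> h (x \<oplus>\<^bsub>A\<^esub> y) = h x \<oplus>\<^bsub>transport_module h A\<^esub> h y"
    and "\<And>r x. \<lbrakk>r \<in> carrier R; x \<in> carrier A\<rbrakk> \<Longrightarrow> h (r \<odot>\<^bsub>A\<^esub> x) = r \<odot>\<^bsub>transport_module h A\<^esub> h x"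
proof -
  interpret A: left_module R A by fact
  let ?A = "transport_module h A"
  show im: "h ` carrier A = carrier ?A" and zero: "h \<zero>\<^bsub>A\<^esub> = \<zero>\<^bsub>?A\<^esub>"
    by (simp_all add: transport_module_def Let_def)
  show add: "h (x \<oplus>\<^bsub>A\<^esub> y) = h x \<oplus>\<^bsub>?A\<^esub> h y" if "x \<in> carrier A" "y \<in> carrier A" for x y
    using that by (simp add: transport_module_def Let_def the_inv_into_f_f[OF inj])
  show sm: "h (r \<odot>\<^bsub>A\<^esub> x) = r \<odot>\<^bsub>?A\<^esub> h x" if "r \<in> carrier R" "x \<in> carrier A" for r x
    using that by (simp add: transport_module_def Let_def the_inv_into_f_f[OF inj])
  have ex: "\<exists>a\<in>carrier A. x = h a" if "x \<in> carrier ?A" for x using that im by blast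
  have cl: "h a \<in> carrier ?A" if "a \<in> carrier A" for a using that im by blast
  have "abelian_group ?A"
  proof (rule abelian_groupI)
    fix x y z assume "x \<in> carrier ?A" "y \<in> carrier ?A" "z \<in> carrier ?A"
    then obtain a b c where "x = h a" "y = h b" "z = h c" "a \<in> carrier A" "b \<in> carrier A" "c \<in> carrier A"
      using ex by meson
    then show "x \<oplus>\<^bsub>?A\<^esub> y \<oplus>\<^bsub>?A\<^esub> z = x \<oplus>\<^bsub>?A\<^esub> (y \<oplus>\<^bsub>?A\<^esub> z)"
      by (simp flip: add add: A.M.a_assoc)
  next
    fix x y assume "x \<in> carrier ?A" "y \<in> carrier ?A"
    then obtain a b where "x = h a" "y = h b" "a \<in> carrier A" "b \<in> carrier A"
      using ex by meson
    then show "x \<oplus>\<^bsub>?A\<^esub> y = y \<oplus>\<^bsub>?A\<^esub> x" "x \<oplus>\<^bsub>?A\<^esub> y \<in> carrier ?A"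
      using cl by (simp_all flip: add add: A.M.a_comm)
  next
    fix x assume "x \<in> carrier ?A"
    then obtain a where a: "x = h a" "a \<in> carrier A" using ex by meson
    then show "\<zero>\<^bsub>?A\<^esub> \<oplus>\<^bsub>?A\<^esub> x = x" by (simp flip: add zero)
    show "\<exists>y\<in>carrier ?A. y \<oplus>\<^bsub>?A\<^esub> x = \<zero>\<^bsub>?A\<^esub>"
      using a by (intro bexI[of _ "h (\<ominus>\<^bsub>A\<^esub> a)"]) (simp_all flip: add zero add: cl A.M.l_neg)
  qed (simp add: cl flip: zero)
  then show "left_module R ?A"
  proof (intro left_module.intro left_module_axioms.intro A.R.ring_axioms)
    fix r s x assume *: "r \<in> carrier R" "s \<in> carrier R" "x \<in> carrier ?A"
    then obtain a where "x = h a" "a \<in> carrier A" using ex by meson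
    with * show "(r \<oplus>\<^bsub>R\<^esub> s) \<odot>\<^bsub>?A\<^esub> x = r \<odot>\<^bsub>?A\<^esub> x \<oplus>\<^bsub>?A\<^esub> s \<odot>\<^bsub>?A\<^esub> x"
      "(r \<otimes>\<^bsub>R\<^esub> s) \<odot>\<^bsub>?A\<^esub> x = r \<odot>\<^bsub>?A\<^esub> (s \<odot>\<^bsub>?A\<^esub> x)"
      by (simp_all flip: add sm add: A.smult_closed A.smult_l_distr A.smult_assoc)
  next
    fix r x y assume *: "r \<in> carrier R" "x \<in> carrier ?A" "y \<in> carrier ?A"
    then obtain a b where "x = h a" "y = h b" "a \<in> carrier A" "b \<in> carrier A" using ex by meson
    with * show "r \<odot>\<^bsub>?A\<^esub> (x \<oplus>\<^bsub>?A\<^esub> y) = r \<odot>\<^bsub>?A\<^esub> x \<oplus>\<^bsub>?A\<^esub> r \<odot>\<^bsub>?A\<^esub> y"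
      by (simp_all flip: add sm add: A.smult_closed A.smult_r_distr)
  next
    fix r x assume *: "r \<in> carrier R" "x \<in> carrier ?A"
    then obtain a where "x = h a" "a \<in> carrier A" using ex by meson
    with * show "r \<odot>\<^bsub>?A\<^esub> x \<in> carrier ?A" by (simp flip: sm add: cl A.smult_closed)
  next
    fix x assume "x \<in> carrier ?A"
    then obtain a where "x = h a" "a \<in> carrier A" using ex by meson
    then show "\<one>\<^bsub>R\<^esub> \<odot>\<^bsub>?A\<^esub> x = x" by (simp flip: sm add: A.smult_one)
  qed
qed

section \<open>Tensor powers and their multiplication\<close>

lemma additive_hom_finsum:
  assumes "abelian_group X" "abelian_group Y" "f \<in> additive_hom X Y"
    and "finite J" "\<And>j. j \<in> J \<Longrightarrow> x j \<in> carrier X"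
  shows "f (\<Oplus>\<^bsub>X\<^esub>j\<in>J. x j) = (\<Oplus>\<^bsub>Y\<^esub>j\<in>J. f (x j))"
proof -
  interpret X: abelian_group X by fact
  interpret Y: abelian_group Y by fact
  show ?thesis
    using assms(4,5)
  proof (induction J rule: finite_induct)
    case empty
    then show ?case using additive_hom_zero[OF assms(3,1,2)] by simp
  next
    case (insert i J)
    have "f (\<Oplus>\<^bsub>X\<^esub>j\<in>insert i J. x j) = f (x i \<oplus>\<^bsub>X\<^esub> (\<Oplus>\<^bsub>X\<^esub>j\<in>J. x j))"
      using insert by (subst X.finsum_insert) auto
    also have "\<dots> = f (x i) \<oplus>\<^bsub>Y\<^esub> (\<Oplus>\<^bsub>Y\<^esub>j\<in>J. f (x j))"
      using insert by (subst additive_homD(2)[OF assms(3)]) (auto intro!: X.finsum_closed)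
    also have "\<dots> = (\<Oplus>\<^bsub>Y\<^esub>j\<in>insert i J. f (x j))"
      using insert additive_homD(1)[OF assms(3)] by (subst Y.finsum_insert) auto
    finally show ?case .
  qed
qed

lemma (in abelian_monoid) finsum_add_cong:
  assumes "\<And>i. i \<in> I \<Longrightarrow> g i \<in> carrier G" "\<And>i. i \<in> I \<Longrightarrow> h i \<in> carrier G"
    and "\<And>i. i \<in> I \<Longrightarrow> f i = g i \<oplus> h i"
  shows "(\<Oplus>i\<in>I. f i) = (\<Oplus>i\<in>I. g i) \<oplus> (\<Oplus>i\<in>I. h i)"
proof -
  have "(\<Oplus>i\<in>I. f i) = (\<Oplus>i\<in>I. g i \<oplus> h i)"
    using assms by (intro add.finprod_cong') auto
  then show ?thesis using assms by (simp add: finsum_addf)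
qed

text \<open>
  Summation over the triangle \<open>j + l \<le> k\<close> by diagonals and by rows.
\<close>

lemma (in abelian_monoid) finsum_triangle:
  fixes k :: nat
  assumes "\<And>j l. j + l \<le> k \<Longrightarrow> g j l \<in> carrier G"
  shows "(\<Oplus>i\<in>{..k}. \<Oplus>j\<in>{..i}. g j (i - j)) = (\<Oplus>j\<in>{..k}. \<Oplus>l\<in>{..k - j}. g j l)"
  using assms
proof (induction k)
  case 0
  then show ?case by simp
next
  case (Suc k)
  note g = Suc.prems
  have c: "(\<Oplus>l\<in>{..k - j}. g j l) \<in> carrier G" if "j \<le> k" for j
    using that by (intro finsum_closed) (auto intro!: g)
  have "(\<Oplus>j\<in>{..Suc k}. \<Oplus>l\<in>{..Suc k - j}. g j l)
      = (\<Oplus>l\<in>{..0}. g (Suc k) l) \<oplus> (\<Oplus>j\<in>{..k}. \<Oplus>l\<in>{..Suc k - j}. g j l)"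
    by (subst finsum_Suc) (auto intro!: finsum_closed g)
  also have "(\<Oplus>j\<in>{..k}. \<Oplus>l\<in>{..Suc k - j}. g j l)
      = (\<Oplus>j\<in>{..k}. g j (Suc k - j) \<oplus> (\<Oplus>l\<in>{..k - j}. g j l))"
  proof (intro add.finprod_cong' refl)
    fix j assume "j \<in> {..k}"
    then have "{..Suc k - j} = {..Suc (k - j)}" "Suc k - j = Suc (k - j)" by auto
    then show "(\<Oplus>l\<in>{..Suc k - j}. g j l) = g j (Suc k - j) \<oplus> (\<Oplus>l\<in>{..k - j}. g j l)"
      using \<open>j \<in> {..k}\<close> by (simp only:, subst finsum_Suc) (auto intro!: g)
  qed (use c in \<open>auto intro!: g a_closed\<close>)
  also have "\<dots> = (\<Oplus>j\<in>{..k}. g j (Suc k - j)) \<oplus> (\<Oplus>j\<in>{..k}. \<Oplus>l\<in>{..k - j}. g j l)"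
    using c by (intro finsum_addf) (auto intro!: g)
  also have "(\<Oplus>j\<in>{..k}. \<Oplus>l\<in>{..k - j}. g j l) = (\<Oplus>i\<in>{..k}. \<Oplus>j\<in>{..i}. g j (i - j))"
    by (rule Suc.IH[symmetric]) (simp add: g)
  also have "(\<Oplus>l\<in>{..0}. g (Suc k) l) \<oplus> ((\<Oplus>j\<in>{..k}. g j (Suc k - j)) \<oplus> (\<Oplus>i\<in>{..k}. \<Oplus>j\<in>{..i}. g j (i - j)))
    = ((g (Suc k) (Suc k - Suc k)) \<oplus> (\<Oplus>j\<in>{..k}. g j (Suc k - j))) \<oplus> (\<Oplus>i\<in>{..k}. \<Oplus>j\<in>{..i}. g j (i - j))"
    using g[of "Suc k" 0] by (subst a_assoc) (auto intro!: g finsum_closed simp: finsum_insert)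
  also have "g (Suc k) (Suc k - Suc k) \<oplus> (\<Oplus>j\<in>{..k}. g j (Suc k - j)) = (\<Oplus>j\<in>{..Suc k}. g j (Suc k - j))"
    by (rule finsum_Suc[symmetric]) (auto intro!: g)
  also have "\<dots> \<oplus> (\<Oplus>i\<in>{..k}. \<Oplus>j\<in>{..i}. g j (i - j)) = (\<Oplus>i\<in>{..Suc k}. \<Oplus>j\<in>{..i}. g j (i - j))"
    by (rule finsum_Suc[symmetric]) (auto intro!: g finsum_closed)
  finally show ?case by simp
qed

context bimodule
begin

abbreviation "P \<equiv> tensor_power R M"

text \<open>
  The pure tensor \<open>a \<otimes> z\<close> in \<open>M\<^sup>i\<^sup>+\<^sup>1\<close> for \<open>a \<in> M\<close> and \<open>z \<in> M\<^sup>i\<close>.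
\<close>

definition tens :: "nat \<Rightarrow> 'm \<Rightarrow> ('r, 'm) tensor_term \<Rightarrow> ('r, 'm) tensor_term" where
  "tens i a z = tensor_code (pure_tensor R (op_module M) (P i) a z)"

text \<open>
  The additive map on \<open>M\<^sup>i\<^sup>+\<^sup>1\<close> that a biadditive balanced map \<open>\<phi>\<close> on \<open>M \<times> M\<^sup>i\<close> induces.
\<close>

definition power_lift where
  "power_lift i C \<phi> x =
    tensor_lift C \<phi> (the_inv_into (carrier (tensor_module R M (P i))) tensor_code x)"

lemma bimodule_tensorI: "left_module R B \<Longrightarrow> bimodule_tensor R M B"
  by (intro bimodule_tensor.intro bimodule_axioms)

lemma inj_Scalar: "inj_on Scalar A"
  by (auto simp: inj_on_def)

lemma left_module_power: "left_module R (P i)"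
proof (induction i)
  case 0
  then show ?case using transport_module(1)[OF inj_Scalar left_module_regular[OF R.ring_axioms]] by simp
next
  case (Suc i)
  interpret T: bimodule_tensor R M "P i" using Suc by (rule bimodule_tensorI)
  show ?case
    using transport_module(1)[OF inj_on_tensor_code[OF bimodule_axioms Suc] T.left_module_tensor] by simp
qed

lemma abelian_group_power: "abelian_group (P i)"
  using left_module_power by (rule left_module.axioms(2))

lemma bimodule_tensor_power: "bimodule_tensor R M (P i)"
  by (rule bimodule_tensorI[OF left_module_power])

lemma power_zero:
  "carrier (P 0) = Scalar ` carrier R"
  "\<zero>\<^bsub>P 0\<^esub> = Scalar \<zero>"
  "\<lbrakk>r \<in> carrier R; s \<in> carrier R\<rbrakk> \<Longrightarrow> Scalar r \<oplus>\<^bsub>P 0\<^esub> Scalar s = Scalar (r \<oplus> s)"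
  "\<lbrakk>r \<in> carrier R; s \<in> carrier R\<rbrakk> \<Longrightarrow> r \<odot>\<^bsub>P 0\<^esub> Scalar s = Scalar (r \<otimes> s)"
  by (simp_all add: regular_module_simps
      flip: transport_module(2-5)[OF inj_Scalar left_module_regular[OF R.ring_axioms]])

lemmas tensor_code_hom =
  transport_module(2-5)[OF inj_on_tensor_code[OF bimodule_axioms left_module_power]
    bimodule_tensor.left_module_tensor[OF bimodule_tensor_power], folded tensor_power.simps(2)]

lemma tens_closed:
  assumes "a \<in> carrier M" "z \<in> carrier (P i)"
  shows "tens i a z \<in> carrier (P (Suc i))"
proof -
  interpret T: bimodule_tensor R M "P i" by (rule bimodule_tensor_power)
  show ?thesis
    using assms T.pure_closed[of a z] tensor_code_hom(1)[of i] T.tensor_module_simps unfolding tens_def by blast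
qed

lemma tens_add_left:
  assumes "a \<in> carrier M" "b \<in> carrier M" "z \<in> carrier (P i)"
  shows "tens i (a \<oplus>\<^bsub>M\<^esub> b) z = tens i a z \<oplus>\<^bsub>P (Suc i)\<^esub> tens i b z"
proof -
  interpret T: bimodule_tensor R M "P i" by (rule bimodule_tensor_power)
  show ?thesis
    using assms T.pure_add_left[of a b z] T.pure_closed[of _ z] tensor_code_hom(3)[of "T.pure a z" i "T.pure b z"]
    by (simp add: tens_def T.tensor_module_simps del: tensor_power.simps)
qed

lemma tens_add_right:
  assumes "a \<in> carrier M" "y \<in> carrier (P i)" "z \<in> carrier (P i)"
  shows "tens i a (y \<oplus>\<^bsub>P i\<^esub> z) = tens i a y \<oplus>\<^bsub>P (Suc i)\<^esub> tens i a z"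
proof -
  interpret T: bimodule_tensor R M "P i" by (rule bimodule_tensor_power)
  show ?thesis
    using assms T.pure_add_right[of a y z] T.pure_closed[of a] tensor_code_hom(3)[of "T.pure a y" i "T.pure a z"]
    by (simp add: tens_def T.tensor_module_simps del: tensor_power.simps)
qed

lemma tens_balanced:
  "\<lbrakk>a \<in> carrier M; z \<in> carrier (P i); r \<in> carrier R\<rbrakk>
    \<Longrightarrow> tens i (rsmult M a r) z = tens i a (r \<odot>\<^bsub>P i\<^esub> z)"
  using bimodule_tensor.pure_balanced[OF bimodule_tensor_power] by (simp add: tens_def)

lemma tens_smult:
  assumes "a \<in> carrier M" "z \<in> carrier (P i)" "r \<in> carrier R"
  shows "r \<odot>\<^bsub>P (Suc i)\<^esub> tens i a z = tens i (r \<odot>\<^bsub>M\<^esub> a) z"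
proof -
  interpret T: bimodule_tensor R M "P i" by (rule bimodule_tensor_power)
  show ?thesis
    using assms T.tensor_smult(2)[of r a z] T.pure_closed[of a z] tensor_code_hom(4)[of r "T.pure a z" i]
    by (simp add: tens_def T.tensor_module_simps del: tensor_power.simps)
qed

lemma power_Suc_induct [consumes 1, case_names zero tens add]:
  assumes "x \<in> carrier (P (Suc i))"
    and zero: "Q \<zero>\<^bsub>P (Suc i)\<^esub>"
    and tens: "\<And>a z. \<lbrakk>a \<in> carrier M; z \<in> carrier (P i)\<rbrakk> \<Longrightarrow> Q (tens i a z)"
    and add: "\<And>x y. \<lbrakk>x \<in> carrier (P (Suc i)); y \<in> carrier (P (Suc i)); Q x; Q y\<rbrakk>
        \<Longrightarrow> Q (x \<oplus>\<^bsub>P (Suc i)\<^esub> y)"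
  shows "Q x"
proof -
  interpret T: bimodule_tensor R M "P i" by (rule bimodule_tensor_power)
  obtain c where c: "c \<in> carrier T.\<T>" "x = tensor_code c"
    using assms(1) unfolding tensor_code_hom(1)[symmetric] T.tensor_module_simps by blast
  have cl: "tensor_code c \<in> carrier (P (Suc i))" if "c \<in> carrier T.\<T>" for c
    using that tensor_code_hom(1)[of i] unfolding T.tensor_module_simps by blast
  have "Q (tensor_code c)"
    using c(1)
  proof (induction rule: T.tensor_induct)
    case zero
    then show ?case using assms(2) tensor_code_hom(2)[of i] by (simp only: T.tensor_module_simps)
  next
    case (pure a b)
    then show ?case using tens by (simp add: tens_def)
  next
    case (add x y)
    then show ?case
      using assms(4)[OF cl cl] tensor_code_hom(3)[of x i y] by (simp only: T.tensor_module_simps)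
  qed
  then show ?thesis using c(2) by simp
qed

lemma power_lift_hom:
  assumes C: "abelian_group C"
    and bal: "balanced_map C (P i) \<phi>"
  shows "power_lift i C \<phi> \<in> additive_hom (P (Suc i)) C"
    and "\<And>a z. \<lbrakk>a \<in> carrier M; z \<in> carrier (P i)\<rbrakk> \<Longrightarrow> power_lift i C \<phi> (tens i a z) = \<phi> a z"
proof -
  interpret T: bimodule_tensor R M "P i" by (rule bimodule_tensor_power)
  interpret TG: abelian_group T.\<T> by (rule T.abelian_group_tensor)
  have inj: "inj_on tensor_code (carrier T.\<M>)"
    by (rule inj_on_tensor_code[OF bimodule_axioms left_module_power])
  have lift: "power_lift i C \<phi> (tensor_code c) = tensor_lift C \<phi> c" if "c \<in> carrier T.\<T>" for c
    using that the_inv_into_f_f[OF inj, of c] by (simp add: power_lift_def T.tensor_module_simps)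
  have h: "tensor_lift C \<phi> \<in> additive_hom T.\<T> C"
    and p: "\<lbrakk>a \<in> carrier M; z \<in> carrier (P i)\<rbrakk> \<Longrightarrow> tensor_lift C \<phi> (T.pure a z) = \<phi> a z" for a z
    using T.tensor_lift_hom[OF assms] by blast+
  show "power_lift i C \<phi> (tens i a z) = \<phi> a z" if "a \<in> carrier M" "z \<in> carrier (P i)" for a z
    using that by (simp add: tens_def lift p T.pure_closed)
  show "power_lift i C \<phi> \<in> additive_hom (P (Suc i)) C"
  proof (rule additive_homI)
    fix x y assume "x \<in> carrier (P (Suc i))" "y \<in> carrier (P (Suc i))"
    then obtain c d where c: "c \<in> carrier T.\<T>" "x = tensor_code c" and d: "d \<in> carrier T.\<T>" "y = tensor_code d"
      unfolding tensor_code_hom(1)[symmetric] T.tensor_module_simps by blast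
    then have "x \<oplus>\<^bsub>P (Suc i)\<^esub> y = tensor_code (c \<oplus>\<^bsub>T.\<T>\<^esub> d)"
      using tensor_code_hom(3)[of c i d] by (simp only: T.tensor_module_simps)
    then show "power_lift i C \<phi> (x \<oplus>\<^bsub>P (Suc i)\<^esub> y) = power_lift i C \<phi> x \<oplus>\<^bsub>C\<^esub> power_lift i C \<phi> y"
      using c d by (simp add: lift additive_homD(2)[OF h])
  next
    fix x assume "x \<in> carrier (P (Suc i))"
    then obtain c where c: "c \<in> carrier T.\<T>" "x = tensor_code c"
      unfolding tensor_code_hom(1)[symmetric] T.tensor_module_simps by blast
    then show "power_lift i C \<phi> x \<in> carrier C" by (simp add: lift additive_homD(1)[OF h])
  qed
qed

lemma power_relation:
  assumes C: "abelian_group C" and W: "subgroup W (add_monoid C)"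
    and bal: "balanced_mod C W (P i) \<phi>"
    and J: "finite J" "\<And>j. j \<in> J \<Longrightarrow> a j \<in> carrier M" "\<And>j. j \<in> J \<Longrightarrow> z j \<in> carrier (P i)"
    and sum: "(\<Oplus>\<^bsub>P (Suc i)\<^esub>j\<in>J. tens i (a j) (z j)) = \<zero>\<^bsub>P (Suc i)\<^esub>"
  shows "(\<Oplus>\<^bsub>C\<^esub>j\<in>J. \<phi> (a j) (z j)) \<in> W"
proof -
  interpret T: bimodule_tensor R M "P i" by (rule bimodule_tensor_power)
  interpret TG: abelian_group T.\<T> by (rule T.abelian_group_tensor)
  have code: "tensor_code \<in> additive_hom T.\<T> (P (Suc i))"
  proof (rule additive_homI)
    show "tensor_code x \<in> carrier (P (Suc i))" if "x \<in> carrier T.\<T>" for x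
      using that tensor_code_hom(1)[of i] unfolding T.tensor_module_simps by blast
    show "tensor_code (x \<oplus>\<^bsub>T.\<T>\<^esub> y) = tensor_code x \<oplus>\<^bsub>P (Suc i)\<^esub> tensor_code y"
      if "x \<in> carrier T.\<T>" "y \<in> carrier T.\<T>" for x y
      using that tensor_code_hom(3)[of x i y] by (simp only: T.tensor_module_simps)
  qed
  have pc: "T.pure (a j) (z j) \<in> carrier T.\<T>" if "j \<in> J" for j using J that by (auto intro: T.pure_closed)
  have "tensor_code (\<Oplus>\<^bsub>T.\<T>\<^esub>j\<in>J. T.pure (a j) (z j)) = \<zero>\<^bsub>P (Suc i)\<^esub>"
    using additive_hom_finsum[OF T.abelian_group_tensor abelian_group_power code J(1) pc] sum
    by (simp add: tens_def del: tensor_power.simps)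
  also have "\<dots> = tensor_code \<zero>\<^bsub>T.\<T>\<^esub>"
    using tensor_code_hom(2)[of i] by (simp only: T.tensor_module_simps)
  finally have "(\<Oplus>\<^bsub>T.\<T>\<^esub>j\<in>J. T.pure (a j) (z j)) = \<zero>\<^bsub>T.\<T>\<^esub>"
    using inj_on_tensor_code[OF bimodule_axioms left_module_power, of i] pc
    by (elim inj_onD) (auto simp: T.tensor_module_simps intro!: TG.finsum_closed)
  with C W bal J show ?thesis by (rule T.tensor_relation)
qed

lemma additive_hom_power_eqI:
  assumes "abelian_group Y" "f \<in> additive_hom (P (Suc i)) Y" "g \<in> additive_hom (P (Suc i)) Y"
    and "\<And>a z. \<lbrakk>a \<in> carrier M; z \<in> carrier (P i)\<rbrakk> \<Longrightarrow> f (tens i a z) = g (tens i a z)"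
    and "x \<in> carrier (P (Suc i))"
  shows "f x = g x"
  using assms(5)
  by (induction rule: power_Suc_induct)
    (simp_all add: additive_hom_zero[OF assms(2) abelian_group_power assms(1)]
      additive_hom_zero[OF assms(3) abelian_group_power assms(1)] assms(4)
      additive_homD(2)[OF assms(2)] additive_homD(2)[OF assms(3)] del: tensor_power.simps)

declare tensor_power.simps [simp del] tensor_mult.simps [simp del]

abbreviation "\<mu> \<equiv> tensor_mult R M"

lemma mult_Scalar: "\<mu> 0 m (Scalar r) y = r \<odot>\<^bsub>P m\<^esub> y"
  by (simp add: tensor_mult.simps)

lemma mult_Suc: "\<mu> (Suc n) m x y = power_lift n (P (Suc (n + m))) (\<lambda>a z. tens (n + m) a (\<mu> n m z y)) x"
  by (simp add: tensor_mult.simps power_lift_def tens_def)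

lemma power_smult_closed: "\<lbrakk>r \<in> carrier R; x \<in> carrier (P i)\<rbrakk> \<Longrightarrow> r \<odot>\<^bsub>P i\<^esub> x \<in> carrier (P i)"
  using left_module.smult_closed[OF left_module_power] .

lemma power_smult_hom: "r \<in> carrier R \<Longrightarrow> (\<lambda>x. r \<odot>\<^bsub>P i\<^esub> x) \<in> additive_hom (P i) (P i)"
  using left_module.smult_closed[OF left_module_power] left_module.smult_r_distr[OF left_module_power]
  by (intro additive_homI)

text \<open>
  Linearity in the left factor and the recursion for pure tensors are proved together: the map
  \<open>(a, z) \<mapsto> a \<otimes> (z \<cdot> y)\<close> is balanced because \<open>z \<mapsto> z \<cdot> y\<close> is \<open>R\<close>-linear, which is the induction
  hypothesis.
\<close>

lemma mult_left_hom:
  assumes y: "y \<in> carrier (P m)"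
  shows "(\<lambda>x. \<mu> n m x y) \<in> left_module_hom R (P n) (P (n + m))"
    and "\<And>a z. \<lbrakk>a \<in> carrier M; z \<in> carrier (P n)\<rbrakk> \<Longrightarrow> \<mu> (Suc n) m (tens n a z) y = tens (n + m) a (\<mu> n m z y)"
proof -
  interpret Pm: left_module R "P k" for k by (rule left_module_power)
  have step: "(\<lambda>x. \<mu> (Suc n) m x y) \<in> additive_hom (P (Suc n)) (P (Suc (n + m)))
    \<and> (\<forall>a\<in>carrier M. \<forall>z\<in>carrier (P n). \<mu> (Suc n) m (tens n a z) y = tens (n + m) a (\<mu> n m z y))"
    if IH: "(\<lambda>x. \<mu> n m x y) \<in> left_module_hom R (P n) (P (n + m))" for n
  proof -
    let ?\<phi> = "\<lambda>a z. tens (n + m) a (\<mu> n m z y)"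
    note IHD = left_module_homD[OF IH]
    have c: "\<mu> n m z y \<in> carrier (P (n + m))" if "z \<in> carrier (P n)" for z
      using additive_homD(1)[OF IHD(1)] that .
    have "balanced_map (P (Suc (n + m))) (P n) ?\<phi>"
      unfolding balanced_map_def using c additive_homD(2)[OF IHD(1)] IHD(2)
      by (simp add: tens_closed tens_add_left tens_add_right tens_balanced)
    then show ?thesis
      unfolding mult_Suc using power_lift_hom[of "P (Suc (n + m))" n ?\<phi>] abelian_group_power by simp
  qed
  have hom: "(\<lambda>x. \<mu> n m x y) \<in> left_module_hom R (P n) (P (n + m))" for n
  proof (induction n)
    case 0
    show ?case
      using y by (auto simp: left_module_hom_def power_zero mult_Scalar power_smult_closed
        Pm.smult_l_distr Pm.smult_assoc)
  next
    case (Suc n)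
    note s = step[OF Suc, THEN conjunct1] and t = step[OF Suc, THEN conjunct2, rule_format]
    have c: "\<mu> n m z y \<in> carrier (P (n + m))" if "z \<in> carrier (P n)" for z
      using additive_homD(1)[OF left_module_homD(1)[OF Suc]] that .
    have "\<mu> (Suc n) m (r \<odot>\<^bsub>P (Suc n)\<^esub> x) y = r \<odot>\<^bsub>P (Suc (n + m))\<^esub> \<mu> (Suc n) m x y"
      if r: "r \<in> carrier R" and x: "x \<in> carrier (P (Suc n))" for r x
    proof (rule additive_hom_power_eqI[OF abelian_group_power _ _ _ x])
      show "(\<lambda>x. \<mu> (Suc n) m (r \<odot>\<^bsub>P (Suc n)\<^esub> x) y) \<in> additive_hom (P (Suc n)) (P (Suc (n + m)))"
        using r by (intro additive_homI)
          (simp_all add: additive_homD[OF s] power_smult_closed additive_homD(2)[OF power_smult_hom])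
      show "(\<lambda>x. r \<odot>\<^bsub>P (Suc (n + m))\<^esub> \<mu> (Suc n) m x y) \<in> additive_hom (P (Suc n)) (P (Suc (n + m)))"
        using r by (intro additive_homI)
          (simp_all add: additive_homD[OF s] power_smult_closed additive_homD(2)[OF power_smult_hom])
      fix a z assume "a \<in> carrier M" "z \<in> carrier (P n)"
      then show "\<mu> (Suc n) m (r \<odot>\<^bsub>P (Suc n)\<^esub> tens n a z) y = r \<odot>\<^bsub>P (Suc (n + m))\<^esub> \<mu> (Suc n) m (tens n a z) y"
        using r c by (simp add: tens_smult t smult_closed)
    qed
    with s show ?case by (intro left_module_homI) simp_all
  qed
  then show "(\<lambda>x. \<mu> n m x y) \<in> left_module_hom R (P n) (P (n + m))" .
  show "\<mu> (Suc n) m (tens n a z) y = tens (n + m) a (\<mu> n m z y)" if "a \<in> carrier M" "z \<in> carrier (P n)" for a z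
    using step[OF hom] that by blast
qed

lemma mult_closed: "\<lbrakk>x \<in> carrier (P n); y \<in> carrier (P m)\<rbrakk> \<Longrightarrow> \<mu> n m x y \<in> carrier (P (n + m))"
  using additive_homD(1)[OF left_module_homD(1)[OF mult_left_hom(1)]] .

lemma mult_add_left: "\<lbrakk>x \<in> carrier (P n); x' \<in> carrier (P n); y \<in> carrier (P m)\<rbrakk>
    \<Longrightarrow> \<mu> n m (x \<oplus>\<^bsub>P n\<^esub> x') y = \<mu> n m x y \<oplus>\<^bsub>P (n + m)\<^esub> \<mu> n m x' y"
  using additive_homD(2)[OF left_module_homD(1)[OF mult_left_hom(1)]] .

lemma mult_smult: "\<lbrakk>r \<in> carrier R; x \<in> carrier (P n); y \<in> carrier (P m)\<rbrakk>
    \<Longrightarrow> \<mu> n m (r \<odot>\<^bsub>P n\<^esub> x) y = r \<odot>\<^bsub>P (n + m)\<^esub> \<mu> n m x y"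
  using left_module_homD(2)[OF mult_left_hom(1)] .

lemma mult_add_right:
  assumes "x \<in> carrier (P n)" "y \<in> carrier (P m)" "y' \<in> carrier (P m)"
  shows "\<mu> n m x (y \<oplus>\<^bsub>P m\<^esub> y') = \<mu> n m x y \<oplus>\<^bsub>P (n + m)\<^esub> \<mu> n m x y'"
  using assms(1)
proof (induction n arbitrary: x)
  case 0
  then show ?case using assms(2,3) left_module.smult_r_distr[OF left_module_power]
    by (auto simp: power_zero mult_Scalar)
next
  case (Suc n)
  interpret A: abelian_group "P (Suc (n + m))" by (rule abelian_group_power)
  have yy: "y \<oplus>\<^bsub>P m\<^esub> y' \<in> carrier (P m)" using assms abelian_groupE(1)[OF abelian_group_power] by blast
  have hom: "(\<lambda>x. \<mu> (Suc n) m x u) \<in> additive_hom (P (Suc n)) (P (Suc (n + m)))" if "u \<in> carrier (P m)" for u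
    using left_module_homD(1)[OF mult_left_hom(1)[OF that, of "Suc n"]] by simp
  have "\<mu> (Suc n) m x (y \<oplus>\<^bsub>P m\<^esub> y') = \<mu> (Suc n) m x y \<oplus>\<^bsub>P (Suc (n + m))\<^esub> \<mu> (Suc n) m x y'"
  proof (rule additive_hom_power_eqI[OF abelian_group_power _ _ _ Suc.prems])
    show "(\<lambda>x. \<mu> (Suc n) m x (y \<oplus>\<^bsub>P m\<^esub> y')) \<in> additive_hom (P (Suc n)) (P (Suc (n + m)))"
      by (rule hom[OF yy])
    show "(\<lambda>x. \<mu> (Suc n) m x y \<oplus>\<^bsub>P (Suc (n + m))\<^esub> \<mu> (Suc n) m x y') \<in> additive_hom (P (Suc n)) (P (Suc (n + m)))"
      using additive_homD[OF hom[OF assms(2)]] additive_homD[OF hom[OF assms(3)]]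
      by (intro additive_homI) (simp_all add: A.a_ac)
    fix a z assume "a \<in> carrier M" "z \<in> carrier (P n)"
    then show "\<mu> (Suc n) m (tens n a z) (y \<oplus>\<^bsub>P m\<^esub> y')
        = \<mu> (Suc n) m (tens n a z) y \<oplus>\<^bsub>P (Suc (n + m))\<^esub> \<mu> (Suc n) m (tens n a z) y'"
      using assms yy Suc.IH by (simp add: mult_left_hom(2) tens_add_right mult_closed)
  qed
  then show ?case by simp
qed

lemma mult_right_hom: "x \<in> carrier (P n) \<Longrightarrow> (\<lambda>y. \<mu> n m x y) \<in> additive_hom (P m) (P (n + m))"
  by (intro additive_homI) (simp_all add: mult_closed mult_add_right)

lemma mult_assoc:
  assumes "x \<in> carrier (P n)" "y \<in> carrier (P m)" "z \<in> carrier (P k)"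
  shows "\<mu> (n + m) k (\<mu> n m x y) z = \<mu> n (m + k) x (\<mu> m k y z)"
  using assms(1)
proof (induction n arbitrary: x)
  case 0
  then show ?case using assms(2,3) by (auto simp: power_zero mult_Scalar mult_smult)
next
  case (Suc n)
  have yz: "\<mu> m k y z \<in> carrier (P (m + k))" using assms by (simp add: mult_closed)
  have hom: "(\<lambda>x. \<mu> (Suc n) l x u) \<in> additive_hom (P (Suc n)) (P (Suc (n + l)))" if "u \<in> carrier (P l)" for u l
    using left_module_homD(1)[OF mult_left_hom(1)[OF that, of "Suc n"]] by simp
  have "\<mu> (Suc (n + m)) k (\<mu> (Suc n) m x y) z = \<mu> (Suc n) (m + k) x (\<mu> m k y z)"
  proof (rule additive_hom_power_eqI[OF abelian_group_power _ _ _ Suc.prems])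
    have h2: "(\<lambda>x. \<mu> (Suc (n + m)) k x z) \<in> additive_hom (P (Suc (n + m))) (P (Suc (n + (m + k))))"
      using left_module_homD(1)[OF mult_left_hom(1)[OF assms(3), of "Suc (n + m)"]] by (simp add: add.assoc)
    show "(\<lambda>x. \<mu> (Suc (n + m)) k (\<mu> (Suc n) m x y) z) \<in> additive_hom (P (Suc n)) (P (Suc (n + (m + k))))"
      by (intro additive_homI) (simp_all add: additive_homD[OF h2] additive_homD[OF hom[OF assms(2)]])
    show "(\<lambda>x. \<mu> (Suc n) (m + k) x (\<mu> m k y z)) \<in> additive_hom (P (Suc n)) (P (Suc (n + (m + k))))"
      by (rule hom[OF yz])
    fix a w assume "a \<in> carrier M" "w \<in> carrier (P n)"
    then show "\<mu> (Suc (n + m)) k (\<mu> (Suc n) m (tens n a w) y) z = \<mu> (Suc n) (m + k) (tens n a w) (\<mu> m k y z)"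
      using assms yz Suc.IH by (simp add: mult_left_hom(2) mult_closed add.assoc)
  qed
  then show ?case by simp
qed

lemma mult_one_right:
  assumes "x \<in> carrier (P n)"
  shows "\<mu> n 0 x (Scalar \<one>) = x"
  using assms
proof (induction n arbitrary: x)
  case 0
  then show ?case by (auto simp: power_zero mult_Scalar)
next
  case (Suc n)
  have 1: "Scalar \<one> \<in> carrier (P 0)" by (simp add: power_zero)
  show ?case
  proof (rule additive_hom_power_eqI[OF abelian_group_power _ _ _ Suc.prems])
    show "(\<lambda>x. \<mu> (Suc n) 0 x (Scalar \<one>)) \<in> additive_hom (P (Suc n)) (P (Suc n))"
      using left_module_homD(1)[OF mult_left_hom(1)[OF 1, of "Suc n"]] by simp
    show "(\<lambda>x. x) \<in> additive_hom (P (Suc n)) (P (Suc n))" by (rule additive_homI) simp_all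
  qed (simp add: mult_left_hom(2)[OF 1] Suc.IH)
qed

section \<open>The tensor ring\<close>

text \<open>
  The left \<open>R\<close>-module underlying the tensor ring.
\<close>

abbreviation "sum_module N \<equiv> product_module {..N} P"

lemma left_module_sum: "left_module R (sum_module N)"
  by (rule left_module_product_module[OF R.ring_axioms left_module_power])

lemma abelian_group_sum: "abelian_group (sum_module N)"
  using left_module_sum by (rule left_module.axioms(2))

lemma tensor_ring_simps:
  "carrier (tensor_ring R M N) = carrier (sum_module N)"
  "\<zero>\<^bsub>tensor_ring R M N\<^esub> = \<zero>\<^bsub>sum_module N\<^esub>"
  "u \<oplus>\<^bsub>tensor_ring R M N\<^esub> v = u \<oplus>\<^bsub>sum_module N\<^esub> v"
  "\<one>\<^bsub>tensor_ring R M N\<^esub> = single {..N} P 0 (Scalar \<one>)"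
  by (simp_all add: tensor_ring_def product_module_simps single_def)

lemma tensor_ring_mult:
  "k \<le> N \<Longrightarrow> (u \<otimes>\<^bsub>tensor_ring R M N\<^esub> v) k = (\<Oplus>\<^bsub>P k\<^esub>i\<in>{..k}. \<mu> i (k - i) (u i) (v (k - i)))"
  by (simp add: tensor_ring_def)

lemma sum_component: "\<lbrakk>u \<in> carrier (sum_module N); k \<le> N\<rbrakk> \<Longrightarrow> u k \<in> carrier (P k)"
  by (auto simp: product_module_simps)

lemma mult_diff_closed: "\<lbrakk>x \<in> carrier (P i); y \<in> carrier (P (k - i)); i \<le> k\<rbrakk> \<Longrightarrow> \<mu> i (k - i) x y \<in> carrier (P k)"
  using mult_closed[of x i y "k - i"] by simp

lemma tensor_ring_mult_closed:
  assumes "u \<in> carrier (sum_module N)" "v \<in> carrier (sum_module N)"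
  shows "u \<otimes>\<^bsub>tensor_ring R M N\<^esub> v \<in> carrier (sum_module N)"
proof -
  have "(\<Oplus>\<^bsub>P k\<^esub>i\<in>{..k}. \<mu> i (k - i) (u i) (v (k - i))) \<in> carrier (P k)" if "k \<le> N" for k
    using that assms
    by (intro abelian_monoid.finsum_closed abelian_group.axioms(1)[OF abelian_group_power])
      (auto intro!: mult_diff_closed sum_component[OF assms(1)] sum_component[OF assms(2)])
  then show ?thesis by (simp add: tensor_ring_def product_module_simps)
qed

lemma single_power_closed: "x \<in> carrier (P d) \<Longrightarrow> single {..N} P d x \<in> carrier (sum_module N)"
  using abelian_group_power by (rule single_closed)

lemma mult_zero_left: "y \<in> carrier (P m) \<Longrightarrow> \<mu> n m \<zero>\<^bsub>P n\<^esub> y = \<zero>\<^bsub>P (n + m)\<^esub>"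
  using additive_hom_zero[OF left_module_homD(1)[OF mult_left_hom(1)] abelian_group_power abelian_group_power] .

lemma mult_zero_right: "x \<in> carrier (P n) \<Longrightarrow> \<mu> n m x \<zero>\<^bsub>P m\<^esub> = \<zero>\<^bsub>P (n + m)\<^esub>"
  using additive_hom_zero[OF mult_right_hom abelian_group_power abelian_group_power] .

lemma tensor_ring_mult_Scalar:
  assumes "r \<in> carrier R" "v \<in> carrier (sum_module N)" "k \<le> N"
  shows "(single {..N} P 0 (Scalar r) \<otimes>\<^bsub>tensor_ring R M N\<^esub> v) k = r \<odot>\<^bsub>P k\<^esub> v k"
proof -
  interpret A: abelian_group "P k" by (rule abelian_group_power)
  have v: "v j \<in> carrier (P j)" if "j \<le> k" for j
    using sum_component[OF assms(2)] assms(3) that by simp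
  have "(single {..N} P 0 (Scalar r) \<otimes>\<^bsub>tensor_ring R M N\<^esub> v) k
      = (\<Oplus>\<^bsub>P k\<^esub>i\<in>{..k}. if 0 = i then r \<odot>\<^bsub>P k\<^esub> v k else \<zero>\<^bsub>P k\<^esub>)"
    unfolding tensor_ring_mult[OF assms(3)]
  proof (intro A.add.finprod_cong' refl)
    fix i assume i: "i \<in> {..k}"
    then have "\<mu> i (k - i) \<zero>\<^bsub>P i\<^esub> (v (k - i)) = \<zero>\<^bsub>P k\<^esub>"
      using mult_zero_left[of "v (k - i)" "k - i" i] v[of "k - i"] by simp
    then show "\<mu> i (k - i) (single {..N} P 0 (Scalar r) i) (v (k - i)) = (if 0 = i then r \<odot>\<^bsub>P k\<^esub> v k else \<zero>\<^bsub>P k\<^esub>)"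
      using i assms(3) by (auto simp: single_def mult_Scalar)
  qed (use assms v in \<open>auto intro!: power_smult_closed\<close>)
  also have "\<dots> = r \<odot>\<^bsub>P k\<^esub> v k"
    using A.add.finprod_singleton[of 0 "{..k}" "\<lambda>_. r \<odot>\<^bsub>P k\<^esub> v k"] assms v
    by (simp add: power_smult_closed)
  finally show ?thesis .
qed

lemma tensor_ring_mult_single:
  assumes "u \<in> carrier (sum_module N)" "x \<in> carrier (P d)" "k \<le> N" "d \<le> k"
  shows "(u \<otimes>\<^bsub>tensor_ring R M N\<^esub> single {..N} P d x) k = \<mu> (k - d) d (u (k - d)) x"
proof -
  interpret A: abelian_group "P k" by (rule abelian_group_power)
  have u: "u j \<in> carrier (P j)" if "j \<le> k" for j
    using sum_component[OF assms(1)] assms(3) that by simp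
  have c: "\<mu> (k - d) d (u (k - d)) x \<in> carrier (P k)"
    using mult_closed[OF u[of "k - d"] assms(2)] assms(4) by simp
  have "(u \<otimes>\<^bsub>tensor_ring R M N\<^esub> single {..N} P d x) k
      = (\<Oplus>\<^bsub>P k\<^esub>i\<in>{..k}. if k - d = i then \<mu> (k - d) d (u (k - d)) x else \<zero>\<^bsub>P k\<^esub>)"
    unfolding tensor_ring_mult[OF assms(3)]
  proof (intro A.add.finprod_cong' refl)
    fix i assume i: "i \<in> {..k}"
    then have "\<mu> i (k - i) (u i) \<zero>\<^bsub>P (k - i)\<^esub> = \<zero>\<^bsub>P k\<^esub>"
      using mult_zero_right[of "u i" i "k - i"] u[of i] by simp
    then show "\<mu> i (k - i) (u i) (single {..N} P d x (k - i))
        = (if k - d = i then \<mu> (k - d) d (u (k - d)) x else \<zero>\<^bsub>P k\<^esub>)"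
      using i assms(3,4) by (auto simp: single_def)
  qed (use c in auto)
  also have "\<dots> = \<mu> (k - d) d (u (k - d)) x"
    using A.add.finprod_singleton[of "k - d" "{..k}" "\<lambda>_. \<mu> (k - d) d (u (k - d)) x"] c by simp
  finally show ?thesis .
qed

text \<open>
  The product is that of the full tensor ring cut off above degree \<open>N\<close>. All terms that occur in
  a component of degree \<open>k \<le> N\<close> of a triple product have degree at most \<open>k\<close>, so truncation does
  not affect associativity.
\<close>

lemma tensor_ring_mult_assoc:
  assumes "u \<in> carrier (sum_module N)" "v \<in> carrier (sum_module N)" "w \<in> carrier (sum_module N)"
  shows "u \<otimes>\<^bsub>tensor_ring R M N\<^esub> v \<otimes>\<^bsub>tensor_ring R M N\<^esub> w
    = u \<otimes>\<^bsub>tensor_ring R M N\<^esub> (v \<otimes>\<^bsub>tensor_ring R M N\<^esub> w)" (is "?l = ?r")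
proof (rule product_module_eqI)
  show "?l \<in> carrier (sum_module N)" "?r \<in> carrier (sum_module N)"
    using assms by (simp_all add: tensor_ring_mult_closed)
  fix k assume "k \<in> {..N}"
  then have k: "k \<le> N" by simp
  interpret A: abelian_group "P k" by (rule abelian_group_power)
  have u: "u j \<in> carrier (P j)" and v: "v j \<in> carrier (P j)" and w: "w j \<in> carrier (P j)"
    if "j \<le> k" for j
    using sum_component[OF assms(1)] sum_component[OF assms(2)] sum_component[OF assms(3)] that k by simp_all
  \<comment> \<open>the term of degree \<open>j\<close> in \<open>u\<close>, \<open>l\<close> in \<open>v\<close> and \<open>k - j - l\<close> in \<open>w\<close>\<close>
  define g where "g j l = \<mu> j (k - j) (u j) (\<mu> l (k - j - l) (v l) (w (k - j - l)))" for j l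
  have g: "g j l \<in> carrier (P k)" if "j + l \<le> k" for j l
    unfolding g_def using that by (intro mult_diff_closed u v w) auto
  have "?l k = (\<Oplus>\<^bsub>P k\<^esub>i\<in>{..k}. \<Oplus>\<^bsub>P k\<^esub>j\<in>{..i}. g j (i - j))"
    unfolding tensor_ring_mult[OF k]
  proof (intro A.add.finprod_cong' refl)
    fix i assume "i \<in> {..k}"
    then have i: "i \<le> k" by simp
    have hom: "(\<lambda>x. \<mu> i (k - i) x (w (k - i))) \<in> additive_hom (P i) (P k)"
      using left_module_homD(1)[OF mult_left_hom(1)[OF w[of "k - i"], of i]] i by simp
    have "(u \<otimes>\<^bsub>tensor_ring R M N\<^esub> v) i = (\<Oplus>\<^bsub>P i\<^esub>j\<in>{..i}. \<mu> j (i - j) (u j) (v (i - j)))"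
      using i k by (intro tensor_ring_mult) simp
    moreover have "\<mu> j (i - j) (u j) (v (i - j)) \<in> carrier (P i)" if "j \<in> {..i}" for j
      using that i by (intro mult_diff_closed u v) auto
    ultimately have "\<mu> i (k - i) ((u \<otimes>\<^bsub>tensor_ring R M N\<^esub> v) i) (w (k - i))
        = (\<Oplus>\<^bsub>P k\<^esub>j\<in>{..i}. \<mu> i (k - i) (\<mu> j (i - j) (u j) (v (i - j))) (w (k - i)))"
      using additive_hom_finsum[OF abelian_group_power abelian_group_power hom, of "{..i}" "\<lambda>j. \<mu> j (i - j) (u j) (v (i - j))"]
      by simp
    also have "\<dots> = (\<Oplus>\<^bsub>P k\<^esub>j\<in>{..i}. g j (i - j))"
    proof (intro A.add.finprod_cong' refl)
      fix j assume "j \<in> {..i}"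
      then show "\<mu> i (k - i) (\<mu> j (i - j) (u j) (v (i - j))) (w (k - i)) = g j (i - j)"
        unfolding g_def using mult_assoc[OF u[of j] v[of "i - j"] w[of "k - i"]] i by simp
    qed (use i in \<open>auto intro!: g\<close>)
    finally show "\<mu> i (k - i) ((u \<otimes>\<^bsub>tensor_ring R M N\<^esub> v) i) (w (k - i)) = (\<Oplus>\<^bsub>P k\<^esub>j\<in>{..i}. g j (i - j))" .
  qed (auto intro!: A.finsum_closed g)
  also have "\<dots> = (\<Oplus>\<^bsub>P k\<^esub>j\<in>{..k}. \<Oplus>\<^bsub>P k\<^esub>l\<in>{..k - j}. g j l)"
    by (rule A.finsum_triangle) (rule g)
  also have "\<dots> = ?r k"
    unfolding tensor_ring_mult[OF k]
  proof (intro A.add.finprod_cong' refl)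
    fix j assume "j \<in> {..k}"
    then have j: "j \<le> k" by simp
    have hom: "(\<lambda>y. \<mu> j (k - j) (u j) y) \<in> additive_hom (P (k - j)) (P k)"
      using mult_right_hom[OF u[OF j], of "k - j"] j by simp
    have "(v \<otimes>\<^bsub>tensor_ring R M N\<^esub> w) (k - j) = (\<Oplus>\<^bsub>P (k - j)\<^esub>l\<in>{..k - j}. \<mu> l (k - j - l) (v l) (w (k - j - l)))"
      using k by (intro tensor_ring_mult) simp
    moreover have "\<mu> l (k - j - l) (v l) (w (k - j - l)) \<in> carrier (P (k - j))" if "l \<in> {..k - j}" for l
      using that by (intro mult_diff_closed v w) auto
    ultimately show "(\<Oplus>\<^bsub>P k\<^esub>l\<in>{..k - j}. g j l) = \<mu> j (k - j) (u j) ((v \<otimes>\<^bsub>tensor_ring R M N\<^esub> w) (k - j))"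
      unfolding g_def
      using additive_hom_finsum[OF abelian_group_power abelian_group_power hom, of "{..k - j}" "\<lambda>l. \<mu> l (k - j - l) (v l) (w (k - j - l))"]
      by simp
  qed (use k in \<open>auto intro!: mult_diff_closed u sum_component[OF tensor_ring_mult_closed[OF assms(2,3)]]\<close>)
  finally show "?l k = ?r k" .
qed

lemma ring_tensor_ring: "ring (tensor_ring R M N)"
proof (rule ringI)
  let ?T = "tensor_ring R M N"
  interpret S: abelian_group "sum_module N" by (rule abelian_group_sum)
  show "abelian_group ?T"
    by (rule abelian_groupI)
      (simp_all add: tensor_ring_simps S.a_ac abelian_groupE(6)[OF abelian_group_sum])
  have one: "Scalar \<one> \<in> carrier (P 0)" by (simp add: power_zero)
  show "monoid ?T"
  proof (rule monoidI; simp only: tensor_ring_simps)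
    show "single {..N} P 0 (Scalar \<one>) \<in> carrier (sum_module N)" by (rule single_power_closed[OF one])
    fix u assume u: "u \<in> carrier (sum_module N)"
    show "single {..N} P 0 (Scalar \<one>) \<otimes>\<^bsub>?T\<^esub> u = u"
      by (rule product_module_eqI[OF tensor_ring_mult_closed[OF single_power_closed[OF one] u] u])
        (use u sum_component[OF u] in \<open>simp add: tensor_ring_mult_Scalar left_module.smult_one[OF left_module_power]\<close>)
    show "u \<otimes>\<^bsub>?T\<^esub> single {..N} P 0 (Scalar \<one>) = u"
      by (rule product_module_eqI[OF tensor_ring_mult_closed[OF u single_power_closed[OF one]] u])
        (use u sum_component[OF u] in \<open>simp add: tensor_ring_mult_single one mult_one_right\<close>)
  qed (simp_all add: tensor_ring_mult_closed tensor_ring_mult_assoc)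
  fix u v w assume "u \<in> carrier ?T" "v \<in> carrier ?T" "w \<in> carrier ?T"
  then have u: "u \<in> carrier (sum_module N)" and v: "v \<in> carrier (sum_module N)" and w: "w \<in> carrier (sum_module N)"
    by (simp_all add: tensor_ring_simps)
  note c = sum_component[OF u] sum_component[OF v] sum_component[OF w]
  show "(u \<oplus>\<^bsub>?T\<^esub> v) \<otimes>\<^bsub>?T\<^esub> w = u \<otimes>\<^bsub>?T\<^esub> w \<oplus>\<^bsub>?T\<^esub> v \<otimes>\<^bsub>?T\<^esub> w"
    unfolding tensor_ring_simps
  proof (rule product_module_eqI[where I = "{..N}" and X = P])
    fix k assume "k \<in> {..N}"
    then have k: "k \<le> N" by simp
    interpret A: abelian_group "P k" by (rule abelian_group_power)
    show "((u \<oplus>\<^bsub>sum_module N\<^esub> v) \<otimes>\<^bsub>?T\<^esub> w) k = (u \<otimes>\<^bsub>?T\<^esub> w \<oplus>\<^bsub>sum_module N\<^esub> v \<otimes>\<^bsub>?T\<^esub> w) k"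
      using k c mult_add_left[of "u i" i "v i" "w (k - i)" "k - i" for i]
      by (simp add: tensor_ring_mult product_module_simps(3))
        (intro A.finsum_add_cong, auto intro!: mult_diff_closed simp: product_module_simps(3))
  qed (use u v w in \<open>simp_all add: tensor_ring_mult_closed\<close>)
  show "w \<otimes>\<^bsub>?T\<^esub> (u \<oplus>\<^bsub>?T\<^esub> v) = w \<otimes>\<^bsub>?T\<^esub> u \<oplus>\<^bsub>?T\<^esub> w \<otimes>\<^bsub>?T\<^esub> v"
    unfolding tensor_ring_simps
  proof (rule product_module_eqI[where I = "{..N}" and X = P])
    fix k assume "k \<in> {..N}"
    then have k: "k \<le> N" by simp
    interpret A: abelian_group "P k" by (rule abelian_group_power)
    show "(w \<otimes>\<^bsub>?T\<^esub> (u \<oplus>\<^bsub>sum_module N\<^esub> v)) k = (w \<otimes>\<^bsub>?T\<^esub> u \<oplus>\<^bsub>sum_module N\<^esub> w \<otimes>\<^bsub>?T\<^esub> v) k"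
      using k c mult_add_right[of "w i" i "u (k - i)" "k - i" "v (k - i)" for i]
      by (simp add: tensor_ring_mult product_module_simps(3))
        (intro A.finsum_add_cong, auto intro!: mult_diff_closed simp: product_module_simps(3))
  qed (use u v w in \<open>simp_all add: tensor_ring_mult_closed\<close>)
qed

text \<open>
  The inclusion of \<open>R\<close> into the tensor ring as the component of degree \<open>0\<close>.
\<close>

definition scalar_embedding where "scalar_embedding N r = single {..N} P 0 (Scalar r)"

lemma additive_hom_tensor_ring_iff:
  "f \<in> additive_hom X (tensor_ring R M N) \<longleftrightarrow> f \<in> additive_hom X (sum_module N)"
  "g \<in> additive_hom (tensor_ring R M N) Y \<longleftrightarrow> g \<in> additive_hom (sum_module N) Y"
  by (simp_all add: hom_def tensor_ring_simps)

lemma scalar_embedding_hom: "scalar_embedding N \<in> additive_hom R (tensor_ring R M N)"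
  unfolding additive_hom_tensor_ring_iff scalar_embedding_def
proof (rule additive_homI)
  fix r s assume r: "r \<in> carrier R" and s: "s \<in> carrier R"
  then show "single {..N} P 0 (Scalar (r \<oplus> s))
      = single {..N} P 0 (Scalar r) \<oplus>\<^bsub>sum_module N\<^esub> single {..N} P 0 (Scalar s)"
    unfolding power_zero(3)[OF r s, symmetric] by (intro single_add abelian_group_power)
qed (simp add: single_power_closed power_zero)

lemma scalar_embedding_mult:
  assumes "r \<in> carrier R" "v \<in> carrier (tensor_ring R M N)"
  shows "scalar_embedding N r \<otimes>\<^bsub>tensor_ring R M N\<^esub> v = r \<odot>\<^bsub>sum_module N\<^esub> v"
proof (rule product_module_eqI)
  have v: "v \<in> carrier (sum_module N)" using assms by (simp add: tensor_ring_simps)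
  show "scalar_embedding N r \<otimes>\<^bsub>tensor_ring R M N\<^esub> v \<in> carrier (sum_module N)"
    unfolding scalar_embedding_def using assms v
    by (intro tensor_ring_mult_closed single_power_closed) (simp_all add: power_zero)
  show "r \<odot>\<^bsub>sum_module N\<^esub> v \<in> carrier (sum_module N)"
    by (rule left_module.smult_closed[OF left_module_sum assms(1) v])
  fix k assume "k \<in> {..N}"
  then show "(scalar_embedding N r \<otimes>\<^bsub>tensor_ring R M N\<^esub> v) k = (r \<odot>\<^bsub>sum_module N\<^esub> v) k"
    using assms v by (simp add: scalar_embedding_def tensor_ring_mult_Scalar product_module_simps(4))
qed

text \<open>
  The projection of the tensor ring onto its component \<open>R\<close> of degree \<open>0\<close>.
\<close>

definition augmentation :: "(nat \<Rightarrow> ('r, 'm) tensor_term) \<Rightarrow> 'r" where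
  "augmentation t = scalar_of (t 0)"

lemma augmentation_hom: "augmentation \<in> additive_hom (tensor_ring R M N) R"
  unfolding additive_hom_tensor_ring_iff augmentation_def
proof (rule additive_homI)
  fix s t assume "s \<in> carrier (sum_module N)" "t \<in> carrier (sum_module N)"
  then have "s 0 \<in> carrier (P 0)" "t 0 \<in> carrier (P 0)" by (auto intro: sum_component)
  then show "scalar_of ((s \<oplus>\<^bsub>sum_module N\<^esub> t) 0) = scalar_of (s 0) \<oplus> scalar_of (t 0)"
    by (auto simp: product_module_simps(3) power_zero)
next
  fix s assume "s \<in> carrier (sum_module N)"
  then have "s 0 \<in> carrier (P 0)" by (auto intro: sum_component)
  then show "scalar_of (s 0) \<in> carrier R" by (auto simp: power_zero)
qed

lemma augmentation_mult:
  assumes "s \<in> carrier (tensor_ring R M N)" "t \<in> carrier (tensor_ring R M N)"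
  shows "augmentation (s \<otimes>\<^bsub>tensor_ring R M N\<^esub> t) = augmentation s \<otimes> augmentation t"
proof -
  have "s 0 \<in> carrier (P 0)" "t 0 \<in> carrier (P 0)"
    using assms by (auto intro: sum_component simp: tensor_ring_simps)
  then obtain a b where a: "a \<in> carrier R" "s 0 = Scalar a" and b: "b \<in> carrier R" "t 0 = Scalar b"
    by (auto simp: power_zero)
  interpret A: abelian_group "P 0" by (rule abelian_group_power)
  have "(s \<otimes>\<^bsub>tensor_ring R M N\<^esub> t) 0 = Scalar (a \<otimes> b)"
    using a b by (simp add: tensor_ring_mult mult_Scalar power_zero A.finsum_insert)
  then show ?thesis using a b by (simp add: augmentation_def)
qed

lemma augmentation_embedding: "augmentation (scalar_embedding N r) = r"
  by (simp add: augmentation_def scalar_embedding_def single_def)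

section \<open>Coherence descends to the base ring and the bimodule\<close>

lemma left_coherent_base:
  assumes "left_coherent (tensor_ring R M N)"
  shows "left_coherent R"
proof -
  let ?T = "tensor_ring R M N"
  interpret T: ring ?T by (rule ring_tensor_ring)
  have c: "scalar_embedding N r \<in> carrier ?T" if "r \<in> carrier R" for r
    using additive_homD(1)[OF scalar_embedding_hom that] .
  have hom: "f \<in> additive_hom (regular_module R) Y" if "f \<in> additive_hom R Y" for f and Y :: "(_, _) ring_scheme"
    using that by (simp add: hom_def regular_module_simps)
  have hom': "f \<in> additive_hom Y (regular_module R)" if "f \<in> additive_hom Y R" for f and Y :: "(_, _) ring_scheme"
    using that by (simp add: hom_def regular_module_simps)
  have mult: "scalar_embedding N r \<otimes>\<^bsub>?T\<^esub> scalar_embedding N x = scalar_embedding N (r \<otimes> x)"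
    if "r \<in> carrier R" "x \<in> carrier R" for r x
    unfolding scalar_embedding_mult[OF that(1) c[OF that(2)]]
    using single_smult[of "{..N}" R P r 0 "Scalar x"] left_module_power that
    by (simp add: scalar_embedding_def power_zero)
  have "pseudo_coherent R (regular_module R)"
    by (rule pseudo_coherent_descent[OF ring_tensor_ring left_module_regular[OF R.ring_axioms]
          assms[unfolded left_coherent_iff[OF ring_tensor_ring]] augmentation_hom augmentation_mult
          scalar_embedding_hom augmentation_embedding hom[OF scalar_embedding_hom] _ hom'[OF augmentation_hom]])
      (simp_all add: regular_module_simps mult augmentation_mult c augmentation_embedding)
  then show ?thesis using left_coherent_iff[OF R.ring_axioms] by simp
qed

text \<open>
  The map \<open>M \<otimes>\<^sub>R R \<rightarrow> M\<close>, \<open>a \<otimes> r \<mapsto> a r\<close>, is a left inverse of \<open>m \<mapsto> m \<otimes> 1\<close>.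
\<close>

lemma power_one_left_inverse:
  obtains \<delta> where "\<delta> \<in> additive_hom (P 1) M"
    "\<And>m. m \<in> carrier M \<Longrightarrow> \<delta> (tens 0 m (Scalar \<one>)) = m"
proof
  let ?\<phi> = "\<lambda>a z. rsmult M a (scalar_of z)"
  have "balanced_map M (P 0) ?\<phi>"
    unfolding balanced_map_def
    by (auto simp: power_zero rsmult_closed rsmult_add_left rsmult_add_right rsmult_mult)
  note lift = power_lift_hom[OF M.abelian_group_axioms this]
  show "power_lift 0 M ?\<phi> \<in> additive_hom (P 1) M"
    unfolding One_nat_def by (rule lift(1))
  show "power_lift 0 M ?\<phi> (tens 0 m (Scalar \<one>)) = m" if "m \<in> carrier M" for m
    using lift(2)[OF that, of "Scalar \<one>"] that by (simp add: power_zero rsmult_one)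
qed

lemma pseudo_coherent_bimodule:
  assumes "left_coherent (tensor_ring R M N)" "nilpotent_bimodule R M N"
  shows "pseudo_coherent R M"
proof -
  let ?T = "tensor_ring R M N"
  obtain \<delta> where \<delta>: "\<delta> \<in> additive_hom (P 1) M"
    "\<And>m. m \<in> carrier M \<Longrightarrow> \<delta> (tens 0 m (Scalar \<one>)) = m"
    by (rule power_one_left_inverse) (rule that)
  have one: "Scalar \<one> \<in> carrier (P 0)" by (simp add: power_zero)
  have tc: "tens 0 m (Scalar \<one>) \<in> carrier (P 1)" if "m \<in> carrier M" for m
    using tens_closed[OF that one] by simp
  show ?thesis
  proof (cases "N = 0")
    case True
    then have P1: "carrier (P 1) = {\<zero>\<^bsub>P 1\<^esub>}" using assms(2) by (simp add: nilpotent_bimodule_def)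
    have "m = \<zero>\<^bsub>M\<^esub>" if "m \<in> carrier M" for m
      using \<delta>(2)[OF that] tc[OF that] P1
        additive_hom_zero[OF \<delta>(1) abelian_group_power M.abelian_group_axioms] by simp
    then have "carrier M = {\<zero>\<^bsub>M\<^esub>}" by auto
    then show ?thesis by (rule pseudo_coherent_zero[OF left_module_axioms])
  next
    case False
    then have N: "1 \<in> {..N}" by simp
    \<comment> \<open>\<open>M\<close> is the component of degree \<open>1\<close>, which is present only for \<open>N > 0\<close>.\<close>
    let ?\<tau> = "\<lambda>m. single {..N} P 1 (tens 0 m (Scalar \<one>))" and ?\<rho> = "\<lambda>t. \<delta> (t 1)"
    have \<tau>: "?\<tau> \<in> additive_hom M ?T"
      unfolding additive_hom_tensor_ring_iff
    proof (rule additive_homI)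
      show "?\<tau> m \<in> carrier (sum_module N)" if "m \<in> carrier M" for m by (rule single_power_closed[OF tc[OF that]])
      show "?\<tau> (a \<oplus>\<^bsub>M\<^esub> b) = ?\<tau> a \<oplus>\<^bsub>sum_module N\<^esub> ?\<tau> b" if "a \<in> carrier M" "b \<in> carrier M" for a b
        using tens_add_left[OF that one] single_add[of "{..N}" P 1] abelian_group_power by simp
    qed
    have \<tau>c: "?\<tau> m \<in> carrier ?T" if "m \<in> carrier M" for m using additive_homD(1)[OF \<tau> that] .
    have \<tau>_smult: "scalar_embedding N r \<otimes>\<^bsub>?T\<^esub> ?\<tau> m = ?\<tau> (r \<odot>\<^bsub>M\<^esub> m)" if "r \<in> carrier R" "m \<in> carrier M" for r m
      unfolding scalar_embedding_mult[OF that(1) \<tau>c[OF that(2)]]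
      using single_smult[of "{..N}" R P r 1 "tens 0 m (Scalar \<one>)"] left_module_power tens_smult[OF that(2) one that(1)] that(1)
      by simp
    have \<rho>: "?\<rho> \<in> additive_hom ?T M"
      unfolding additive_hom_tensor_ring_iff
      using N by (intro additive_homI)
        (simp_all add: additive_homD[OF \<delta>(1)] sum_component product_module_simps(3) del: One_nat_def)
    have \<rho>_mult: "?\<rho> (t \<otimes>\<^bsub>?T\<^esub> ?\<tau> m) = augmentation t \<odot>\<^bsub>M\<^esub> m" if t: "t \<in> carrier ?T" and m: "m \<in> carrier M" for t m
    proof -
      have ts: "t \<in> carrier (sum_module N)" using t by (simp add: tensor_ring_simps)
      then have "t 0 \<in> carrier (P 0)" by (auto intro: sum_component)
      then obtain a where a: "a \<in> carrier R" "t 0 = Scalar a" by (auto simp: power_zero)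
      have "(t \<otimes>\<^bsub>?T\<^esub> ?\<tau> m) 1 = \<mu> 0 1 (t 0) (tens 0 m (Scalar \<one>))"
        using tensor_ring_mult_single[OF ts tc[OF m], of 1] N by simp
      also have "\<dots> = tens 0 (a \<odot>\<^bsub>M\<^esub> m) (Scalar \<one>)"
        using a tens_smult[OF m one a(1)] by (simp add: mult_Scalar)
      finally show ?thesis using a m \<delta>(2) by (simp add: augmentation_def smult_closed)
    qed
    show ?thesis
      by (rule pseudo_coherent_descent[where \<tau> = ?\<tau> and \<rho> = ?\<rho>, OF ring_tensor_ring left_module_axioms
          assms(1)[unfolded left_coherent_iff[OF ring_tensor_ring]] augmentation_hom augmentation_mult
          scalar_embedding_hom augmentation_embedding \<tau> \<tau>_smult \<rho> \<rho>_mult])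
  qed
qed

section \<open>Coherence ascends to the tensor ring\<close>

lemma rsmult_zero:
  assumes "m \<in> carrier M"
  shows "rsmult M m \<zero> = \<zero>\<^bsub>M\<^esub>"
proof (rule additive_hom_zero[OF _ R.abelian_group_axioms M.abelian_group_axioms])
  show "(\<lambda>r. rsmult M m r) \<in> additive_hom R M"
    using assms by (intro additive_homI rsmult_closed rsmult_add_right)
qed

text \<open>
  If a balanced map \<open>\<beta>\<close> on \<open>M \<times> L\<close>, linear in the first argument, sends pairs of generators
  into a submodule \<open>H\<close>, then it sends all pairs into \<open>H\<close>. The order matters: a scalar in the
  second argument moves to the first, so \<open>H\<close> must be reached for all first arguments before the
  second one is varied.
\<close>

lemma balanced_image_subset:
  assumes X: "left_module R X" and Y: "left_module R Y" and H: "submodule H R Y" and L: "submodule L R X"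
    and gens_M: "S \<subseteq> carrier M" "\<And>K. submodule K R M \<Longrightarrow> S \<subseteq> K \<Longrightarrow> carrier M \<subseteq> K"
    and gens_L: "T \<subseteq> L" "\<And>K. submodule K R X \<Longrightarrow> T \<subseteq> K \<Longrightarrow> L \<subseteq> K"
    and left: "\<And>x. x \<in> L \<Longrightarrow> (\<lambda>m. \<beta> m x) \<in> left_module_hom R M Y"
    and right: "\<And>m x y. \<lbrakk>m \<in> carrier M; x \<in> L; y \<in> L\<rbrakk> \<Longrightarrow> \<beta> m (x \<oplus>\<^bsub>X\<^esub> y) = \<beta> m x \<oplus>\<^bsub>Y\<^esub> \<beta> m y"
    and balanced: "\<And>m x r. \<lbrakk>m \<in> carrier M; x \<in> L; r \<in> carrier R\<rbrakk> \<Longrightarrow> \<beta> (rsmult M m r) x = \<beta> m (r \<odot>\<^bsub>X\<^esub> x)"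
    and gens: "\<And>s t. \<lbrakk>s \<in> S; t \<in> T\<rbrakk> \<Longrightarrow> \<beta> s t \<in> H"
    and mx: "m \<in> carrier M" "x \<in> L"
  shows "\<beta> m x \<in> H"
proof -
  interpret X: left_module R X by fact
  interpret Y: left_module R Y by fact
  note HD = H[unfolded Y.submodule_iff] and LD = L[unfolded X.submodule_iff]
  have 1: "\<beta> m t \<in> H" if "t \<in> T" "m \<in> carrier M" for m t
  proof -
    have t: "t \<in> L" using that gens_L(1) by blast
    have "submodule {m \<in> carrier M. \<beta> m t \<in> H} R M"
      by (rule submodule_preimage[OF Y _ left_module_homD[OF left[OF t]] H]) auto
    then show ?thesis using gens_M(1) gens_M(2)[of "{m \<in> carrier M. \<beta> m t \<in> H}"] gens[OF _ that(1)] that(2) by blast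
  qed
  let ?K = "{x \<in> L. \<forall>m\<in>carrier M. \<beta> m x \<in> H}"
  have "submodule ?K R X"
    unfolding X.submodule_iff
  proof (intro conjI ballI)
    show "?K \<subseteq> carrier X" using LD by blast
    have z: "\<zero>\<^bsub>X\<^esub> \<in> L" using LD by blast
    have "\<beta> m \<zero>\<^bsub>X\<^esub> = \<beta> \<zero>\<^bsub>M\<^esub> \<zero>\<^bsub>X\<^esub>" if m: "m \<in> carrier M" for m
    proof -
      have "\<zero>\<^bsub>X\<^esub> = \<zero> \<odot>\<^bsub>X\<^esub> \<zero>\<^bsub>X\<^esub>" by (simp add: X.smult_zero_left)
      then have "\<beta> m \<zero>\<^bsub>X\<^esub> = \<beta> (rsmult M m \<zero>) \<zero>\<^bsub>X\<^esub>" using balanced[OF m z R.zero_closed] by simp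
      also have "rsmult M m \<zero> = \<zero>\<^bsub>M\<^esub>" by (rule rsmult_zero[OF m])
      finally show ?thesis .
    qed
    moreover have "\<beta> \<zero>\<^bsub>M\<^esub> \<zero>\<^bsub>X\<^esub> = \<zero>\<^bsub>Y\<^esub>"
      by (rule additive_hom_zero[OF left_module_homD(1)[OF left[OF z]] M.abelian_group_axioms Y.M.abelian_group_axioms])
    ultimately show "\<zero>\<^bsub>X\<^esub> \<in> ?K" using HD z by auto
  next
    fix x y assume "x \<in> ?K" "y \<in> ?K"
    then show "x \<oplus>\<^bsub>X\<^esub> y \<in> ?K" using HD LD right by auto
  next
    fix r x assume "r \<in> carrier R" "x \<in> ?K"
    then show "r \<odot>\<^bsub>X\<^esub> x \<in> ?K" using LD rsmult_closed by (auto simp flip: balanced)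
  qed
  from gens_L(2)[OF this] show ?thesis using 1 gens_L(1) mx by blast
qed

lemma tens_left_hom:
  "z \<in> carrier (P i) \<Longrightarrow> (\<lambda>m. tens i m z) \<in> left_module_hom R M (P (Suc i))"
  by (intro left_module_homI additive_homI) (simp_all add: tens_closed tens_add_left tens_smult)

lemma fg_power_Suc:
  assumes "fg_subset R M (carrier M)" "fg_subset R (P i) (carrier (P i))"
  shows "fg_subset R (P (Suc i)) (carrier (P (Suc i)))"
proof -
  interpret X: left_module R "P i" by (rule left_module_power)
  interpret Y: left_module R "P (Suc i)" by (rule left_module_power)
  obtain S where S: "finite S" "S \<subseteq> carrier M" "\<And>K. submodule K R M \<Longrightarrow> S \<subseteq> K \<Longrightarrow> carrier M \<subseteq> K"
    using assms(1) unfolding fg_subset_def by blast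
  obtain T where T: "finite T" "T \<subseteq> carrier (P i)" "\<And>K. submodule K R (P i) \<Longrightarrow> T \<subseteq> K \<Longrightarrow> carrier (P i) \<subseteq> K"
    using assms(2) unfolding fg_subset_def by blast
  show ?thesis
    unfolding fg_subset_def
  proof (intro exI[of _ "(\<lambda>(s, t). tens i s t) ` (S \<times> T)"] conjI allI impI subsetI)
    fix H x assume H: "submodule H R (P (Suc i))" "(\<lambda>(s, t). tens i s t) ` (S \<times> T) \<subseteq> H"
      and x: "x \<in> carrier (P (Suc i))"
    note HD = H(1)[unfolded Y.submodule_iff]
    have "tens i m z \<in> H" if "m \<in> carrier M" "z \<in> carrier (P i)" for m z
      by (rule balanced_image_subset[OF left_module_power left_module_power H(1) X.submodule_carrier S(2,3) T(2,3) tens_left_hom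
            tens_add_right tens_balanced _ that])
        (use H(2) in auto)
    with x show "x \<in> H"
      by (induction rule: power_Suc_induct) (use HD in auto)
  qed (use S T in \<open>auto intro!: tens_closed\<close>)
qed

text \<open>
  For generators \<open>x j\<close> of \<open>M\<^sup>i\<close>, indexed by \<open>j < n\<close>, the module \<open>M\<^sup>i\<^sup>+\<^sup>1\<close> is the quotient of
  the \<open>n\<close>-fold direct sum of \<open>M\<close> by the submodule generated by the
  \<open>act m k = (m k\<^sub>1, \<dots>, m k\<^sub>n)\<close>, for finitely many \<open>m\<close> and finitely many relations \<open>k\<close> between
  the \<open>x j\<close>.
\<close>

lemma pseudo_coherent_power_Suc:
  assumes "fg_subset R M (carrier M)" "pseudo_coherent R M"
    and "fg_subset R (P i) (carrier (P i))" "pseudo_coherent R (P i)"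
  shows "pseudo_coherent R (P (Suc i))"
proof -
  interpret X: left_module R "P i" by (rule left_module_power)
  interpret Y: left_module R "P (Suc i)" by (rule left_module_power)
  obtain n f where f: "f \<in> left_module_hom R (free_module R n) (P i)"
      "f ` carrier (free_module R n) = carrier (P i)"
    by (rule fg_subset_imp_free_surj[OF left_module_power X.submodule_carrier assms(3)])
  let ?F = "free_module R n"
  interpret F: left_module R ?F by (rule left_module_free[OF R.ring_axioms])
  let ?Q = "product_module {..<n} (\<lambda>_. M)"
  interpret Q: left_module R ?Q by (rule left_module_product_module[OF R.ring_axioms left_module_axioms])
  note fD = left_module_homD[OF f(1)]
  define e where "e j = free_single R n j \<one>" for j
  have e: "e j \<in> carrier ?F" for j unfolding e_def by (rule free_single_closed[OF R.ring_axioms R.one_closed])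
  define x where "x j = f (e j)" for j
  have x: "x j \<in> carrier (P i)" for j unfolding x_def by (rule additive_homD(1)[OF fD(1) e])
  let ?\<psi> = "coordinate_sum (P (Suc i)) {..<n} (\<lambda>j m. tens i m (x j))"
  have \<psi>: "?\<psi> \<in> left_module_hom R ?Q (P (Suc i))"
    by (intro coordinate_sum_module_hom finite_lessThan left_module_power left_module_axioms tens_left_hom x)
  note \<psi>D = left_module_homD[OF \<psi>]
  have \<psi>_single: "?\<psi> (single {..<n} (\<lambda>_. M) j m) = tens i m (x j)" if "j < n" "m \<in> carrier M" for j m
    using left_module_homD(1)[OF tens_left_hom[OF x]] that
    by (intro coordinate_sum_single) (auto simp: abelian_group_power M.abelian_group_axioms)
  define act where "act m v = (\<lambda>j\<in>{..<n}. rsmult M m (v j))" for m v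
  have Fc: "v j \<in> carrier R" if "v \<in> carrier ?F" "j < n" for v j using that by (auto simp: free_module_def)
  have act: "act m v \<in> carrier ?Q" if "m \<in> carrier M" "v \<in> carrier ?F" for m v
    using that Fc by (auto simp: act_def product_module_simps rsmult_closed)
  have act_left: "(\<lambda>m. act m v) \<in> left_module_hom R M ?Q" if "v \<in> carrier ?F" for v
    using that Fc by (intro left_module_homI additive_homI act)
      (auto simp: act_def product_module_simps rsmult_add_left smult_rsmult intro!: restrict_ext)
  have act_right: "act m (v \<oplus>\<^bsub>?F\<^esub> w) = act m v \<oplus>\<^bsub>?Q\<^esub> act m w"
    if "m \<in> carrier M" "v \<in> carrier ?F" "w \<in> carrier ?F" for m v w
    using that Fc by (auto simp: act_def product_module_simps free_module_def rsmult_add_right intro!: restrict_ext)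
  have act_balanced: "act (rsmult M m r) v = act m (r \<odot>\<^bsub>?F\<^esub> v)"
    if "m \<in> carrier M" "v \<in> carrier ?F" "r \<in> carrier R" for m v r
    using that Fc by (auto simp: act_def product_module_simps free_module_def rsmult_mult intro!: restrict_ext)
  have act_right_hom: "(\<lambda>v. act m v) \<in> additive_hom ?F ?Q" if "m \<in> carrier M" for m
    using that by (intro additive_homI act act_right)
  have act_single: "act m (free_single R n j r) = single {..<n} (\<lambda>_. M) j (rsmult M m r)"
    if "m \<in> carrier M" "r \<in> carrier R" for m r j
    using that by (auto simp: act_def single_def regular_module_simps rsmult_zero intro!: restrict_ext)
  have \<psi>_act: "?\<psi> (act m v) = tens i m (f v)" if m: "m \<in> carrier M" and v: "v \<in> carrier ?F" for m v
  proof (rule additive_hom_free_eqI[OF R.ring_axioms abelian_group_power _ _ _ v])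
    show "(\<lambda>v. ?\<psi> (act m v)) \<in> additive_hom ?F (P (Suc i))"
      by (intro additive_homI)
        (simp_all only: additive_homD[OF act_right_hom[OF m]] additive_homD[OF \<psi>D(1)])
    show "(\<lambda>v. tens i m (f v)) \<in> additive_hom ?F (P (Suc i))"
      using m by (intro additive_homI) (simp_all add: additive_homD[OF fD(1)] tens_closed tens_add_right)
    fix j r assume j: "j < n" "r \<in> carrier R"
    have "f (free_single R n j r) = r \<odot>\<^bsub>P i\<^esub> x j"
      unfolding x_def e_def by (rule left_module_hom_free_single[OF R.ring_axioms f(1) j(2)])
    then show "?\<psi> (act m (free_single R n j r)) = tens i m (f (free_single R n j r))"
      using j m x by (simp add: act_single \<psi>_single rsmult_closed tens_balanced)
  qed
  have \<psi>_surj: "?\<psi> ` carrier ?Q = carrier (P (Suc i))"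
  proof (intro equalityI subsetI)
    show "y \<in> carrier (P (Suc i))" if "y \<in> ?\<psi> ` carrier ?Q" for y
      using that additive_homD(1)[OF \<psi>D(1)] by blast
    have sub: "submodule (?\<psi> ` carrier ?Q) R (P (Suc i))"
      by (rule submodule_hom_image[OF Q.left_module_axioms left_module_power \<psi> Q.submodule_carrier])
    note subD = sub[unfolded Y.submodule_iff]
    show "y \<in> ?\<psi> ` carrier ?Q" if "y \<in> carrier (P (Suc i))" for y
      using that
    proof (induction rule: power_Suc_induct)
      case zero
      then show ?case using subD by blast
    next
      case (tens a z)
      then obtain v where "v \<in> carrier ?F" "z = f v" using f(2) by blast
      then show ?case using \<psi>_act[OF tens(1), of v] act[OF tens(1), of v] by (metis imageI)
    next
      case (add y z)
      then show ?case using subD by blast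
    qed
  qed
  obtain S where S: "finite S" "S \<subseteq> carrier M" "\<And>K. submodule K R M \<Longrightarrow> S \<subseteq> K \<Longrightarrow> carrier M \<subseteq> K"
    using assms(1) unfolding fg_subset_def by blast
  have KF: "submodule (kernel_of ?F (P i) f) R ?F"
    by (rule submodule_kernel[OF F.left_module_axioms left_module_power f(1)])
  obtain T where T: "finite T" "T \<subseteq> kernel_of ?F (P i) f"
    "\<And>K. submodule K R ?F \<Longrightarrow> T \<subseteq> K \<Longrightarrow> kernel_of ?F (P i) f \<subseteq> K"
    using bspec[OF spec[OF assms(4)[unfolded pseudo_coherent_def]] f(1)] unfolding fg_subset_def by blast
  have "fg_subset R ?Q (kernel_of ?Q (P (Suc i)) ?\<psi>)"
    unfolding fg_subset_def
  proof (intro exI[of _ "(\<lambda>(s, t). act s t) ` (S \<times> T)"] conjI allI impI subsetI)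
    show "finite ((\<lambda>(s, t). act s t) ` (S \<times> T))" using S T by simp
    fix q assume "q \<in> (\<lambda>(s, t). act s t) ` (S \<times> T)"
    then obtain s t where st: "q = act s t" "s \<in> S" "t \<in> T" by auto
    then have q: "q = act s t" "s \<in> carrier M" "t \<in> carrier ?F" "f t = \<zero>\<^bsub>P i\<^esub>"
      using S(2) T(2) by blast+
    have "tens i s \<zero>\<^bsub>P i\<^esub> = \<zero>\<^bsub>P (Suc i)\<^esub>"
      by (rule additive_hom_zero[where f = "tens i s"])
        (auto intro!: additive_homI simp: q tens_closed tens_add_right abelian_group_power)
    then show "q \<in> kernel_of ?Q (P (Suc i)) ?\<psi>" using q act by (simp add: \<psi>_act)
  next
    fix H q assume H: "submodule H R ?Q" "(\<lambda>(s, t). act s t) ` (S \<times> T) \<subseteq> H"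
      and "q \<in> kernel_of ?Q (P (Suc i)) ?\<psi>"
    then have q: "q \<in> carrier ?Q" and \<psi>q: "?\<psi> q = \<zero>\<^bsub>P (Suc i)\<^esub>" by simp_all
    note HD = H(1)[unfolded Q.submodule_iff]
    have actH: "act m v \<in> H" if "m \<in> carrier M" "v \<in> kernel_of ?F (P i) f" for m v
      by (rule balanced_image_subset[OF F.left_module_axioms Q.left_module_axioms H(1) KF S(2,3) T(2,3)
            act_left act_right act_balanced _ that])
        (use H(2) in auto)
    \<comment> \<open>A section \<open>s\<close> of \<open>f\<close>, not additive. Modulo \<open>H\<close> the map \<open>(m, z) \<mapsto> act m (s z)\<close> is
        biadditive and balanced, since \<open>s\<close> is linear up to relations.\<close>
    have "\<forall>z\<in>carrier (P i). \<exists>v\<in>carrier ?F. f v = z" using f(2) by (metis imageE)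
    then obtain s where s: "\<And>z. z \<in> carrier (P i) \<Longrightarrow> s z \<in> carrier ?F" "\<And>z. z \<in> carrier (P i) \<Longrightarrow> f (s z) = z"
      by metis
    have fminus: "f (v \<ominus>\<^bsub>?F\<^esub> w) = f v \<ominus>\<^bsub>P i\<^esub> f w" if "v \<in> carrier ?F" "w \<in> carrier ?F" for v w
      by (rule additive_hom_minus[OF fD(1) F.M.abelian_group_axioms X.M.abelian_group_axioms that])
    have aminus: "act m (v \<ominus>\<^bsub>?F\<^esub> w) = act m v \<ominus>\<^bsub>?Q\<^esub> act m w"
      if "m \<in> carrier M" "v \<in> carrier ?F" "w \<in> carrier ?F" for m v w
      by (rule additive_hom_minus[OF act_right_hom[OF that(1)] F.M.abelian_group_axioms Q.M.abelian_group_axioms that(2,3)])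
    have diffH: "act m v \<ominus>\<^bsub>?Q\<^esub> act m w \<in> H"
      if "m \<in> carrier M" "v \<in> carrier ?F" "w \<in> carrier ?F" "f v = f w" for m v w
    proof -
      have "f (v \<ominus>\<^bsub>?F\<^esub> w) = \<zero>\<^bsub>P i\<^esub>"
        unfolding fminus[OF that(2,3)] using that(4) additive_homD(1)[OF fD(1) that(3)]
        by (simp add: a_minus_def X.M.r_neg)
      then show ?thesis using actH[of m "v \<ominus>\<^bsub>?F\<^esub> w"] that by (simp add: aminus)
    qed
    \<comment> \<open>\<open>\<theta>\<close> is the identity modulo \<open>H\<close>, and \<open>\<theta> q\<close> is in \<open>H\<close> by the vanishing of \<open>\<psi> q\<close>.\<close>
    let ?\<theta> = "coordinate_sum ?Q {..<n} (\<lambda>j m. act m (s (x j)))"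
    have \<theta>: "?\<theta> \<in> left_module_hom R ?Q ?Q"
      by (intro coordinate_sum_module_hom finite_lessThan left_module_axioms Q.left_module_axioms act_left s x)
    note \<theta>D = left_module_homD[OF \<theta>]
    have \<theta>c: "?\<theta> q \<in> carrier ?Q" if "q \<in> carrier ?Q" for q using additive_homD(1)[OF \<theta>D(1)] that .
    have \<theta>_single: "?\<theta> (single {..<n} (\<lambda>_. M) j m) = act m (s (x j))" if "j < n" "m \<in> carrier M" for j m
      using left_module_homD(1)[OF act_left[OF s(1)[OF x]]] that
      by (intro coordinate_sum_single) (auto simp: Q.M.abelian_group_axioms M.abelian_group_axioms)
    have q\<theta>: "q \<ominus>\<^bsub>?Q\<^esub> ?\<theta> q \<in> H"
    proof (rule product_module_induct[OF finite_lessThan q M.abelian_group_axioms])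
      have "?\<theta> \<zero>\<^bsub>?Q\<^esub> = \<zero>\<^bsub>?Q\<^esub>"
        by (rule additive_hom_zero[OF \<theta>D(1) Q.M.abelian_group_axioms Q.M.abelian_group_axioms])
      then show "\<zero>\<^bsub>?Q\<^esub> \<ominus>\<^bsub>?Q\<^esub> ?\<theta> \<zero>\<^bsub>?Q\<^esub> \<in> H"
        using HD by (simp add: a_minus_def Q.M.r_neg)
    next
      fix j m assume j: "j \<in> {..<n}" "m \<in> carrier M"
      have eq: "single {..<n} (\<lambda>_. M) j m = act m (e j)"
        unfolding e_def using act_single[OF j(2) R.one_closed] rsmult_one[OF j(2)] by simp
      have "act m (e j) \<ominus>\<^bsub>?Q\<^esub> act m (s (x j)) \<in> H"
        by (rule diffH[OF j(2) e s(1)[OF x]]) (simp only: s(2)[OF x], simp only: x_def)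
      then show "single {..<n} (\<lambda>_. M) j m \<ominus>\<^bsub>?Q\<^esub> ?\<theta> (single {..<n} (\<lambda>_. M) j m) \<in> H"
        using \<theta>_single[of j m] j unfolding eq by simp
    next
      fix u v assume uv: "u \<in> carrier ?Q" "v \<in> carrier ?Q" "u \<ominus>\<^bsub>?Q\<^esub> ?\<theta> u \<in> H" "v \<ominus>\<^bsub>?Q\<^esub> ?\<theta> v \<in> H"
      then have "(u \<oplus>\<^bsub>?Q\<^esub> v) \<ominus>\<^bsub>?Q\<^esub> ?\<theta> (u \<oplus>\<^bsub>?Q\<^esub> v) = (u \<ominus>\<^bsub>?Q\<^esub> ?\<theta> u) \<oplus>\<^bsub>?Q\<^esub> (v \<ominus>\<^bsub>?Q\<^esub> ?\<theta> v)"
        using \<theta>c by (simp add: additive_homD(2)[OF \<theta>D(1)] a_minus_def Q.M.minus_add Q.M.a_ac)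
      then show "(u \<oplus>\<^bsub>?Q\<^esub> v) \<ominus>\<^bsub>?Q\<^esub> ?\<theta> (u \<oplus>\<^bsub>?Q\<^esub> v) \<in> H" using uv HD by simp
    qed
    have 1: "act (m \<oplus>\<^bsub>M\<^esub> m') (s z) \<ominus>\<^bsub>?Q\<^esub> act m (s z) \<ominus>\<^bsub>?Q\<^esub> act m' (s z) \<in> H"
      if "m \<in> carrier M" "m' \<in> carrier M" "z \<in> carrier (P i)" for m m' z
      using that HD additive_homD(2)[OF left_module_homD(1)[OF act_left[OF s(1)[OF that(3)]]]] act s
      by (simp add: Q.M.minus_add_cancel)
    have 2: "act m (s (z \<oplus>\<^bsub>P i\<^esub> z')) \<ominus>\<^bsub>?Q\<^esub> act m (s z) \<ominus>\<^bsub>?Q\<^esub> act m (s z') \<in> H"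
      if "m \<in> carrier M" "z \<in> carrier (P i)" "z' \<in> carrier (P i)" for m z z'
    proof -
      have "act m (s (z \<oplus>\<^bsub>P i\<^esub> z')) \<ominus>\<^bsub>?Q\<^esub> act m (s z \<oplus>\<^bsub>?F\<^esub> s z') \<in> H"
        using that s additive_homD(2)[OF fD(1)] by (intro diffH) simp_all
      also have "act m (s (z \<oplus>\<^bsub>P i\<^esub> z')) \<ominus>\<^bsub>?Q\<^esub> act m (s z \<oplus>\<^bsub>?F\<^esub> s z')
          = act m (s (z \<oplus>\<^bsub>P i\<^esub> z')) \<ominus>\<^bsub>?Q\<^esub> act m (s z) \<ominus>\<^bsub>?Q\<^esub> act m (s z')"
        using that s act by (simp add: act_right a_minus_def Q.M.minus_add Q.M.a_assoc)
      finally show ?thesis .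
    qed
    have 3: "act (rsmult M m r) (s z) \<ominus>\<^bsub>?Q\<^esub> act m (s (r \<odot>\<^bsub>P i\<^esub> z)) \<in> H"
      if "m \<in> carrier M" "z \<in> carrier (P i)" "r \<in> carrier R" for m z r
      unfolding act_balanced[OF that(1) s(1)[OF that(2)] that(3)]
      using that s fD(2) by (intro diffH) (simp_all add: F.smult_closed X.smult_closed)
    have "balanced_mod ?Q H (P i) (\<lambda>m z. act m (s z))"
      unfolding balanced_mod_def by (intro conjI ballI act s 1 2 3)
    moreover have "q j \<in> carrier M" if "j \<in> {..<n}" for j using q that by (auto simp: product_module_simps)
    moreover have "(\<Oplus>\<^bsub>P (Suc i)\<^esub>j\<in>{..<n}. tens i (q j) (x j)) = \<zero>\<^bsub>P (Suc i)\<^esub>"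
      using \<psi>q by (simp add: coordinate_sum_def)
    ultimately have "?\<theta> q \<in> H"
      unfolding coordinate_sum_def
      using x by (intro power_relation[OF Q.M.abelian_group_axioms submodule.axioms(1)[OF H(1)]]) auto
    then have "(q \<ominus>\<^bsub>?Q\<^esub> ?\<theta> q) \<oplus>\<^bsub>?Q\<^esub> ?\<theta> q \<in> H" using HD q\<theta> by blast
    then show "q \<in> H" using q \<theta>c by (simp add: a_minus_def Q.M.a_assoc Q.M.l_neg)
  qed
  moreover have "pseudo_coherent R ?Q"
    by (rule pseudo_coherent_product_module[OF R.ring_axioms finite_lessThan left_module_axioms assms(2)])
  ultimately show ?thesis
    by (intro pseudo_coherent_quotient[OF Q.left_module_axioms left_module_power \<psi> \<psi>_surj])
qed

lemma power_fg_pseudo_coherent: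
  assumes "fg_subset R M (carrier M)" "pseudo_coherent R M" "pseudo_coherent R (regular_module R)"
  shows "fg_subset R (P i) (carrier (P i)) \<and> pseudo_coherent R (P i)"
proof (induction i)
  case 0
  interpret A: left_module R "regular_module R" by (rule left_module_regular[OF R.ring_axioms])
  have h: "Scalar \<in> left_module_hom R (regular_module R) (P 0)"
    by (auto simp: left_module_hom_def regular_module_simps power_zero)
  have im: "Scalar ` carrier (regular_module R) = carrier (P 0)"
    by (simp add: regular_module_simps power_zero)
  have "kernel_of (regular_module R) (P 0) Scalar = {\<zero>\<^bsub>regular_module R\<^esub>}"
    by (auto simp: power_zero regular_module_simps)
  then have "fg_subset R (regular_module R) (kernel_of (regular_module R) (P 0) Scalar)"
    unfolding fg_subset_def by (intro exI[of _ "{}"]) (auto simp: A.submodule_iff)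
  then show ?case
    using fg_subset_hom_image[OF A.left_module_axioms left_module_power h fg_regular_module[OF R.ring_axioms] _ im]
      pseudo_coherent_quotient[OF A.left_module_axioms left_module_power h im assms(3)] by simp
next
  case (Suc i)
  then show ?case
    using fg_power_Suc[OF assms(1)] pseudo_coherent_power_Suc[OF assms(1,2)] by simp
qed

lemma left_coherent_tensor_ring:
  assumes "fg_subset R M (carrier M)" "pseudo_coherent R M" "left_coherent R"
  shows "left_coherent (tensor_ring R M N)"
proof -
  let ?T = "tensor_ring R M N" and ?S = "sum_module N"
  note pow = power_fg_pseudo_coherent[OF assms(1,2) assms(3)[unfolded left_coherent_iff[OF R.ring_axioms]]]
  interpret S: left_module R ?S by (rule left_module_sum)
  interpret T: ring ?T by (rule ring_tensor_ring)
  interpret A: left_module ?T "regular_module ?T" by (rule left_module_regular[OF ring_tensor_ring])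
  have "pseudo_coherent ?T (regular_module ?T)"
    unfolding pseudo_coherent_def
  proof (intro allI ballI)
    fix n f assume f: "f \<in> left_module_hom ?T (free_module ?T n) (regular_module ?T)"
    note fD = left_module_homD[OF f]
    let ?F = "free_module ?T n" and ?G = "product_module {..<n} (\<lambda>_. ?S)"
    interpret F: left_module ?T ?F by (rule left_module_free[OF ring_tensor_ring])
    interpret G: left_module R ?G by (rule left_module_product_module[OF R.ring_axioms left_module_sum])
    \<comment> \<open>\<open>G\<close> is \<open>F\<close> with scalars restricted along \<open>\<iota>\<close>.\<close>
    have eq: "carrier ?G = carrier ?F" "u \<oplus>\<^bsub>?G\<^esub> v = u \<oplus>\<^bsub>?F\<^esub> v" for u v
      by (simp_all add: free_module_def product_module_def[of "{..<n}"] tensor_ring_simps)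
    have smult: "r \<odot>\<^bsub>?G\<^esub> v = scalar_embedding N r \<odot>\<^bsub>?F\<^esub> v" if "r \<in> carrier R" "v \<in> carrier ?F" for r v
      using that scalar_embedding_mult[OF that(1)]
      by (auto simp: free_module_def product_module_def[of "{..<n}"] PiE_iff intro!: restrict_ext)
    have emb: "scalar_embedding N r \<in> carrier ?T" if "r \<in> carrier R" for r
      using additive_homD(1)[OF scalar_embedding_hom that] .
    have fc: "f v \<in> carrier ?T" if "v \<in> carrier ?F" for v
      using additive_homD(1)[OF fD(1) that] by (simp add: regular_module_simps)
    have comp: "(\<lambda>v. f v k) \<in> left_module_hom R ?G (P k)" if k: "k \<in> {..N}" for k
    proof (intro left_module_homI additive_homI; simp only: eq)
      fix v assume v: "v \<in> carrier ?F"
      show "f v k \<in> carrier (P k)" using fc[OF v] k by (simp add: tensor_ring_simps sum_component)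
      show "f (r \<odot>\<^bsub>?G\<^esub> v) k = r \<odot>\<^bsub>P k\<^esub> f v k" if "r \<in> carrier R" for r
        unfolding smult[OF that v] fD(2)[OF emb[OF that] v]
        using k scalar_embedding_mult[OF that fc[OF v]]
        by (simp add: regular_module_simps product_module_simps(4))
      show "f (v \<oplus>\<^bsub>?F\<^esub> w) k = f v k \<oplus>\<^bsub>P k\<^esub> f w k" if "w \<in> carrier ?F" for w
        using additive_homD(2)[OF fD(1) v that] k
        by (simp add: regular_module_simps tensor_ring_simps product_module_simps(3))
    qed
    have "fg_subset R ?S (carrier ?S)"
      using pow by (intro fg_product_module R.ring_axioms left_module_power) auto
    then have "fg_subset R ?G (carrier ?G)"
      by (rule fg_product_module[OF R.ring_axioms finite_lessThan left_module_sum])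
    then have fg: "fg_subset R ?G {v \<in> carrier ?G. \<forall>k\<in>{..N}. f v k = \<zero>\<^bsub>P k\<^esub>}"
      using pow comp G.left_module_axioms left_module_power by (intro conjunct1[OF fg_common_kernel]) auto
    have "f v = \<zero>\<^bsub>?T\<^esub> \<longleftrightarrow> (\<forall>k\<in>{..N}. f v k = \<zero>\<^bsub>P k\<^esub>)" if v: "v \<in> carrier ?F" for v
    proof
      assume "f v = \<zero>\<^bsub>?T\<^esub>"
      then show "\<forall>k\<in>{..N}. f v k = \<zero>\<^bsub>P k\<^esub>" by (simp add: tensor_ring_simps product_module_simps(2))
    next
      assume 0: "\<forall>k\<in>{..N}. f v k = \<zero>\<^bsub>P k\<^esub>"
      show "f v = \<zero>\<^bsub>?T\<^esub>"
        unfolding tensor_ring_simps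
        by (rule product_module_eqI[OF fc[OF v, unfolded tensor_ring_simps] S.M.zero_closed])
          (use 0 in \<open>simp add: product_module_simps(2)\<close>)
    qed
    then have ker: "{v \<in> carrier ?G. \<forall>k\<in>{..N}. f v k = \<zero>\<^bsub>P k\<^esub>} = kernel_of ?F (regular_module ?T) f"
      by (auto simp: eq regular_module_simps)
    show "fg_subset ?T ?F (kernel_of ?F (regular_module ?T) f)"
    proof (rule fg_subset_image[OF G.left_module_axioms F.left_module_axioms _ _ _ fg, where \<sigma> = "scalar_embedding N" and q = "\<lambda>v. v"])
      show "(\<lambda>v. v) \<in> additive_hom ?G ?F" by (rule additive_homI) (simp_all add: eq)
      show "r \<odot>\<^bsub>?G\<^esub> v = scalar_embedding N r \<odot>\<^bsub>?F\<^esub> v" if "r \<in> carrier R" "v \<in> carrier ?G" for r v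
        using that by (simp add: eq smult)
    qed (use emb ker in auto)
  qed
  then show ?thesis using left_coherent_iff[OF ring_tensor_ring] by simp
qed

end

theorem theorem2:
  fixes R :: "'r ring" and M :: "('r, 'm) bimodule" and N :: nat
  assumes "ring R" and "\<one>\<^bsub>R\<^esub> \<noteq> \<zero>\<^bsub>R\<^esub>"
    and "bimodule R M" and "nilpotent_bimodule R M N"
  shows "(finitely_generated R M \<and> left_coherent (tensor_ring R M N)
           \<longrightarrow> finitely_presented R M \<and> left_coherent R) \<and>
         (flat_right_module R (op_module M) \<longrightarrow>
           (finitely_generated R M \<and> left_coherent (tensor_ring R M N)
             \<longleftrightarrow> finitely_presented R M \<and> left_coherent R))"
proof -
  interpret bimodule R M by fact
  have fp: "finitely_presented R M \<longleftrightarrow> finitely_generated R M \<and> pseudo_coherent R M" if "left_coherent R"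
    using finitely_presented_iff_pseudo_coherent[OF left_module_axioms] that left_coherent_iff[OF assms(1)] by simp
  have "finitely_generated R M \<and> left_coherent (tensor_ring R M N)
      \<longleftrightarrow> finitely_presented R M \<and> left_coherent R"
  proof
    assume *: "finitely_generated R M \<and> left_coherent (tensor_ring R M N)"
    then have "left_coherent R" by (blast intro: left_coherent_base)
    with * show "finitely_presented R M \<and> left_coherent R"
      using fp pseudo_coherent_bimodule[OF _ assms(4)] by simp
  next
    assume "finitely_presented R M \<and> left_coherent R"
    then show "finitely_generated R M \<and> left_coherent (tensor_ring R M N)"
      using fp left_coherent_tensor_ring finitely_generated_iff[OF left_module_axioms] by simp
  qed
  then show ?thesis by blast
qed

end
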